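(* Assume that $g$, $W$ and $\sigma$ satisfy the standing assumptions listed in the context. For every $L\in\mathbb{R}$ and $p\in\mathbb{R}^N$, there exists a unique viscosity solution $w\in C_b(\mathbb{R}^+\times\mathbb{R}^N)$ of $$\begin{cases}\partial_\tau w=\mathcal{I}_1[w(\tau,\cdot)]+L-W'(w+p\cdot y)+\sigma(\tau,y)&\text{in }\mathbb{R}^+\times\mathbb{R}^N,\\ w(0,y)=0&\text{on }\mathbb{R}^N,\end{cases}$$ and there exists a unique $\lambda\in\mathbb{R}$ such that $\frac{w(\tau,y)}{\tau}$ converges towards $\lambda$ as $\tau\to+\infty$, locally uniformly in $y$. Denote this real number $\lambda$ by $\overline{H}(p,L)$. Then the function $\overline{H}$ is continuous on $\mathbb{R}^N\times\mathbb{R}$ and non-decreasing in $L$.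
   Context: Standing assumptions ($N\ge 1$): (H1) $g\in C(\mathbf{S}^{N-1})$, $g>0$, $g$ even ($g(-z)=g(z)$); (H2) $W\in C^{1,1}(\mathbb{R})$ and $W(v+1)=W(v)$ for all $v\in\mathbb{R}$; (H3) $\sigma\in C^{0,1}(\mathbb{R}^+\times\mathbb{R}^N)$ and $\sigma(t+1,x)=\sigma(t,x)$, $\sigma(t,x+k)=\sigma(t,x)$ for all $k\in\mathbb{Z}^N$, $(t,x)\in\mathbb{R}^+\times\mathbb{R}^N$. (The paper also lists (H4) $u_0\in W^{2,\infty}(\mathbb{R}^N)$, an assumption on an initial datum $u_0$ that does not occur in this statement.) Operator: put $\mu(dz)=\frac{1}{|z|^{N+1}}g\left(\frac{z}{|z|}\right)dz$ on $\mathbb{R}^N\setminus\{0\}$ and, for $r>0$, $$\mathcal{I}_1^{1,r}[U,x]=\int_{|z|\le r}(U(x+z)-U(x)-\nabla U(x)\cdot z)\,\mu(dz),\qquad \mathcal{I}_1^{2,r}[U,x]=\int_{|z|>r}(U(x+z)-U(x))\,\mu(dz),$$ and $\mathcal{I}_1[U](x)=\mathcal{I}_1^{1,r}[U,x]+\mathcal{I}_1^{2,r}[U,x]$ (independent of $r$ since $g$ is even). Function spaces: functions are defined for times $t\ge 0$. $USC_b(\mathbb{R}^+\times\mathbb{R}^N)$ (resp. $LSC_b$) is the set of upper (resp. lower) semicontinuous functions on $\mathbb{R}^+\times\mathbb{R}^N$ that are bounded on $(0,T)\times\mathbb{R}^N$ for every $T>0$, and $C_b=USC_b\cap LSC_b$.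 Viscosity solutions: consider $u_t=F(t,x,u,\nabla_x u,\mathcal{I}_1[u(t,\cdot)])$ in $\mathbb{R}^+\times\mathbb{R}^N$, $u(0,x)=u_0(x)$, with $F$ continuous and non-decreasing in its last argument. Fix $r>0$ (the notion does not depend on $r$). $u\in USC_b$ (resp. $u\in LSC_b$) is a viscosity subsolution (resp. supersolution) if $u(0,x)\le (u_0)^*(x)$ (resp. $u(0,x)\ge (u_0)_*(x)$), where $^*,{}_*$ denote semicontinuous envelopes, and for every $(t_0,x_0)$ with $t_0>0$, every $\tau\in(0,t_0)$ and every $\phi\in C^2(\mathbb{R}^+\times\mathbb{R}^N)$ such that $u-\phi$ attains a maximum (resp. minimum) over $(t_0-\tau,t_0+\tau)\times B_r(x_0)$ at $(t_0,x_0)$, $$\partial_t\phi(t_0,x_0)-F\big(t_0,x_0,u(t_0,x_0),\nabla_x\phi(t_0,x_0),\mathcal{I}_1^{1,r}[\phi(t_0,\cdot),x_0]+\mathcal{I}_1^{2,r}[u(t_0,\cdot),x_0]\big)\le 0\quad(\text{resp. }\ge 0).$$ A viscosity solution is a function in $C_b$ which is both a sub- and a supersolution. *)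

theory Defs
  imports "HOL-Analysis.Analysis"
begin

section \<open>Function spaces\<close>

text \<open>Space-time $\mathbf{R}^+ \times \mathbf{R}^N$; times are $t \ge 0$. A function on it is a total
  function on \<^typ>\<open>real \<times> (real^'n)\<close> whose values at negative times are never inspected.\<close>

definition space_time :: "(real \<times> (real^'n)) set" where
  "space_time = {0..} \<times> UNIV"

definition upper_semicontinuous_on :: "'a::topological_space set \<Rightarrow> ('a \<Rightarrow> real) \<Rightarrow> bool" where
  "upper_semicontinuous_on S f \<longleftrightarrow>
     (\<forall>x\<in>S. \<forall>e>0. \<forall>\<^sub>F y in at x within S. f y < f x + e)"

definition lower_semicontinuous_on :: "'a::topological_space set \<Rightarrow> ('a \<Rightarrow> real) \<Rightarrow> bool" where
  "lower_semicontinuous_on S f \<longleftrightarrow>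
     (\<forall>x\<in>S. \<forall>e>0. \<forall>\<^sub>F y in at x within S. f y > f x - e)"

definition USC_b :: "(real \<times> (real^'n) \<Rightarrow> real) set" where
  "USC_b = {u. upper_semicontinuous_on space_time u \<and>
               (\<forall>T>0. bounded (u ` ({0<..<T} \<times> UNIV)))}"

definition LSC_b :: "(real \<times> (real^'n) \<Rightarrow> real) set" where
  "LSC_b = {u. lower_semicontinuous_on space_time u \<and>
               (\<forall>T>0. bounded (u ` ({0<..<T} \<times> UNIV)))}"

definition C_b :: "(real \<times> (real^'n) \<Rightarrow> real) set" where
  "C_b = USC_b \<inter> LSC_b"

text \<open>Twice continuously differentiable on \<^term>\<open>S\<close>. Derivatives are taken within \<^term>\<open>S\<close>,
  hence one-sided in time at $t = 0$ when \<^term>\<open>S\<close> is space-time.\<close>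

definition C2_on :: "'a::real_normed_vector set \<Rightarrow> ('a \<Rightarrow> real) \<Rightarrow> bool" where
  "C2_on S f \<longleftrightarrow>
     (\<exists>(D :: 'a \<Rightarrow> 'a \<Rightarrow>\<^sub>L real) (D2 :: 'a \<Rightarrow> 'a \<Rightarrow>\<^sub>L ('a \<Rightarrow>\<^sub>L real)).
        (\<forall>x\<in>S. (f has_derivative blinfun_apply (D x)) (at x within S)) \<and>
        (\<forall>x\<in>S. (D has_derivative blinfun_apply (D2 x)) (at x within S)) \<and>
        continuous_on S D2)"

definition gradient :: "('a::real_inner \<Rightarrow> real) \<Rightarrow> 'a \<Rightarrow> 'a" where
  "gradient f x = (THE D. GDERIV f x :> D)"


section \<open>Nonlocal operators\<close>

text \<open>The measure $\mu(dz) = |z|^{-N-1} g(z/|z|)\,dz$ on $\mathbf{R}^N \setminus \{0\}$. The density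
  vanishes at the origin because division by zero yields zero.\<close>

definition levy_measure :: "(real^'n \<Rightarrow> real) \<Rightarrow> (real^'n) measure" where
  "levy_measure g =
     density lborel (\<lambda>z. ennreal (g (z /\<^sub>R norm z) / norm z ^ (CARD('n) + 1)))"

definition I1_inner :: "(real^'n \<Rightarrow> real) \<Rightarrow> real \<Rightarrow> (real^'n \<Rightarrow> real) \<Rightarrow> real^'n \<Rightarrow> real" where
  "I1_inner g r U x =
     (LINT z:{z. norm z \<le> r}|levy_measure g. U (x + z) - U x - gradient U x \<bullet> z)"

definition I1_outer :: "(real^'n \<Rightarrow> real) \<Rightarrow> real \<Rightarrow> (real^'n \<Rightarrow> real) \<Rightarrow> real^'n \<Rightarrow> real" where
  "I1_outer g r U x = (LINT z:{z. norm z > r}|levy_measure g. U (x + z) - U x)"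


section \<open>Viscosity solutions\<close>

text \<open>Sub- and supersolutions of
  $u_t = F(t, x, u, \nabla_x u, \mathcal{I}_1[u(t,\cdot)])$, $u(0,\cdot) = u_0$.
  The nonlocal term is split at radius \<^term>\<open>r\<close>: the singular part is evaluated on the test
  function, the rest on $u$. The semicontinuous envelopes of $u_0$ at $x$ are its upper and lower
  limits along the full neighbourhood filter \<^term>\<open>nhds x\<close>, which includes $x$ itself;
  they may be infinite for general $u_0$.\<close>

definition viscosity_subsolution ::
  "(real^'n \<Rightarrow> real) \<Rightarrow> real \<Rightarrow> (real \<Rightarrow> real^'n \<Rightarrow> real \<Rightarrow> real^'n \<Rightarrow> real \<Rightarrow> real) \<Rightarrow>
   (real^'n \<Rightarrow> real) \<Rightarrow> (real \<times> (real^'n) \<Rightarrow> real) \<Rightarrow> bool" where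
  "viscosity_subsolution g r F u0 u \<longleftrightarrow>
     u \<in> USC_b \<and>
     (\<forall>x. ereal (u (0, x)) \<le> Limsup (nhds x) (\<lambda>y. ereal (u0 y))) \<and>
     (\<forall>t0>0. \<forall>x0. \<forall>\<tau>\<in>{0<..<t0}. \<forall>\<phi>.
        C2_on space_time \<phi> \<longrightarrow>
        (\<forall>q \<in> {t0 - \<tau><..<t0 + \<tau>} \<times> ball x0 r. u q - \<phi> q \<le> u (t0, x0) - \<phi> (t0, x0)) \<longrightarrow>
        deriv (\<lambda>t. \<phi> (t, x0)) t0
          - F t0 x0 (u (t0, x0)) (gradient (\<lambda>x. \<phi> (t0, x)) x0)
              (I1_inner g r (\<lambda>x. \<phi> (t0, x)) x0 + I1_outer g r (\<lambda>x. u (t0, x)) x0) \<le> 0)"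

definition viscosity_supersolution ::
  "(real^'n \<Rightarrow> real) \<Rightarrow> real \<Rightarrow> (real \<Rightarrow> real^'n \<Rightarrow> real \<Rightarrow> real^'n \<Rightarrow> real \<Rightarrow> real) \<Rightarrow>
   (real^'n \<Rightarrow> real) \<Rightarrow> (real \<times> (real^'n) \<Rightarrow> real) \<Rightarrow> bool" where
  "viscosity_supersolution g r F u0 u \<longleftrightarrow>
     u \<in> LSC_b \<and>
     (\<forall>x. ereal (u (0, x)) \<ge> Liminf (nhds x) (\<lambda>y. ereal (u0 y))) \<and>
     (\<forall>t0>0. \<forall>x0. \<forall>\<tau>\<in>{0<..<t0}. \<forall>\<phi>.
        C2_on space_time \<phi> \<longrightarrow>
        (\<forall>q \<in> {t0 - \<tau><..<t0 + \<tau>} \<times> ball x0 r. u q - \<phi> q \<ge> u (t0, x0) - \<phi> (t0, x0)) \<longrightarrow>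
        deriv (\<lambda>t. \<phi> (t, x0)) t0
          - F t0 x0 (u (t0, x0)) (gradient (\<lambda>x. \<phi> (t0, x)) x0)
              (I1_inner g r (\<lambda>x. \<phi> (t0, x)) x0 + I1_outer g r (\<lambda>x. u (t0, x)) x0) \<ge> 0)"

definition viscosity_solution ::
  "(real^'n \<Rightarrow> real) \<Rightarrow> real \<Rightarrow> (real \<Rightarrow> real^'n \<Rightarrow> real \<Rightarrow> real^'n \<Rightarrow> real \<Rightarrow> real) \<Rightarrow>
   (real^'n \<Rightarrow> real) \<Rightarrow> (real \<times> (real^'n) \<Rightarrow> real) \<Rightarrow> bool" where
  "viscosity_solution g r F u0 u \<longleftrightarrow>
     u \<in> C_b \<and> viscosity_subsolution g r F u0 u \<and> viscosity_supersolution g r F u0 u"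


section \<open>The cell problem and the effective Hamiltonian\<close>

definition cell_solution ::
  "(real^'n \<Rightarrow> real) \<Rightarrow> (real \<Rightarrow> real) \<Rightarrow> (real \<times> (real^'n) \<Rightarrow> real) \<Rightarrow> real \<Rightarrow>
   real^'n \<Rightarrow> real \<Rightarrow> (real \<times> (real^'n) \<Rightarrow> real) \<Rightarrow> bool" where
  "cell_solution g W \<sigma> r p L w \<longleftrightarrow>
     viscosity_solution g r
       (\<lambda>\<tau> y v q l. l + L - deriv W (v + p \<bullet> y) + \<sigma> (\<tau>, y)) (\<lambda>y. 0) w"

definition has_growth_rate :: "(real \<times> (real^'n) \<Rightarrow> real) \<Rightarrow> real \<Rightarrow> bool" where
  "has_growth_rate w l \<longleftrightarrow>
     (\<forall>K. compact K \<longrightarrow> uniform_limit K (\<lambda>\<tau> y. w (\<tau>, y) / \<tau>) (\<lambda>y. l) at_top)"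

definition effective_hamiltonian ::
  "(real^'n \<Rightarrow> real) \<Rightarrow> (real \<Rightarrow> real) \<Rightarrow> (real \<times> (real^'n) \<Rightarrow> real) \<Rightarrow> real \<Rightarrow>
   real^'n \<Rightarrow> real \<Rightarrow> real" where
  "effective_hamiltonian g W \<sigma> r p L =
     (THE l. \<exists>w. cell_solution g W \<sigma> r p L w \<and> has_growth_rate w l)"

end

theory Submission
  imports Defs
begin

text \<open>
The cell equation is semilinear with a translation invariant operator, so neither Perron's method
nor doubling of variables is needed. Truncating the jump measure to \<open>|z| > \<delta>\<close> leaves a finite
measure, for which the explicit Euler scheme is monotone under a CFL condition; its iterates are
Lipschitz in time and space with constants independent of \<open>\<delta>\<close> and of the time step. Mollifying
the iterates gives \<open>C\<^sup>2\<close> functions that solve the original equation up to an arbitrarily small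
error: the commutator with the nonlinearity is controlled by the Lipschitz bounds, and the removed
small jumps contribute \<open>O(\<delta>)\<close> times a bound on second derivatives that does not depend on \<open>\<delta>\<close>.
Such a function, enlarged by a growing barrier, is itself an admissible test function, hence any
viscosity subsolution can be compared with it directly. This yields the convergence of the
approximations, the uniqueness of the solution and its continuous dependence on \<open>p\<close> and \<open>L\<close>.

For the ergodic part one works with the monotone scheme. Since \<open>p \<bullet> k\<close> can be rounded to an integer,
shifting the solution by a lattice vector \<open>k\<close> changes it by at most 1. The jump measure has a
positive density, so the jumps from two points of the same unit cell have a common part of positive
mass, which makes the oscillation contract. The resulting oscillation bound does not depend on \<open>p\<close>
and \<open>L\<close>; with the periodicity in time it makes \<open>w(n, 0)\<close> quasi-additive in \<open>n\<close>, so that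
\<open>w(n, 0) - n \<lambda>\<close> is bounded uniformly in \<open>p\<close> and \<open>L\<close>, and \<open>\<lambda>\<close> is a uniform limit of continuous
functions.
\<close>

section \<open>Moments of the jump measure\<close>

text \<open>The kernel has order exactly one: near the origin it integrates squares but not
  \<open>norm z\<close>, and its tail has no first moment. Barriers must therefore grow slower than
  linearly. Because of \<open>p \<bullet> y\<close> the right-hand side is not periodic in
  \<open>y\<close>, so comparison takes place on the whole space. A change of \<open>p\<close>
  perturbs the equation by an amount that grows with \<open>y\<close> before it saturates; against a
  logarithmic weight it is small everywhere, since \<open>deriv W\<close> has bounded oscillation.
  The parameters must be fixed in the order mollification width, truncation radius, time step: the
  Hessian bound depends on the width and the horizon, the truncation error is that bound times the
  radius, and the CFL condition ties the step to the mass outside the radius. Each solution is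
  recorded in two ways along one sequence. \<open>limit_solution\<close> carries smooth
  approximations with error rates, for comparison; \<open>scheme_limit\<close> carries the Euler
  iterates, for which lattice shifts and overlapping jumps are exact computations. The Lipschitz
  constants of the iterates grow exponentially in time and depend on \<open>p\<close>; they never
  enter the long-time estimate.\<close>

definition levy_density :: "(real^'n \<Rightarrow> real) \<Rightarrow> real^'n \<Rightarrow> real" where
  "levy_density g z = g (z /\<^sub>R norm z) / norm z ^ (CARD('n) + 1)"

lemma levy_measure_eq: "levy_measure g = density lborel (\<lambda>z. ennreal (levy_density g z))"
  by (simp add: levy_measure_def levy_density_def)

text \<open>Integrable majorant of both kinds of increments: second-order ones up to the splitting
  radius \<open>s\<close>, increments of order \<open>sqrt (norm z)\<close> beyond it. The exponent
  1/2 stands for any exponent below one.\<close>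

definition levy_weight :: "real \<Rightarrow> real^'n \<Rightarrow> real" where
  "levy_weight s z = (if norm z \<le> s then (norm z)\<^sup>2 else 1 + sqrt (norm z))"

text \<open>The least \<open>k\<close> whose inner radius falls below \<open>a\<close> works: the
  preceding inner radius is the outer radius of this shell, and minimality puts \<open>a\<close>
  below it.\<close>

lemma dyadic_shell_inner:
  fixes a s :: real
  assumes "0 < a" "a \<le> s"
  shows "\<exists>k. s / 2^k / 2 < a \<and> a \<le> s / 2^k"
proof -
  have "\<exists>k. s / 2^k / 2 < a"
  proof -
    obtain k where "(1/2)^k < a / s"
      using real_arch_pow_inv[of "a/s" "1/2"] assms by auto
    then have "s / 2^k < a" using assms by (simp add: field_simps power_divide)
    moreover have "s / 2^k / 2 \<le> s / 2^k" using assms by (intro divide_left_mono[where b=1, simplified] | simp add: divide_le_eq)+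
    ultimately have "s / 2^k / 2 < a" by linarith
    then show ?thesis by blast
  qed
  then obtain k where k: "s / 2^k / 2 < a" "\<And>j. j < k \<Longrightarrow> \<not> s / 2^j / 2 < a"
    using exists_least_iff[of "\<lambda>k. s / 2^k / 2 < a"] by blast
  have "a \<le> s / 2^k"
  proof (cases k)
    case 0 then show ?thesis using assms by simp
  next
    case (Suc j) then show ?thesis using k(2)[of j] by (simp add: not_less field_simps)
  qed
  with k show ?thesis by blast
qed

text \<open>The exponent starts at \<open>Suc k\<close> so that the first shell is the one between
  \<open>s\<close> and \<open>2 * s\<close>; again the least admissible \<open>k\<close> is
  taken.\<close>

lemma dyadic_shell_outer:
  fixes a s :: real
  assumes "0 < s" "s < a"
  shows "\<exists>k. s * 2^Suc k / 2 < a \<and> a \<le> s * 2^Suc k"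
proof -
  have "\<exists>k. a \<le> s * 2^Suc k"
  proof -
    obtain k where "a / s < 2^k" using real_arch_pow[of 2 "a/s"] by auto
    then have "a < s * 2^k" using assms by (simp add: field_simps)
    also have "\<dots> \<le> s * 2^Suc k" using assms by simp
    finally show ?thesis by (intro exI[of _ k]) simp
  qed
  then obtain k where k: "a \<le> s * 2^Suc k" "\<And>j. j < k \<Longrightarrow> \<not> a \<le> s * 2^Suc j"
    using exists_least_iff[of "\<lambda>k. a \<le> s * 2^Suc k"] by blast
  have "s * 2^k < a"
  proof (cases k)
    case 0 then show ?thesis using assms by simp
  next
    case (Suc j) then show ?thesis using k(2)[of j] by (simp add: not_le)
  qed
  with k show ?thesis by (intro exI[of _ k]) simp
qed

lemma lborel_distr_uminus_euclidean:
  "distr lborel borel uminus = (lborel :: 'a::euclidean_space measure)"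
  by (subst lborel_affine[of "-1" 0]) (auto simp: density_1)

locale levy_kernel =
  fixes g :: "real^'n \<Rightarrow> real"
  assumes g_continuous: "continuous_on (sphere 0 1) g"
    and g_positive: "\<forall>z \<in> sphere 0 1. g z > 0"
    and g_even: "\<forall>z \<in> sphere 0 1. g (- z) = g z"
begin

lemma levy_density_measurable [measurable]: "levy_density g \<in> borel_measurable borel"
proof (rule borel_measurable_continuous_countable_exceptions[of "{0}"])
  show "continuous_on (- {0}) (levy_density g)"
    unfolding levy_density_def
    by (intro continuous_intros continuous_on_compose2[OF g_continuous]) (auto simp: field_simps split: if_splits)
qed simp

lemma levy_density_nonneg: "levy_density g z \<ge> 0"
proof (cases "z = 0")
  case False
  then have "z /\<^sub>R norm z \<in> sphere 0 1" by simp
  with g_positive have "g (z /\<^sub>R norm z) > 0" by blast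
  then show ?thesis unfolding levy_density_def by simp
qed (simp add: levy_density_def)

lemma levy_density_even: "levy_density g (- z) = levy_density g z"
proof (cases "z = 0")
  case False
  then have "z /\<^sub>R norm z \<in> sphere 0 1" by simp
  with g_even have "g (- (z /\<^sub>R norm z)) = g (z /\<^sub>R norm z)" by blast
  then show ?thesis by (simp add: levy_density_def)
qed simp

lemma sets_levy [simp, measurable_cong]: "sets (levy_measure g) = sets borel"
  by (simp add: levy_measure_def)

lemma space_levy [simp]: "space (levy_measure g) = UNIV"
  by (simp add: levy_measure_def)

lemma levy_integral:
  fixes f :: "real^'n \<Rightarrow> real"
  assumes [measurable]: "f \<in> borel_measurable borel"
  shows "integral\<^sup>L (levy_measure g) f = (\<integral>z. levy_density g z * f z \<partial>lborel)"
  unfolding levy_measure_eq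
  by (subst integral_density) (auto simp: levy_density_nonneg)

text \<open>Reflection turns the integral into its own negative. This also covers non-integrable
  \<open>f\<close>, whose integral is 0 by convention.\<close>

lemma levy_integral_odd:
  fixes f :: "real^'n \<Rightarrow> real"
  assumes [measurable]: "f \<in> borel_measurable borel" and odd: "\<And>z. f (- z) = - f z"
  shows "integral\<^sup>L (levy_measure g) f = 0"
proof -
  have "(\<integral>z. levy_density g z * f z \<partial>lborel) = (\<integral>z. levy_density g z * f z \<partial>distr lborel borel uminus)"
    by (simp add: lborel_distr_uminus_euclidean)
  also have "\<dots> = (\<integral>z. levy_density g (-z) * f (-z) \<partial>lborel)"
    by (subst integral_distr) auto
  also have "\<dots> = - (\<integral>z. levy_density g z * f z \<partial>lborel)"
    by (simp add: levy_density_even odd)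
  finally show ?thesis by (simp add: levy_integral)
qed

text \<open>By compactness \<open>g\<close> has a positive minimum on the sphere. This lower bound
  is what later makes the jumps from two different points overlap.\<close>

lemma levy_lower:
  assumes "0 < R"
  obtains c where "c > 0" "\<And>z. z \<noteq> 0 \<Longrightarrow> norm z \<le> R \<Longrightarrow> levy_density g z \<ge> c"
proof -
  have ne: "(sphere 0 1 :: (real^'n) set) \<noteq> {}" by simp
  obtain z0 where z0: "z0 \<in> sphere 0 1" "\<And>z. z \<in> sphere 0 1 \<Longrightarrow> g z0 \<le> g z"
    using continuous_attains_inf[OF compact_sphere ne g_continuous] by blast
  have pos: "g z0 > 0" using g_positive z0 by blast
  have "levy_density g z \<ge> g z0 / R ^ (CARD('n) + 1)" if "z \<noteq> 0" "norm z \<le> R" for z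
  proof -
    have "z /\<^sub>R norm z \<in> sphere 0 1" using that by simp
    then have "g z0 \<le> g (z /\<^sub>R norm z)" using z0 by blast
    then show ?thesis unfolding levy_density_def
      using that pos assms by (intro frac_le power_mono) auto
  qed
  then show ?thesis using that[of "g z0 / R ^ (CARD('n) + 1)"] pos assms by simp
qed

text \<open>Scaling: a shell of radius \<open>R\<close> has volume of order \<open>R ^ N\<close> and
  density of order \<open>R ^ (- N - 1)\<close>, where \<open>N\<close> is the dimension. All
  moments below are dyadic sums of this bound.\<close>

lemma levy_shell:
  obtains A where "A \<ge> 0"
    "\<And>R. R > 0 \<Longrightarrow> emeasure (levy_measure g) {z. R / 2 < norm z \<and> norm z \<le> R} \<le> ennreal (A / R)"
proof -
  have ne: "(sphere 0 1 :: (real^'n) set) \<noteq> {}" by simp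
  obtain z0 where z0: "z0 \<in> sphere 0 1" "\<And>z. z \<in> sphere 0 1 \<Longrightarrow> g z \<le> g z0"
    using continuous_attains_sup[OF compact_sphere ne g_continuous] by blast
  have pos: "g z0 > 0" using g_positive z0 by blast
  define om where "om = unit_ball_vol (real CARD('n))"
  have om: "om \<ge> 0" unfolding om_def by (intro unit_ball_vol_nonneg) simp
  have "emeasure (levy_measure g) {z. R / 2 < norm z \<and> norm z \<le> R}
      \<le> ennreal (g z0 * om * 2 ^ (CARD('n) + 1) / R)" if R: "R > 0" for R
  proof -
    have "emeasure (levy_measure g) {z. R / 2 < norm z \<and> norm z \<le> R}
      = (\<integral>\<^sup>+z. ennreal (levy_density g z) * indicator {z. R / 2 < norm z \<and> norm z \<le> R} z \<partial>lborel)"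
      unfolding levy_measure_eq by (subst emeasure_density) auto
    also have "\<dots> \<le> (\<integral>\<^sup>+z. ennreal (g z0 / (R / 2) ^ (CARD('n) + 1)) * indicator (cball (0::real^'n) R) z \<partial>lborel)"
    proof (intro nn_integral_mono)
      fix z :: "real^'n"
      have "levy_density g z \<le> g z0 / (R / 2) ^ (CARD('n) + 1)" if z: "R / 2 < norm z"
      proof -
        have "z \<noteq> 0" using z R by auto
        then have "z /\<^sub>R norm z \<in> sphere 0 1" by simp
        then have "g (z /\<^sub>R norm z) \<le> g z0" using z0 by blast
        then show ?thesis unfolding levy_density_def
          using z pos R by (intro frac_le power_mono) auto
      qed
      then show "ennreal (levy_density g z) * indicator {z. R / 2 < norm z \<and> norm z \<le> R} z
        \<le> ennreal (g z0 / (R / 2) ^ (CARD('n) + 1)) * indicator (cball (0::real^'n) R) z"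
        by (auto split: split_indicator intro!: ennreal_leI)
    qed
    also have "\<dots> = ennreal (g z0 / (R / 2) ^ (CARD('n) + 1)) * ennreal (om * R ^ CARD('n))"
      using R by (simp add: nn_integral_cmult_indicator emeasure_cball om_def)
    also have "\<dots> = ennreal (g z0 / (R / 2) ^ (CARD('n) + 1) * (om * R ^ CARD('n)))"
      using R om pos by (intro ennreal_mult[symmetric]) auto
    also have "g z0 / (R / 2) ^ (CARD('n) + 1) * (om * R ^ CARD('n)) = g z0 * om * 2 ^ (CARD('n) + 1) / R"
      using R by (simp add: field_simps power_divide)
    finally show ?thesis .
  qed
  then show ?thesis using that[of "g z0 * om * 2 ^ (CARD('n) + 1)"] pos om by simp
qed

text \<open>Overlapping shells do no harm: pointwise \<open>b z\<close> is dominated by a single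
  term of the series, hence by its sum.\<close>

lemma nn_integral_le_shells:
  fixes b :: "real^'n \<Rightarrow> real" and \<beta> R :: "nat \<Rightarrow> real"
  assumes A: "A \<ge> 0"
    "\<And>R. R > 0 \<Longrightarrow> emeasure (levy_measure g) {z. R / 2 < norm z \<and> norm z \<le> R} \<le> ennreal (A / R)"
    and R: "\<And>k. R k > 0" and \<beta>: "\<And>k. \<beta> k \<ge> 0"
    and shell: "\<And>z. b z \<noteq> 0 \<Longrightarrow> \<exists>k. R k / 2 < norm z \<and> norm z \<le> R k \<and> b z \<le> \<beta> k"
    and sm: "(\<lambda>k. \<beta> k * (A / R k)) sums S"
  shows "(\<integral>\<^sup>+z. ennreal (b z) \<partial>levy_measure g) \<le> ennreal S"
proof -
  let ?I = "\<lambda>k z. ennreal (\<beta> k) * indicator {z. R k / 2 < norm z \<and> norm z \<le> R k} (z::real^'n)"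
  have "(\<integral>\<^sup>+z. ennreal (b z) \<partial>levy_measure g) \<le> (\<integral>\<^sup>+z. (\<Sum>k. ?I k z) \<partial>levy_measure g)"
  proof (intro nn_integral_mono)
    fix z :: "real^'n"
    show "ennreal (b z) \<le> (\<Sum>k. ?I k z)"
    proof (cases "b z = 0")
      case False
      then obtain k where k: "R k / 2 < norm z" "norm z \<le> R k" "b z \<le> \<beta> k" using shell by blast
      then have "ennreal (b z) \<le> ?I k z" by (simp add: ennreal_leI)
      also have "\<dots> \<le> (\<Sum>k. ?I k z)"
        using sum_le_suminf[of "\<lambda>k. ?I k z" "{k}"] by (simp only: sum.insert finite.emptyI finite_insert empty_iff sum.empty add_0_right summableI zero_le if_False simp_thms)
      finally show ?thesis .
    qed simp
  qed
  also have "\<dots> = (\<Sum>k. \<integral>\<^sup>+z. ?I k z \<partial>levy_measure g)"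
    by (intro nn_integral_suminf) auto
  also have "\<dots> \<le> (\<Sum>k. ennreal (\<beta> k * (A / R k)))"
  proof (intro suminf_le)
    fix k
    have "(\<integral>\<^sup>+z. ?I k z \<partial>levy_measure g)
      = ennreal (\<beta> k) * emeasure (levy_measure g) {z. R k / 2 < norm z \<and> norm z \<le> R k}"
      by (intro nn_integral_cmult_indicator) auto
    also have "\<dots> \<le> ennreal (\<beta> k) * ennreal (A / R k)"
      by (intro mult_left_mono A R) simp
    also have "\<dots> = ennreal (\<beta> k * (A / R k))"
      using R[of k] \<beta>[of k] A(1) by (intro ennreal_mult[symmetric]) (auto intro: divide_nonneg_pos)
    finally show "(\<integral>\<^sup>+z. ?I k z \<partial>levy_measure g) \<le> ennreal (\<beta> k * (A / R k))" .
  qed auto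
  also have "\<dots> = ennreal S"
  proof (rule suminf_ennreal_eq[OF _ sm])
    show "\<And>i. 0 \<le> \<beta> i * (A / R i)" using R \<beta> A(1) by (simp add: less_imp_le)
  qed
  finally show ?thesis .
qed

text \<open>Shell \<open>k\<close> contributes at most
  \<open>(s / 2^k)\<^sup>2 * A / (s / 2^k)\<close>, a geometric series of order \<open>s\<close>.
  This rate is the cost of discarding the small jumps.\<close>

lemma levy_inner_small:
  obtains A where "A \<ge> 0"
    "\<And>s. s > 0 \<Longrightarrow> (\<integral>\<^sup>+z. ennreal (indicator (cball 0 s) z * (norm z)\<^sup>2) \<partial>levy_measure g) \<le> ennreal (A * s)"
proof -
  obtain A where A: "A \<ge> 0"
    "\<And>R. R > 0 \<Longrightarrow> emeasure (levy_measure g) {z. R / 2 < norm z \<and> norm z \<le> R} \<le> ennreal (A / R)"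
    using levy_shell by blast
  have "(\<integral>\<^sup>+z. ennreal (indicator (cball 0 s) z * (norm z)\<^sup>2) \<partial>levy_measure g) \<le> ennreal (2 * A * s)"
    if s: "s > 0" for s
  proof (rule nn_integral_le_shells[OF A, where R = "\<lambda>k. s / 2^k" and \<beta> = "\<lambda>k. (s / 2^k)\<^sup>2"])
    fix z :: "real^'n" assume "indicator (cball 0 s) z * (norm z)\<^sup>2 \<noteq> 0"
    then have z: "0 < norm z" "norm z \<le> s" by (auto simp: indicator_def)
    obtain k where k: "s / 2^k / 2 < norm z \<and> norm z \<le> s / 2^k" using dyadic_shell_inner[OF z] by blast
    then show "\<exists>k. s / 2^k / 2 < norm z \<and> norm z \<le> s / 2^k \<and> indicator (cball 0 s) z * (norm z)\<^sup>2 \<le> (s / 2^k)\<^sup>2"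
      by (intro exI[of _ k]) (auto simp: indicator_def intro!: power_mono)
  next
    have "(\<lambda>k. A * s * (1/2)^k) sums (A * s * 2)"
      using geometric_sums[of "1/2::real"] by (intro sums_mult) simp
    also have "(\<lambda>k. A * s * (1/2)^k) = (\<lambda>k. (s / 2^k)\<^sup>2 * (A / (s / 2^k)))"
      using s by (auto simp: fun_eq_iff field_simps power2_eq_square power_divide)
    finally show "(\<lambda>k. (s / 2^k)\<^sup>2 * (A / (s / 2^k))) sums (2 * A * s)" by (simp add: mult_ac)
  qed (use s in auto)
  then show ?thesis using that[of "2 * A"] A(1) by simp
qed

lemma levy_weight_measurable [measurable]: "levy_weight s \<in> borel_measurable borel"
  unfolding levy_weight_def by measurable

lemma levy_weight_nonneg: "levy_weight s z \<ge> 0"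
  by (simp add: levy_weight_def)

lemma integrable_levy_weight:
  assumes s: "s > 0"
  shows "integrable (levy_measure g) (levy_weight s)"
proof -
  obtain A where A: "A \<ge> 0"
    "\<And>R. R > 0 \<Longrightarrow> emeasure (levy_measure g) {z. R / 2 < norm z \<and> norm z \<le> R} \<le> ennreal (A / R)"
    using levy_shell by blast
  let ?o = "\<lambda>z. indicator (- cball 0 s) z * (1 + sqrt (norm (z::real^'n)))"
  let ?i = "\<lambda>z. indicator (cball 0 s) z * (norm (z::real^'n))\<^sup>2"
  define R where "R k = s * 2^Suc k" for k
  have sm: "summable (\<lambda>k. (1 + sqrt (R k)) * (A / R k))"
  proof -
    \<comment> \<open>The terms split into geometric sequences with ratios 1/2 and 1 / sqrt 2. A
      linearly growing weight would give terms that do not decay.\<close>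
    have "(1 + sqrt (R k)) * (A / R k) = (A / (2 * s)) * (1/2)^k + (A / sqrt (2 * s)) * (1 / sqrt 2)^k" for k
    proof -
      have Rk: "R k > 0" using s by (simp add: R_def)
      have "(1 + sqrt (R k)) * (A / R k) = A / R k + A / sqrt (R k)"
        using Rk by (simp add: field_simps) 
      moreover have "A / R k = (A / (2 * s)) * (1/2)^k" using s by (simp add: R_def field_simps power_divide)
      moreover from Rk have "sqrt (R k) = sqrt (2 * s) * sqrt 2 ^ k"
        by (simp add: R_def real_sqrt_mult real_sqrt_power mult_ac)
      then have "A / sqrt (R k) = (A / sqrt (2 * s)) * (1 / sqrt 2)^k" by (simp add: power_divide)
      ultimately show ?thesis by (simp only:)
    qed
    moreover have "summable (\<lambda>k. (A / (2 * s)) * (1/2)^k + (A / sqrt (2 * s)) * (1 / sqrt 2)^k)"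
      by (intro summable_add summable_mult summable_geometric) auto
    ultimately show ?thesis by simp
  qed
  have "(\<integral>\<^sup>+z. ennreal (?o z) \<partial>levy_measure g) \<le> ennreal (\<Sum>k. (1 + sqrt (R k)) * (A / R k))"
  proof (rule nn_integral_le_shells[OF A, where R = R and \<beta> = "\<lambda>k. 1 + sqrt (R k)"])
    fix z assume "?o z \<noteq> 0"
    then have z: "s < norm z" by (auto simp: indicator_def)
    obtain k where k: "s * 2^Suc k / 2 < norm z \<and> norm z \<le> s * 2^Suc k" using dyadic_shell_outer[OF s z] by blast
    then show "\<exists>k. R k / 2 < norm z \<and> norm z \<le> R k \<and> ?o z \<le> 1 + sqrt (R k)"
      using s unfolding R_def[symmetric]
      by (intro exI[of _ k]) (auto simp: indicator_def R_def)
  next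
    show "0 \<le> 1 + sqrt (R k)" for k using s by (simp add: R_def)
  qed (use s summable_sums[OF sm] in \<open>auto simp: R_def\<close>)
  then have o: "integrable (levy_measure g) ?o"
    unfolding integrable_iff_bounded by (auto simp: top.not_eq_extremum abs_mult intro: le_less_trans)
  obtain A' where A': "A' \<ge> 0"
    "\<And>s. s > 0 \<Longrightarrow> (\<integral>\<^sup>+z. ennreal (indicator (cball 0 s) z * (norm z)\<^sup>2) \<partial>levy_measure g) \<le> ennreal (A' * s)"
    using levy_inner_small by blast
  have "?i \<in> borel_measurable borel"
    by (intro borel_measurable_times borel_measurable_indicator borel_measurable_power borel_measurable_norm)
       auto
  with A'(2)[OF s] have i: "integrable (levy_measure g) ?i"
    unfolding integrable_iff_bounded by (auto simp: top.not_eq_extremum abs_mult intro: le_less_trans)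
  have "integrable (levy_measure g) (\<lambda>z. ?i z + ?o z)" using i o by (rule Bochner_Integration.integrable_add)
  also have "(\<lambda>z. ?i z + ?o z) = levy_weight s" by (auto simp: levy_weight_def indicator_def fun_eq_iff)
  finally show ?thesis .
qed

end

section \<open>Test functions and the nonlocal operator\<close>

lemma gradient_eq:
  assumes "(f has_derivative (\<lambda>h. d \<bullet> h)) (at x)"
  shows "gradient f x = d"
proof -
  have D: "GDERIV f x :> d" using assms by (simp add: gderiv_def inner_commute)
  show ?thesis unfolding gradient_def
  proof (rule the_equality[where P = "\<lambda>d. GDERIV f x :> d", OF D])
    fix d' assume "GDERIV f x :> d'"
    then have "(\<lambda>h. h \<bullet> d') = (\<lambda>h. h \<bullet> d)"
      using D has_derivative_unique unfolding gderiv_def by blast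
    then have "\<forall>h. h \<bullet> d' = h \<bullet> d" by (simp add: fun_eq_iff)
    then have "(d' - d) \<bullet> d' = (d' - d) \<bullet> d" by blast
    then have "(d' - d) \<bullet> (d' - d) = 0" by (simp only: inner_diff_right)
    then show "d' = d" by simp
  qed
qed

text \<open>\<open>C2_on\<close> asks for bounded linear functionals and an operator-valued second
  derivative; here both are obtained from a gradient field. Continuity in operator norm reduces to
  continuity of each \<open>G' q h\<close> because the space is finite-dimensional.\<close>

lemma C2_onI:
  fixes f :: "'a::euclidean_space \<Rightarrow> real" and G :: "'a \<Rightarrow> 'a"
  assumes f: "\<And>q. (f has_derivative (\<lambda>h. G q \<bullet> h)) (at q)"
    and G: "\<And>q. (G has_derivative G' q) (at q)"
    and cont: "\<And>h. continuous_on UNIV (\<lambda>q. G' q h)"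
  shows "C2_on S f"
proof -
  have bl: "bounded_linear (G' q)" for q using G has_derivative_bounded_linear by blast
  let ?D = "\<lambda>q. blinfun_inner_left (G q)"
  let ?D2 = "\<lambda>q. blinfun_compose (Blinfun (\<lambda>x. blinfun_inner_left x :: 'a \<Rightarrow>\<^sub>L real)) (Blinfun (G' q))"
  have bi: "bounded_linear (\<lambda>x. blinfun_inner_left x :: 'a \<Rightarrow>\<^sub>L real)"
    by (rule bounded_linear_blinfun_inner_left)
  show ?thesis unfolding C2_on_def
  proof (intro exI conjI ballI)
    show "(f has_derivative blinfun_apply (?D q)) (at q within S)" for q
      using has_derivative_at_withinI[OF f] by (simp add: blinfun_inner_left.rep_eq fun_eq_iff inner_commute)
    show "(?D has_derivative blinfun_apply (?D2 q)) (at q within S)" for q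
    proof -
      have "(?D has_derivative (\<lambda>h. blinfun_inner_left (G' q h))) (at q)"
        by (rule bounded_linear.has_derivative[OF bi G])
      moreover have "blinfun_apply (?D2 q) = (\<lambda>h. blinfun_inner_left (G' q h))"
        by (auto simp: fun_eq_iff bounded_linear_Blinfun_apply[OF bi] bounded_linear_Blinfun_apply[OF bl])
      ultimately have "(?D has_derivative blinfun_apply (?D2 q)) (at q)" by (simp only:)
      then show ?thesis by (rule has_derivative_at_withinI)
    qed
    have "continuous_on UNIV (\<lambda>q. Blinfun (G' q))"
      by (rule continuous_on_blinfun_componentwise)
         (simp add: bounded_linear_Blinfun_apply[OF bl] cont)
    then have "continuous_on UNIV ?D2" by (intro continuous_intros)
    then show "continuous_on S ?D2" using continuous_on_subset by blast
  qed
qed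

lemma C2_on_add:
  assumes "C2_on S f" "C2_on S g"
  shows "C2_on S (\<lambda>x. f x + g x)"
proof -
  obtain D D2 E E2 where *: "\<forall>x\<in>S. (f has_derivative blinfun_apply (D x)) (at x within S)"
    "\<forall>x\<in>S. (D has_derivative blinfun_apply (D2 x)) (at x within S)" "continuous_on S D2"
    "\<forall>x\<in>S. (g has_derivative blinfun_apply (E x)) (at x within S)"
    "\<forall>x\<in>S. (E has_derivative blinfun_apply (E2 x)) (at x within S)" "continuous_on S E2"
    using assms unfolding C2_on_def by metis
  show ?thesis unfolding C2_on_def
  proof (rule exI[of _ "\<lambda>x. D x + E x"], rule exI[of _ "\<lambda>x. D2 x + E2 x"], intro conjI ballI)
    fix x assume x: "x \<in> S"
    show "((\<lambda>x. f x + g x) has_derivative blinfun_apply (D x + E x)) (at x within S)"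
      using has_derivative_add[OF bspec[OF *(1) x] bspec[OF *(4) x]]
      by (rule has_derivative_eq_rhs) (simp add: fun_eq_iff plus_blinfun.rep_eq)
    show "((\<lambda>x. D x + E x) has_derivative blinfun_apply (D2 x + E2 x)) (at x within S)"
      using has_derivative_add[OF bspec[OF *(2) x] bspec[OF *(5) x]]
      by (rule has_derivative_eq_rhs) (simp add: fun_eq_iff plus_blinfun.rep_eq)
  next
    show "continuous_on S (\<lambda>x. D2 x + E2 x)" by (intro continuous_on_add *)
  qed
qed

lemma C2_on_minus:
  assumes "C2_on S f"
  shows "C2_on S (\<lambda>x. - f x)"
proof -
  obtain D D2 where *: "\<forall>x\<in>S. (f has_derivative blinfun_apply (D x)) (at x within S)"
    "\<forall>x\<in>S. (D has_derivative blinfun_apply (D2 x)) (at x within S)" "continuous_on S D2"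
    using assms unfolding C2_on_def by metis
  show ?thesis unfolding C2_on_def
  proof (rule exI[of _ "\<lambda>x. - D x"], rule exI[of _ "\<lambda>x. - D2 x"], intro conjI ballI)
    fix x assume x: "x \<in> S"
    show "((\<lambda>x. - f x) has_derivative blinfun_apply (- D x)) (at x within S)"
      using has_derivative_minus[OF bspec[OF *(1) x]]
      by (rule has_derivative_eq_rhs) (simp add: fun_eq_iff uminus_blinfun.rep_eq)
    show "((\<lambda>x. - D x) has_derivative blinfun_apply (- D2 x)) (at x within S)"
      using has_derivative_minus[OF bspec[OF *(2) x]]
      by (rule has_derivative_eq_rhs) (simp add: fun_eq_iff uminus_blinfun.rep_eq)
  next
    show "continuous_on S (\<lambda>x. - D2 x)" by (intro continuous_on_minus *)
  qed
qed

lemma linearization_bound: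
  fixes f :: "'a::euclidean_space \<Rightarrow> real" and G :: "'a \<Rightarrow> 'a"
  assumes K: "convex K" "a \<in> K" "b \<in> K"
    and f: "\<And>q. q \<in> K \<Longrightarrow> (f has_derivative (\<lambda>h. G q \<bullet> h)) (at q within K)"
    and G: "\<And>q q'. q \<in> K \<Longrightarrow> q' \<in> K \<Longrightarrow> norm (G q - G q') \<le> \<Lambda> * norm (q - q')"
  shows "\<bar>f b - f a - G a \<bullet> (b - a)\<bar> \<le> \<Lambda> * (norm (b - a))\<^sup>2"
proof -
  have seg: "closed_segment a b \<subseteq> K" using K closed_segment_subset by blast
  have "norm (f b - f a - G a \<bullet> (b - a)) \<le> norm (b - a) * (\<Lambda> * norm (b - a))"
  proof (rule differentiable_bound_linearization[of a b "closed_segment a b" f "\<lambda>q h. G q \<bullet> h" a])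
    show "a + t *\<^sub>R (b - a) \<in> closed_segment a b" if "t \<in> {0..1}" for t
      using that by (auto simp: closed_segment_def algebra_simps intro!: exI[of _ t])
    show "(f has_derivative (\<lambda>h. G q \<bullet> h)) (at q within closed_segment a b)" if "q \<in> closed_segment a b" for q
      using f that seg has_derivative_subset by blast
    show "onorm ((\<lambda>h. G q \<bullet> h) - (\<lambda>h. G a \<bullet> h)) \<le> \<Lambda> * norm (b - a)" if q: "q \<in> closed_segment a b" for q
    proof (rule onorm_le)
      fix h
      \<comment> \<open>\<open>\<Lambda>\<close> carries no sign condition; if \<open>b\<close>
        differs from \<open>a\<close>, the Lipschitz bound forces it to be nonnegative.\<close>
      have L: "\<Lambda> * norm (q - a) \<le> \<Lambda> * norm (b - a)"
      proof (cases "b = a")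
        case True then show ?thesis using q by simp
      next
        case False
        have "0 \<le> \<Lambda> * norm (b - a)" using G[OF K(3,2)] norm_ge_zero order_trans by blast
        then have "\<Lambda> \<ge> 0" using False by (simp add: zero_le_mult_iff)
        moreover have "norm (q - a) \<le> norm (b - a)" using q segment_bound(1) by blast
        ultimately show ?thesis by (rule mult_left_mono[rotated])
      qed
      have "norm (((\<lambda>h. G q \<bullet> h) - (\<lambda>h. G a \<bullet> h)) h) = \<bar>(G q - G a) \<bullet> h\<bar>"
        by (simp add: inner_diff_left)
      also have "\<dots> \<le> norm (G q - G a) * norm h" by (rule Cauchy_Schwarz_ineq2)
      also have "\<dots> \<le> \<Lambda> * norm (q - a) * norm h" using G q seg K by (intro mult_right_mono) auto
      also have "\<dots> \<le> \<Lambda> * norm (b - a) * norm h" using L by (intro mult_right_mono) auto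
      finally show "norm (((\<lambda>h. G q \<bullet> h) - (\<lambda>h. G a \<bullet> h)) h) \<le> \<Lambda> * norm (b - a) * norm h" .
    qed
  qed auto
  then show ?thesis by (simp add: power2_eq_square mult_ac)
qed

lemma linearization_bound_UNIV:
  fixes f :: "'a::euclidean_space \<Rightarrow> real" and G :: "'a \<Rightarrow> 'a"
  assumes f: "\<And>q. (f has_derivative (\<lambda>h. G q \<bullet> h)) (at q)"
    and G: "\<And>q. (G has_derivative G' q) (at q)"
    and bd: "\<And>q h. norm (G' q h) \<le> \<Lambda> * norm h"
  shows "\<bar>f (a + k) - f a - G a \<bullet> k\<bar> \<le> \<Lambda> * (norm k)\<^sup>2"
proof -
  have "norm (G q - G q') \<le> \<Lambda> * norm (q - q')" for q q'
    by (rule differentiable_bound[of UNIV G G']) (auto intro: G onorm_le bd)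
  from linearization_bound[of UNIV a "a + k" f G, OF _ _ _ f this] show ?thesis by simp
qed

text \<open>Converse of \<open>C2_onI\<close>: the Riesz representative of the first derivative. The
  quadratic remainder bound is only local, since the second derivative is merely continuous and so
  bounded on compact sets.\<close>

lemma C2_on_gradient_field:
  fixes f :: "'a::euclidean_space \<Rightarrow> real"
  assumes "C2_on S f"
  obtains G where "\<And>q. q \<in> S \<Longrightarrow> (f has_derivative (\<lambda>h. G q \<bullet> h)) (at q within S)"
    "continuous_on S G"
    "\<And>K. K \<subseteq> S \<Longrightarrow> compact K \<Longrightarrow> convex K \<Longrightarrow>
       \<exists>\<Lambda>\<ge>0. \<forall>a\<in>K. \<forall>b\<in>K. \<bar>f b - f a - G a \<bullet> (b - a)\<bar> \<le> \<Lambda> * (norm (b - a))\<^sup>2"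
proof -
  obtain D D2 where D: "\<forall>x\<in>S. (f has_derivative blinfun_apply (D x)) (at x within S)"
    "\<forall>x\<in>S. (D has_derivative blinfun_apply (D2 x)) (at x within S)" "continuous_on S D2"
    using assms unfolding C2_on_def by metis
  define G where "G q = (\<Sum>b\<in>Basis. blinfun_apply (D q) b *\<^sub>R b)" for q
  have G: "G q \<bullet> h = blinfun_apply (D q) h" for q h
  proof -
    have "blinfun_apply (D q) h = blinfun_apply (D q) (\<Sum>b\<in>Basis. (h \<bullet> b) *\<^sub>R b)"
      by (simp add: euclidean_representation)
    also have "\<dots> = (\<Sum>b\<in>Basis. (h \<bullet> b) * blinfun_apply (D q) b)"
      by (simp add: blinfun.sum_right blinfun.scaleR_right)
    also have "\<dots> = G q \<bullet> h" by (simp add: G_def inner_sum_left inner_commute[of h] mult_ac)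
    finally show ?thesis by simp
  qed
  \<comment> \<open>The functional \<open>D q - D q'\<close> is tested on the vector
    \<open>G q - G q'\<close> that represents it.\<close>
  have Gn: "norm (G q - G q') \<le> norm (D q - D q')" for q q'
  proof -
    have "(norm (G q - G q'))\<^sup>2 = blinfun_apply (D q - D q') (G q - G q')"
      by (simp add: power2_norm_eq_inner inner_diff_left G blinfun.diff_left)
    also have "\<dots> \<le> norm (D q - D q') * norm (G q - G q')"
      using norm_blinfun[of "D q - D q'" "G q - G q'"] by simp
    finally have "norm (G q - G q') * norm (G q - G q') \<le> norm (D q - D q') * norm (G q - G q')"
      by (simp only: power2_eq_square)
    then show ?thesis by (cases "G q = G q'") (auto dest: mult_right_le_imp_le)
  qed
  show ?thesis
  proof
    show "(f has_derivative (\<lambda>h. G q \<bullet> h)) (at q within S)" if "q \<in> S" for q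
      using D that by (simp add: G)
    have "continuous_on S D"
      unfolding continuous_on_eq_continuous_within using D(2) has_derivative_continuous by blast
    then show "continuous_on S G" unfolding G_def by (intro continuous_intros)
    fix K assume K: "K \<subseteq> S" "compact K" "convex K"
    have "continuous_on K D2" using D(3) K continuous_on_subset by blast
    then have "bounded (D2 ` K)" using K compact_continuous_image compact_imp_bounded by blast
    then obtain \<Lambda> where "\<Lambda> > 0" "\<forall>y\<in>D2 ` K. norm y \<le> \<Lambda>" unfolding bounded_pos by blast
    then have L: "\<Lambda> \<ge> 0" "\<And>q. q \<in> K \<Longrightarrow> norm (D2 q) \<le> \<Lambda>" by auto
    have "norm (D q - D q') \<le> \<Lambda> * norm (q - q')" if "q \<in> K" "q' \<in> K" for q q'
    proof (rule differentiable_bound[where S = K and f' = "\<lambda>q. blinfun_apply (D2 q)"])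
      show "(D has_derivative blinfun_apply (D2 x)) (at x within K)" if "x \<in> K" for x
        using D(2) K that has_derivative_subset by blast
      show "onorm (blinfun_apply (D2 x)) \<le> \<Lambda>" if "x \<in> K" for x
        using L(2)[OF that] by (simp add: norm_blinfun.rep_eq)
    qed (use that K in auto)
    then have Gl: "norm (G q - G q') \<le> \<Lambda> * norm (q - q')" if "q \<in> K" "q' \<in> K" for q q'
      using Gn that order_trans by blast
    show "\<exists>\<Lambda>\<ge>0. \<forall>a\<in>K. \<forall>b\<in>K. \<bar>f b - f a - G a \<bullet> (b - a)\<bar> \<le> \<Lambda> * (norm (b - a))\<^sup>2"
    proof (intro exI[of _ \<Lambda>] conjI ballI L)
      fix a b assume "a \<in> K" "b \<in> K"
      then show "\<bar>f b - f a - G a \<bullet> (b - a)\<bar> \<le> \<Lambda> * (norm (b - a))\<^sup>2"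
      proof (rule linearization_bound[OF K(3)])
        show "(f has_derivative (\<lambda>h. G q \<bullet> h)) (at q within K)" if "q \<in> K" for q
          using D(1) K that has_derivative_subset[of f _ q S K] by (auto simp: G)
      qed (rule Gl)
    qed
  qed
qed

text \<open>The singular part of the operator acts on \<open>\<phi>\<close>, whose gradient at \<open>x\<close> is \<open>d\<close>, and
  the rest on \<open>u\<close>.\<close>

definition mixed_increment ::
  "real \<Rightarrow> (real^'n \<Rightarrow> real) \<Rightarrow> (real^'n \<Rightarrow> real) \<Rightarrow> real^'n \<Rightarrow> real^'n \<Rightarrow> real^'n \<Rightarrow> real" where
  "mixed_increment s \<phi> u d x z =
     (if norm z \<le> s then \<phi> (x + z) - \<phi> x - d \<bullet> z else u (x + z) - u x)"

definition mixed_op ::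
  "(real^'n \<Rightarrow> real) \<Rightarrow> real \<Rightarrow> (real^'n \<Rightarrow> real) \<Rightarrow> (real^'n \<Rightarrow> real) \<Rightarrow> real^'n \<Rightarrow> real^'n \<Rightarrow> real" where
  "mixed_op g s \<phi> u d x = (\<integral>z. mixed_increment s \<phi> u d x z \<partial>levy_measure g)"

lemma mixed_increment_measurable [measurable]:
  assumes [measurable]: "\<phi> \<in> borel_measurable borel" "u \<in> borel_measurable borel"
  shows "mixed_increment s \<phi> u d x \<in> borel_measurable borel"
  unfolding mixed_increment_def by measurable

context levy_kernel begin

lemma integrable_mixed_increment:
  assumes s: "s > 0" and m: "\<phi> \<in> borel_measurable borel" "u \<in> borel_measurable borel"
    and \<phi>: "\<And>z. norm z \<le> s \<Longrightarrow> \<bar>\<phi> (x + z) - \<phi> x - d \<bullet> z\<bar> \<le> \<Lambda> * (norm z)\<^sup>2"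
    and u: "\<And>z. s < norm z \<Longrightarrow> \<bar>u (x + z) - u x\<bar> \<le> A * (1 + sqrt (norm z))"
  shows "integrable (levy_measure g) (mixed_increment s \<phi> u d x)"
proof (rule Bochner_Integration.integrable_bound[where f = "\<lambda>z. (\<bar>\<Lambda>\<bar> + \<bar>A\<bar>) * levy_weight s z"])
  show "integrable (levy_measure g) (\<lambda>z. (\<bar>\<Lambda>\<bar> + \<bar>A\<bar>) * levy_weight s z)"
    using integrable_levy_weight[OF s] by simp
  show "AE z in levy_measure g. norm (mixed_increment s \<phi> u d x z) \<le> norm ((\<bar>\<Lambda>\<bar> + \<bar>A\<bar>) * levy_weight s z)"
  proof (rule AE_I2)
    fix z :: "real^'n"
    have "\<Lambda> * (norm z)\<^sup>2 \<le> (\<bar>\<Lambda>\<bar> + \<bar>A\<bar>) * (norm z)\<^sup>2" by (intro mult_right_mono) auto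
    moreover have "A * (1 + sqrt (norm z)) \<le> (\<bar>\<Lambda>\<bar> + \<bar>A\<bar>) * (1 + sqrt (norm z))"
      by (intro mult_right_mono) auto
    ultimately show "norm (mixed_increment s \<phi> u d x z) \<le> norm ((\<bar>\<Lambda>\<bar> + \<bar>A\<bar>) * levy_weight s z)"
      using \<phi>[of z] u[of z] by (auto simp: mixed_increment_def levy_weight_def abs_mult) 
  qed
qed (use m in simp)

text \<open>Moving the splitting radius changes the integrand only by the linear compensator on an
  annulus, away from the singularity, and that term integrates to zero because it is odd.\<close>

lemma annulus_inner:
  fixes s s' :: real and d :: "real^'n"
  assumes "0 < s"
  shows "integrable (levy_measure g) (\<lambda>z. if s < norm z \<and> norm z \<le> s' then d \<bullet> z else 0)"
    and "(\<integral>z. (if s < norm z \<and> norm z \<le> s' then d \<bullet> z else 0) \<partial>levy_measure g) = 0"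
proof -
  show "integrable (levy_measure g) (\<lambda>z. if s < norm z \<and> norm z \<le> s' then d \<bullet> z else 0)"
  proof (rule Bochner_Integration.integrable_bound[where f = "\<lambda>z. (norm d * s') * levy_weight s z"])
    show "integrable (levy_measure g) (\<lambda>z. (norm d * s') * levy_weight s z)"
      using integrable_levy_weight assms by simp
    show "AE z in levy_measure g. norm (if s < norm z \<and> norm z \<le> s' then d \<bullet> z else 0)
      \<le> norm (norm d * s' * levy_weight s z)"
    proof (rule AE_I2)
      fix z :: "real^'n"
      { assume z: "s < norm z" "norm z \<le> s'"
        have "\<bar>d \<bullet> z\<bar> \<le> norm d * norm z" by (rule Cauchy_Schwarz_ineq2)
        also have "\<dots> \<le> norm d * s' * 1" using z by (simp add: mult_left_mono)
        also have "\<dots> \<le> norm d * s' * (1 + sqrt (norm z))" using z assms by (intro mult_left_mono) auto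
        finally have "\<bar>d \<bullet> z\<bar> \<le> norm d * s' * (1 + sqrt (norm z))" . }
      then show "norm (if s < norm z \<and> norm z \<le> s' then d \<bullet> z else 0) \<le> norm (norm d * s' * levy_weight s z)"
        using assms by (auto simp: levy_weight_def abs_mult)
    qed
  qed measurable
  show "(\<integral>z. (if s < norm z \<and> norm z \<le> s' then d \<bullet> z else 0) \<partial>levy_measure g) = 0"
    by (rule levy_integral_odd) auto
qed

text \<open>At a point where \<open>\<phi>\<close> touches \<open>u\<close> from above, letting
  \<open>\<phi>\<close> replace \<open>u\<close> on a larger ball can only increase the operator.
  Stability uses this to return from half the test radius to the full one.\<close>

lemma mixed_op_radius_mono:
  assumes s: "0 < s" "s \<le> s'"
    and i: "integrable (levy_measure g) (mixed_increment s \<phi> u d x)"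
      "integrable (levy_measure g) (mixed_increment s' \<phi> u d x)"
    and le: "\<And>z. s < norm z \<Longrightarrow> norm z \<le> s' \<Longrightarrow> u (x + z) - u x \<le> \<phi> (x + z) - \<phi> x"
  shows "mixed_op g s \<phi> u d x \<le> mixed_op g s' \<phi> u d x"
proof -
  let ?a = "\<lambda>z. if s < norm z \<and> norm z \<le> s' then d \<bullet> z else 0"
  have "mixed_op g s \<phi> u d x \<le> (\<integral>z. mixed_increment s' \<phi> u d x z + ?a z \<partial>levy_measure g)"
    unfolding mixed_op_def
    by (intro integral_mono Bochner_Integration.integrable_add i annulus_inner s(1))
       (use le s in \<open>auto simp: mixed_increment_def\<close>)
  also have "\<dots> = mixed_op g s' \<phi> u d x"
    unfolding mixed_op_def using annulus_inner[OF s(1)] i by simp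
  finally show ?thesis .
qed

lemma mixed_op_radius:
  assumes s: "0 < s" "0 < s'"
    and i: "integrable (levy_measure g) (mixed_increment s u u d x)"
  shows "integrable (levy_measure g) (mixed_increment s' u u d x)"
    and "mixed_op g s u u d x = mixed_op g s' u u d x"
proof -
  let ?a = "\<lambda>s s' z. if s < norm z \<and> norm z \<le> s' then d \<bullet> z else 0"
  \<comment> \<open>At most one of the two annuli is nonempty, so the signed difference treats both
    orders of \<open>s\<close> and \<open>s'\<close> at once.\<close>
  have eq: "mixed_increment s' u u d x = (\<lambda>z. mixed_increment s u u d x z + (?a s' s z - ?a s s' z))"
    by (auto simp: mixed_increment_def fun_eq_iff)
  have a: "integrable (levy_measure g) (?a s s')" "(\<integral>z. ?a s s' z \<partial>levy_measure g) = 0"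
    if "0 < s" for s s'
    using annulus_inner[OF that, of s' d] by simp_all
  show "integrable (levy_measure g) (mixed_increment s' u u d x)"
    unfolding eq using i a s by (intro Bochner_Integration.integrable_add Bochner_Integration.integrable_diff)
  show "mixed_op g s u u d x = mixed_op g s' u u d x"
    unfolding mixed_op_def eq
    using i a s by (subst Bochner_Integration.integral_add; (subst Bochner_Integration.integral_diff)?) auto
qed

lemma mixed_op_mono:
  assumes "integrable (levy_measure g) (mixed_increment s \<phi> u d x)"
      "integrable (levy_measure g) (mixed_increment s \<psi> v d x)"
    and "\<And>z. norm z \<le> s \<Longrightarrow> \<phi> (x + z) - \<phi> x \<le> \<psi> (x + z) - \<psi> x"
    and "\<And>z. s < norm z \<Longrightarrow> u (x + z) - u x \<le> v (x + z) - v x"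
  shows "mixed_op g s \<phi> u d x \<le> mixed_op g s \<psi> v d x"
  unfolding mixed_op_def
  using assms by (intro integral_mono) (auto simp: mixed_increment_def)

text \<open>Bridge from the two integrals in the definition of viscosity solutions to a single one.
  The separate integrals may be added because both inherit integrability from the mixed
  increment.\<close>

lemma I1_inner_plus_outer:
  assumes s: "s > 0" and m: "\<phi> \<in> borel_measurable borel" "u \<in> borel_measurable borel"
    and grad: "gradient \<phi> x = d"
    and i: "integrable (levy_measure g) (mixed_increment s \<phi> u d x)"
  shows "I1_inner g s \<phi> x + I1_outer g s u x = mixed_op g s \<phi> u d x"
proof -
  let ?i = "\<lambda>z. indicator {z. norm z \<le> s} z *\<^sub>R (\<phi> (x + z) - \<phi> x - d \<bullet> z)"
  let ?o = "\<lambda>z. indicator {z. norm z > s} z *\<^sub>R (u (x + z) - u x)"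
  have ii: "integrable (levy_measure g) ?i"
    using i by (rule Bochner_Integration.integrable_bound)
       (use m in \<open>measurable, auto simp: mixed_increment_def indicator_def\<close>)
  have io: "integrable (levy_measure g) ?o"
    using i by (rule Bochner_Integration.integrable_bound)
       (use m in \<open>measurable, auto simp: mixed_increment_def indicator_def\<close>)
  have "I1_inner g s \<phi> x + I1_outer g s u x = (\<integral>z. ?i z + ?o z \<partial>levy_measure g)"
    unfolding I1_inner_def I1_outer_def set_lebesgue_integral_def grad
    using ii io by simp
  also have "(\<lambda>z. ?i z + ?o z) = mixed_increment s \<phi> u d x"
    by (auto simp: mixed_increment_def indicator_def fun_eq_iff)
  finally show ?thesis by (simp add: mixed_op_def)
qed

end

section \<open>An explicit scheme for the truncated operator\<close>

lemma lborel_integral_translate: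
  fixes f :: "'a::euclidean_space \<Rightarrow> 'b::{banach,second_countable_topology}"
  assumes [measurable]: "f \<in> borel_measurable borel"
  shows "(\<integral>x. f (a + x) \<partial>lborel) = (\<integral>x. f x \<partial>lborel)"
proof -
  have "(\<integral>x. f x \<partial>lborel) = (\<integral>x. f x \<partial>distr lborel borel ((+) a))"
    by (simp add: lborel_distr_plus)
  also have "\<dots> = (\<integral>x. f (a + x) \<partial>lborel)" by (subst integral_distr) auto
  finally show ?thesis by simp
qed

definition bounded_borel :: "('a::topological_space \<Rightarrow> real) \<Rightarrow> bool" where
  "bounded_borel u \<longleftrightarrow> u \<in> borel_measurable borel \<and> (\<exists>B. \<forall>x. \<bar>u x\<bar> \<le> B)"

definition euler_step ::
  "'a::euclidean_space measure \<Rightarrow> real \<Rightarrow> ('a \<Rightarrow> real \<Rightarrow> real) \<Rightarrow> ('a \<Rightarrow> real) \<Rightarrow> 'a \<Rightarrow> real" where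
  "euler_step m h \<phi> u x = u x + h * ((\<integral>z. u (x + z) - u x \<partial>m) + \<phi> x (u x))"

primrec euler_seq ::
  "'a::euclidean_space measure \<Rightarrow> real \<Rightarrow> (real \<Rightarrow> 'a \<Rightarrow> real \<Rightarrow> real) \<Rightarrow> nat \<Rightarrow> 'a \<Rightarrow> real" where
  "euler_seq m h f 0 = (\<lambda>x. 0)"
| "euler_seq m h f (Suc n) = euler_step m h (f (real n * h)) (euler_seq m h f n)"

locale rhs =
  fixes f :: "real \<Rightarrow> 'a::euclidean_space \<Rightarrow> real \<Rightarrow> real" and C F :: real
  assumes f_lipschitz: "\<And>t t' x x' a a'. t \<ge> 0 \<Longrightarrow> t' \<ge> 0 \<Longrightarrow>
      \<bar>f t x a - f t' x' a'\<bar> \<le> C * (\<bar>t - t'\<bar> + norm (x - x') + \<bar>a - a'\<bar>)"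
    and f_bound: "\<And>t x a. t \<ge> 0 \<Longrightarrow> \<bar>f t x a\<bar> \<le> F"
begin

lemma C_nonneg: "C \<ge> 0"
  using f_lipschitz[of 0 1 0 0 0 0] by simp

lemma F_nonneg: "F \<ge> 0"
  using f_bound[of 0 0 0] by linarith

end

text \<open>Under \<open>cfl\<close> a step is nondecreasing in \<open>u\<close>: the coefficient
  \<open>1 - h * measure m UNIV\<close> of the old value outweighs the largest decrease
  \<open>h * C\<close> caused by the nonlinearity.\<close>

locale euler_scheme = rhs f C F + finite_measure m
  for f :: "real \<Rightarrow> 'a::euclidean_space \<Rightarrow> real \<Rightarrow> real" and C F and m :: "'a measure" +
  fixes h :: real
  assumes sets_m [measurable_cong]: "sets m = sets borel"
    and h_pos: "h > 0"
    and cfl: "h * (measure m UNIV + C) \<le> 1"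
begin

lemma space_m [simp]: "space m = UNIV"
  using sets_eq_imp_space_eq[OF sets_m] by simp

lemma bounded_borel_integrable:
  assumes "bounded_borel u"
  shows "integrable m (\<lambda>z. u (x + z))"
proof -
  obtain B where [measurable]: "u \<in> borel_measurable borel" and B: "\<forall>x. \<bar>u x\<bar> \<le> B"
    using assms unfolding bounded_borel_def by blast
  show ?thesis by (rule integrable_const_bound[where B = B]) (use B in auto)
qed

lemma euler_step_eq:
  assumes "bounded_borel u"
  shows "euler_step m h \<phi> u x = (1 - h * measure m UNIV) * u x + h * (\<integral>z. u (x + z) \<partial>m) + h * \<phi> x (u x)"
  unfolding euler_step_def using bounded_borel_integrable[OF assms, of x]
  by (subst Bochner_Integration.integral_diff) (auto simp: algebra_simps)

text \<open>Monotonicity with error propagation. The jump term ignores constants, so an error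
  \<open>E\<close> is amplified only through the nonlinearity, by the factor
  \<open>1 + h * C\<close>.\<close>

lemma euler_step_le:
  assumes u: "bounded_borel u" and v: "bounded_borel v"
    and le: "\<And>x. u x \<le> v x + E" and E: "E \<ge> 0"
    and \<phi>: "\<And>x a b. \<bar>\<phi> x a - \<phi> x b\<bar> \<le> C * \<bar>a - b\<bar>"
    and \<psi>: "\<And>x a. \<phi> x a \<le> \<psi> x a + e"
  shows "euler_step m h \<phi> u x \<le> euler_step m h \<psi> v x + ((1 + h * C) * E + h * e)"
proof -
  let ?m = "measure m UNIV"
  have "(\<integral>z. u (x + z) \<partial>m) \<le> (\<integral>z. v (x + z) + E \<partial>m)"
    by (intro integral_mono Bochner_Integration.integrable_add bounded_borel_integrable[OF u]
        bounded_borel_integrable[OF v] le) auto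
  also have "\<dots> = (\<integral>z. v (x + z) \<partial>m) + ?m * E"
    using bounded_borel_integrable[OF v] by simp
  finally have 1: "h * (\<integral>z. u (x + z) \<partial>m) \<le> h * ((\<integral>z. v (x + z) \<partial>m) + ?m * E)"
    using h_pos by simp
  let ?d = "v x + E - u x"
  have d: "?d \<ge> 0" using le[of x] by simp
  have "\<phi> x (u x) \<le> \<phi> x (v x + E) + C * ?d"
    using \<phi>[of x "u x" "v x + E"] d by (simp add: abs_minus_commute)
  moreover have "\<phi> x (v x + E) \<le> \<phi> x (v x) + C * E" using \<phi>[of x "v x + E" "v x"] E by simp
  ultimately have "\<phi> x (u x) \<le> \<psi> x (v x) + e + C * E + C * ?d" using \<psi>[of x "v x"] by linarith
  then have 2: "h * \<phi> x (u x) \<le> h * (\<psi> x (v x) + e + C * E + C * ?d)" using h_pos by simp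
  \<comment> \<open>After the bounds \<open>1\<close> and \<open>2\<close> are inserted, the two
    sides of the claim differ by exactly this product.\<close>
  have "(1 - h * (?m + C)) * ?d \<ge> 0" using cfl d by simp
  then show ?thesis
    using 1 2 by (simp add: euler_step_eq u v) (simp add: algebra_simps)
qed

lemma euler_step_translate:
  "euler_step m h \<phi> u (x + y) = euler_step m h (\<lambda>x. \<phi> (x + y)) (\<lambda>x. u (x + y)) x"
  by (simp add: euler_step_def ac_simps)

lemma euler_step_shift:
  "euler_step m h \<phi> u x + c = euler_step m h (\<lambda>x a. \<phi> x (a - c)) (\<lambda>x. u x + c) x"
  by (simp add: euler_step_def)

lemma f_lip_value: "t \<ge> 0 \<Longrightarrow> \<bar>f t x a - f t x b\<bar> \<le> C * \<bar>a - b\<bar>"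
  using f_lipschitz[of t t x a x b] by simp

lemma bounded_borel_translate:
  fixes u :: "'a \<Rightarrow> real"
  assumes "bounded_borel u"
  shows "bounded_borel (\<lambda>x. u (x + y))"
proof -
  obtain B where [measurable]: "u \<in> borel_measurable borel" and B: "\<forall>x. \<bar>u x\<bar> \<le> B"
    using assms unfolding bounded_borel_def by blast
  have "(\<lambda>x. u (x + y)) \<in> borel_measurable borel" by measurable
  with B show ?thesis unfolding bounded_borel_def by blast
qed

lemma bounded_borel_shift: "bounded_borel u \<Longrightarrow> bounded_borel (\<lambda>x. u x + c)"
proof -
  assume "bounded_borel u"
  then obtain B where [measurable]: "u \<in> borel_measurable borel" and B: "\<forall>x. \<bar>u x\<bar> \<le> B"
    unfolding bounded_borel_def by blast
  have "\<bar>u x + c\<bar> \<le> B + \<bar>c\<bar>" for x using B[rule_format, of x] by linarith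
  then show ?thesis unfolding bounded_borel_def by (intro conjI exI[of _ "B + \<bar>c\<bar>"]) auto
qed

abbreviation u where "u n \<equiv> euler_seq m h f n"

text \<open>The bounds are proved together because the step needs the previous iterate to be bounded
  and measurable, and measurability comes from its Lipschitz bound. The Lipschitz constants obey
  \<open>L' = (1 + h * C) * L + h * C\<close> with start 0, whence the subtracted 1.\<close>

lemma euler_seq_regular:
  "(\<forall>x. \<bar>u n x\<bar> \<le> F * (real n * h)) \<and>
   (\<forall>x y. \<bar>u n x - u n y\<bar> \<le> ((1 + h * C) ^ n - 1) * norm (x - y))"
proof (induction n)
  case (Suc n)
  let ?L = "(1 + h * C) ^ n - 1" and ?B = "F * (real n * h)" and ?m = "measure m UNIV"
  have t: "real n * h \<ge> 0" using h_pos by simp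
  have hC: "h * C \<ge> 0" using h_pos C_nonneg by simp
  then have L: "?L \<ge> 0" by simp
  have "?L-lipschitz_on UNIV (u n)"
    using Suc L by (intro lipschitz_onI) (auto simp: dist_norm)
  then have "continuous_on UNIV (u n)" by (rule lipschitz_on_continuous_on)
  then have bb: "bounded_borel (u n)"
    using Suc by (auto simp: bounded_borel_def intro: borel_measurable_continuous_onI)
  have "\<bar>u (Suc n) x\<bar> \<le> F * (real (Suc n) * h)" for x
  proof -
    have i: "\<bar>\<integral>z. u n (x + z) \<partial>m\<bar> \<le> ?m * ?B"
    proof -
      have "\<bar>\<integral>z. u n (x + z) \<partial>m\<bar> \<le> (\<integral>z. \<bar>u n (x + z)\<bar> \<partial>m)" by (rule integral_abs_bound)
      also have "\<dots> \<le> (\<integral>z. ?B \<partial>m)"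
        using Suc by (intro integral_mono integrable_abs bounded_borel_integrable[OF bb]) auto
      finally show ?thesis by simp
    qed
    have m: "1 - h * ?m \<ge> 0" using cfl hC by (simp add: algebra_simps)
    have "\<bar>(1 - h * ?m) * u n x\<bar> \<le> (1 - h * ?m) * ?B"
      using Suc m by (auto simp: abs_mult intro: mult_left_mono)
    moreover have "\<bar>h * (\<integral>z. u n (x + z) \<partial>m)\<bar> \<le> h * (?m * ?B)"
      using i h_pos by (simp add: abs_mult)
    moreover have "\<bar>h * f (real n * h) x (u n x)\<bar> \<le> h * F"
      using f_bound[OF t] h_pos by (simp add: abs_mult)
    ultimately have "\<bar>u (Suc n) x\<bar> \<le> (1 - h * ?m) * ?B + h * (?m * ?B) + h * F"
      by (simp add: euler_step_eq[OF bb])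
    then show ?thesis by (simp add: algebra_simps)
  qed
  moreover have le: "u (Suc n) (x + y) \<le> u (Suc n) x + ((1 + h * C) ^ Suc n - 1) * norm y" for x y
  proof -
    have "u (Suc n) (x + y) = euler_step m h (\<lambda>x. f (real n * h) (x + y)) (\<lambda>x. u n (x + y)) x"
      by (simp add: euler_step_translate)
    also have "\<dots> \<le> euler_step m h (f (real n * h)) (u n) x + ((1 + h * C) * (?L * norm y) + h * (C * norm y))"
    proof (rule euler_step_le[OF bounded_borel_translate[OF bb] bb])
      show "u n (x + y) \<le> u n x + ?L * norm y" for x
        using conjunct2[OF Suc, rule_format, of "x + y" x] by simp
      show "f (real n * h) (x + y) a \<le> f (real n * h) x a + C * norm y" for x a
        using f_lipschitz[OF t t, of "x + y" a x a] by simp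
    qed (use L f_lip_value[OF t] in auto)
    finally show ?thesis by (simp add: algebra_simps)
  qed
  have "\<bar>u (Suc n) x - u (Suc n) y\<bar> \<le> ((1 + h * C) ^ Suc n - 1) * norm (x - y)" for x y
    using le[of x "y - x"] le[of y "x - y"] by (simp add: norm_minus_commute abs_le_iff)
  ultimately show ?case by blast
qed simp

lemma euler_seq_bound: "\<bar>u n x\<bar> \<le> F * (real n * h)"
  using euler_seq_regular by blast

lemma euler_seq_lipschitz: "\<bar>u n x - u n y\<bar> \<le> (1 + h * C) ^ n * norm (x - y)"
proof -
  have "\<bar>u n x - u n y\<bar> \<le> ((1 + h * C) ^ n - 1) * norm (x - y)" using euler_seq_regular by blast
  also have "\<dots> \<le> (1 + h * C) ^ n * norm (x - y)" by (intro mult_right_mono) auto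
  finally show ?thesis .
qed

lemma euler_seq_continuous: "continuous_on UNIV (u n)"
proof -
  have "((1 + h * C) ^ n)-lipschitz_on UNIV (u n)"
    using euler_seq_lipschitz C_nonneg h_pos by (intro lipschitz_onI) (auto simp: dist_norm)
  then show ?thesis by (rule lipschitz_on_continuous_on)
qed

lemma euler_seq_bounded_borel: "bounded_borel (u n)"
  using euler_seq_bound euler_seq_continuous
  by (auto simp: bounded_borel_def intro: borel_measurable_continuous_onI)

text \<open>Consecutive iterates follow the same scheme with data one time step apart, so
  \<open>euler_step_le\<close> compares them in both directions. In
  \<open>(F + 1) * (1 + h * C) ^ n - 1\<close> the subtracted 1 absorbs the new error
  \<open>C * h\<close> of each step.\<close>

lemma euler_seq_increment: "\<bar>u (Suc n) x - u n x\<bar> \<le> h * ((F + 1) * (1 + h * C) ^ n)"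
proof -
  have "\<forall>x. \<bar>u (Suc n) x - u n x\<bar> \<le> h * ((F + 1) * (1 + h * C) ^ n - 1)"
  proof (induction n)
    case 0
    show ?case using f_bound[of 0 _ 0] h_pos by (auto simp: euler_step_def abs_mult)
  next
    case (Suc n)
    let ?E = "h * ((F + 1) * (1 + h * C) ^ n - 1)" and ?t = "real n * h" and ?t' = "real (Suc n) * h"
    have t: "?t \<ge> 0" "?t' \<ge> 0" using h_pos by auto
    have E: "?E \<ge> 0" using Suc by (meson abs_ge_zero order_trans)
    have eq: "(1 + h * C) * ?E + h * (C * h) = h * ((F + 1) * (1 + h * C) ^ Suc n - 1)"
      by (simp add: algebra_simps)
    have d: "\<bar>?t - ?t'\<bar> = h" using h_pos by (simp add: algebra_simps)
    have up: "u (Suc (Suc n)) x \<le> u (Suc n) x + ((1 + h * C) * ?E + h * (C * h))" for x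
      unfolding euler_seq.simps(2)[of m h f "Suc n"] euler_seq.simps(2)[of m h f n]
    proof (rule euler_step_le)
      show "euler_step m h (f ?t) (u n) x \<le> u n x + ?E" for x
        using Suc[rule_format, of x] by simp
      show "f ?t' x a \<le> f ?t x a + C * h" for x a
        using f_lipschitz[OF t(2,1), of x a x a] d by (simp only: abs_minus_commute) simp
    qed (use E f_lip_value[OF t(2)] euler_seq_bounded_borel[of "Suc n"] euler_seq_bounded_borel[of n] in auto)
    have lo: "u (Suc n) x \<le> u (Suc (Suc n)) x + ((1 + h * C) * ?E + h * (C * h))" for x
      unfolding euler_seq.simps(2)[of m h f "Suc n"] euler_seq.simps(2)[of m h f n]
    proof (rule euler_step_le)
      show "u n x \<le> euler_step m h (f ?t) (u n) x + ?E" for x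
        using Suc[rule_format, of x] by simp
      show "f ?t x a \<le> f ?t' x a + C * h" for x a
        using f_lipschitz[OF t, of x a x a] d by simp
    qed (use E f_lip_value[OF t(1)] euler_seq_bounded_borel[of "Suc n"] euler_seq_bounded_borel[of n] in auto)
    show ?case
    proof
      fix x
      show "\<bar>u (Suc (Suc n)) x - u (Suc n) x\<bar> \<le> h * ((F + 1) * (1 + h * C) ^ Suc n - 1)"
        using up[of x] lo[of x] unfolding eq by linarith
    qed
  qed
  then have "\<bar>u (Suc n) x - u n x\<bar> \<le> h * ((F + 1) * (1 + h * C) ^ n - 1)" by blast
  also have "\<dots> \<le> h * ((F + 1) * (1 + h * C) ^ n)" using h_pos by simp
  finally show ?thesis .
qed

lemma euler_comparison:
  assumes "\<And>n. bounded_borel (a n)" "\<And>n. bounded_borel (b n)"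
    and "\<And>n x. a (Suc n) x = euler_step m h (f (real n * h)) (a n) x"
    and "\<And>n x. b (Suc n) x = euler_step m h (f (real n * h)) (b n) x"
    and "\<And>x. a 0 x \<le> b 0 x"
  shows "a n x \<le> b n x"
proof (induction n arbitrary: x)
  case (Suc n)
  have "euler_step m h (f (real n * h)) (a n) x
      \<le> euler_step m h (f (real n * h)) (b n) x + ((1 + h * C) * 0 + h * 0)"
    by (rule euler_step_le) (use assms Suc f_lip_value h_pos in auto)
  then show ?case using assms by simp
qed (use assms in simp)

end

text \<open>\<open>K\<close> plays the role of the lattice and \<open>D\<close> of its covering
  radius. The constant in \<open>per_space\<close> may depend on the shift \<open>k\<close>; for the
  cell problem it is \<open>p \<bullet> k\<close>. \<open>spread\<close> is a minorization
  condition: jumps reach every unit ball at moderate distance with density at least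
  \<open>c\<close>.\<close>

locale periodic_euler_scheme = euler_scheme +
  fixes K :: "'a set" and D c F0 :: real
  assumes per_value: "\<And>t x a. t \<ge> 0 \<Longrightarrow> f t x (a + 1) = f t x a"
    and per_space: "\<And>k. k \<in> K \<Longrightarrow> \<exists>c. \<forall>t\<ge>0. \<forall>x a. f t (x + k) (a - c) = f t x a"
    and per_time: "\<And>t x a. t \<ge> 0 \<Longrightarrow> f (t + 1) x a = f t x a"
    and K_dense: "\<And>y. \<exists>k\<in>K. norm (y - k) \<le> D"
    and f_osc: "\<And>t x a y b. t \<ge> 0 \<Longrightarrow> \<bar>f t x a - f t y b\<bar> \<le> F0"
    and c_pos: "c > 0"
    and spread: "\<And>w b. bounded_borel w \<Longrightarrow> (\<And>x. w x \<ge> 0) \<Longrightarrow> 2 \<le> norm b \<Longrightarrow> norm b \<le> 2 * D + 2 \<Longrightarrow>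
      c * (\<integral>x. indicator (cball b 1) x * w x \<partial>lborel) \<le> (\<integral>x. w x \<partial>m)"
begin

lemma per_int: "t \<ge> 0 \<Longrightarrow> f t x (a - of_int i) = f t x a"
proof (induction i arbitrary: a rule: int_induct[where k = 0])
  case (step1 i)
  then have "f t x (a - of_int (i + 1)) = f t x (a - 1 - of_int i)" by (simp add: algebra_simps)
  also have "\<dots> = f t x (a - 1)" using step1 by simp
  also have "\<dots> = f t x a" using per_value[of t x "a - 1"] step1 by simp
  finally show ?case .
next
  case (step2 i)
  then have "f t x (a - of_int (i - 1)) = f t x (a + 1 - of_int i)" by (simp add: algebra_simps)
  also have "\<dots> = f t x (a + 1)" using step2 by simp
  also have "\<dots> = f t x a" using per_value step2 by simp
  finally show ?case .
qed simp

lemma euler_seq_int_shift: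
  "u (Suc n) x + of_int i = euler_step m h (f (real n * h)) (\<lambda>x. u n x + of_int i) x"
proof -
  have t: "real n * h \<ge> 0" using h_pos by simp
  show ?thesis by (simp add: euler_step_shift per_int[OF t])
qed

text \<open>Translation by \<open>k\<close> combined with adding the real number \<open>q\<close>
  preserves the scheme, while adding a constant alone preserves it only for integers. Comparison
  with the integers on both sides of \<open>q\<close>, starting from zero, leaves a gap of at most
  1.\<close>

lemma euler_seq_lattice:
  assumes "k \<in> K"
  shows "\<bar>u n (x + k) - u n x\<bar> \<le> 1"
proof -
  obtain q where q: "\<And>t x a. t \<ge> 0 \<Longrightarrow> f t (x + k) (a - q) = f t x a" using per_space[OF assms] by blast
  have step: "u (Suc n) (x + k) + q = euler_step m h (f (real n * h)) (\<lambda>x. u n (x + k) + q) x" for n x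
  proof -
    have t: "real n * h \<ge> 0" using h_pos by simp
    show ?thesis by (simp add: euler_step_translate euler_step_shift q[OF t])
  qed
  note bb = bounded_borel_shift[OF bounded_borel_translate[OF euler_seq_bounded_borel]]
    bounded_borel_shift[OF euler_seq_bounded_borel]
  have "u n (x + k) + q \<le> u n x + of_int \<lceil>q\<rceil>"
    by (rule euler_comparison[where a = "\<lambda>n x. u n (x + k) + q" and b = "\<lambda>n x. u n x + of_int \<lceil>q\<rceil>"])
       (simp_all only: bb step euler_seq_int_shift, simp)
  moreover have "u n x + of_int \<lfloor>q\<rfloor> \<le> u n (x + k) + q"
    by (rule euler_comparison[where b = "\<lambda>n x. u n (x + k) + q" and a = "\<lambda>n x. u n x + of_int \<lfloor>q\<rfloor>"])
       (simp_all only: bb step euler_seq_int_shift, simp)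
  ultimately show ?thesis by linarith
qed

definition om where "om = measure lborel (cball (0::'a) 1)"

lemma om_pos: "om > 0"
  unfolding om_def by (simp add: content_cball)

lemma measure_unit_cball: "measure lborel (cball (b::'a) 1) = om"
  unfolding om_def by (simp add: content_cball)

text \<open>\<open>spread\<close> applied to the constant 1. The next estimate needs it to keep the
  coefficient \<open>measure m UNIV - c * om\<close> nonnegative.\<close>

lemma mass_lower: "c * om \<le> measure m UNIV"
proof -
  have D: "D \<ge> 0" using K_dense[of 0] norm_ge_zero order_trans by blast
  obtain b :: 'a where b: "norm b = 2" using vector_choose_size[of 2] by auto
  have "c * (\<integral>x. indicator (cball b 1) x * 1 \<partial>lborel) \<le> (\<integral>x. 1 \<partial>m)"
    by (rule spread) (use b D in \<open>auto simp: bounded_borel_def\<close>)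
  then show ?thesis by (simp add: measure_unit_cball)
qed

text \<open>The mean over the jumps from \<open>x\<close> falls short of the supremum
  \<open>S\<close>, and the mean from \<open>y\<close> exceeds the infimum \<open>I\<close>, each by
  an average over one common ball. The two surpluses together recover a fixed fraction of the
  oscillation.\<close>

lemma euler_seq_osc_step:
  assumes Q: "\<And>x y. u n x - u n y \<le> Q"
  shows "u (Suc n) x - u (Suc n) y \<le> Q - h * c * om * Q + h * (c * om + F0)"
proof -
  let ?v = "u n" and ?m = "measure m UNIV" and ?t = "real n * h"
  have t: "?t \<ge> 0" using h_pos by simp
  have bb: "bounded_borel ?v" by (rule euler_seq_bounded_borel)
  obtain B where B: "\<forall>x. \<bar>?v x\<bar> \<le> B" and [measurable]: "?v \<in> borel_measurable borel"
    using bb unfolding bounded_borel_def by blast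
  have bd: "bdd_above (range ?v)" "bdd_below (range ?v)"
    using B by (auto simp: bdd_above_def bdd_below_def abs_le_iff) (meson minus_le_iff)+
  define S where "S = (SUP x. ?v x)"
  define I where "I = (INF x. ?v x)"
  have S: "?v x \<le> S" and I: "I \<le> ?v x" for x
    unfolding S_def I_def using bd by (auto intro: cSUP_upper cINF_lower)
  have SI: "S - I \<le> Q"
  proof -
    have "S - Q \<le> ?v y" for y
    proof -
      have "S \<le> ?v y + Q" unfolding S_def by (rule cSUP_least) (use Q in \<open>auto simp: algebra_simps\<close>)
      then show ?thesis by simp
    qed
    then have "S - Q \<le> I" unfolding I_def by (intro cINF_greatest) auto
    then show ?thesis by simp
  qed
  obtain k where k: "k \<in> K" "norm (y - x - k) \<le> D" using K_dense by blast
  have D: "D \<ge> 0" using K_dense[of 0] norm_ge_zero order_trans by blast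
  \<comment> \<open>The lattice translate of \<open>y\<close> that lies close to \<open>x\<close>;
    passing from \<open>y\<close> to \<open>y'\<close> costs at most 1.\<close>
  define y' where "y' = y - k"
  have xy': "norm (x - y') \<le> D" using k by (simp add: y'_def norm_minus_commute algebra_simps)
  \<comment> \<open>Since \<open>x\<close> and \<open>y'\<close> are at distance at most
    \<open>D\<close>, a centre at distance \<open>D + 2\<close> from \<open>x\<close> lies between 2
    and \<open>2 * D + 2\<close> from both, the range covered by \<open>spread\<close>.\<close>
  obtain e :: 'a where e: "norm e = D + 2" using vector_choose_size[of "D + 2"] D by auto
  define x0 where "x0 = x + e"
  (* The jumps from x and from y' both charge the unit ball around x0 with density at least c, and
     there u and its translate by k differ by at most 1. *)
  define avg where "avg w = (\<integral>x. indicator (cball x0 1) x * w x \<partial>lborel)" for w :: "'a \<Rightarrow> real"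
  have avg_int: "integrable lborel (\<lambda>x. indicator (cball x0 1) x * w x)" if w: "bounded_borel w" for w :: "'a \<Rightarrow> real"
  proof -
    obtain B where [measurable]: "w \<in> borel_measurable borel" and B: "\<forall>x. \<bar>w x\<bar> \<le> B"
      using w unfolding bounded_borel_def by blast
    show ?thesis
    proof (rule Bochner_Integration.integrable_bound[where f = "\<lambda>x. B * indicator (cball x0 1) x"])
      show "integrable lborel (\<lambda>x. B * indicator (cball x0 1) x)"
        by (intro integrable_mult_right integrable_real_indicator) (auto simp: emeasure_cball)
      have "B \<ge> 0" using B[rule_format, of 0] by linarith
      then show "AE x in lborel. norm (indicator (cball x0 1) x * w x) \<le> norm (B * indicator (cball x0 1) x)"
        using B by (auto simp: abs_mult indicator_def)
      show "(\<lambda>x. indicator (cball x0 1) x * w x) \<in> borel_measurable lborel"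
        using w by (intro borel_measurable_times borel_measurable_indicator) (auto simp: bounded_borel_def)
    qed
  qed
  have spread': "c * avg w \<le> (\<integral>z. w (a + z) \<partial>m)"
    if w: "bounded_borel w" "\<And>x. w x \<ge> 0" and a: "2 \<le> norm (x0 - a)" "norm (x0 - a) \<le> 2 * D + 2" for w a
  proof -
    have [measurable]: "w \<in> borel_measurable borel" using w unfolding bounded_borel_def by blast
    have "c * (\<integral>z. indicator (cball (x0 - a) 1) z * w (z + a) \<partial>lborel) \<le> (\<integral>z. w (z + a) \<partial>m)"
      by (rule spread[OF bounded_borel_translate[OF w(1)] _ a]) (rule w(2))
    also have "(\<integral>z. indicator (cball (x0 - a) 1) z * w (z + a) \<partial>lborel)
        = (\<integral>z. indicator (cball x0 1) (a + z) * w (a + z) \<partial>lborel)"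
      by (intro Bochner_Integration.integral_cong) (auto simp: indicator_def dist_norm algebra_simps)
    also have "\<dots> = avg w" unfolding avg_def
      using w by (intro lborel_integral_translate borel_measurable_times borel_measurable_indicator)
        (auto simp: bounded_borel_def)
    finally show ?thesis by (simp add: add.commute)
  qed
  let ?A = "\<lambda>x. S - ?v x" and ?B = "\<lambda>x. ?v (x + k) - I"
  have A: "bounded_borel ?A" and Bb: "bounded_borel ?B"
  proof -
    have "\<bar>S - ?v x\<bar> \<le> \<bar>S\<bar> + B" "\<bar>?v (x + k) - I\<bar> \<le> \<bar>I\<bar> + B" for x
      using B[rule_format, of x] B[rule_format, of "x + k"] by linarith+
    then show "bounded_borel ?A" "bounded_borel ?B" unfolding bounded_borel_def by auto
  qed
  have nx: "2 \<le> norm (x0 - x)" "norm (x0 - x) \<le> 2 * D + 2" using e D by (auto simp: x0_def)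
  have ny: "2 \<le> norm (x0 - y')" "norm (x0 - y') \<le> 2 * D + 2"
  proof -
    have eq: "x0 - y' = e + (x - y')" by (simp add: x0_def)
    show "2 \<le> norm (x0 - y')" using norm_diff_ineq[of e "x - y'"] e xy' unfolding eq by linarith
    show "norm (x0 - y') \<le> 2 * D + 2" using norm_triangle_ineq[of e "x - y'"] e xy' unfolding eq by linarith
  qed
  have "c * avg ?A \<le> (\<integral>z. S - ?v (x + z) \<partial>m)" by (rule spread'[OF A _ nx]) (use S in simp)
  also have "\<dots> = ?m * S - (\<integral>z. ?v (x + z) \<partial>m)"
    by (subst Bochner_Integration.integral_diff) (auto simp: bounded_borel_integrable[OF bb])
  finally have 1: "(\<integral>z. ?v (x + z) \<partial>m) \<le> ?m * S - c * avg ?A" by simp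
  have "c * avg ?B \<le> (\<integral>z. ?v (y' + z + k) - I \<partial>m)" by (rule spread'[OF Bb _ ny]) (use I in simp)
  also have "(\<lambda>z. ?v (y' + z + k) - I) = (\<lambda>z. ?v (y + z) - I)" by (simp add: y'_def algebra_simps)
  also have "(\<integral>z. ?v (y + z) - I \<partial>m) = (\<integral>z. ?v (y + z) \<partial>m) - ?m * I"
    by (subst Bochner_Integration.integral_diff) (auto simp: bounded_borel_integrable[OF bb])
  finally have 2: "(\<integral>z. ?v (y + z) \<partial>m) \<ge> ?m * I + c * avg ?B" by simp
  \<comment> \<open>Pointwise the two surpluses add up to at least \<open>S - I - 1\<close>, because
    the shift by \<open>k\<close> lowers the iterate by at most 1.\<close>
  have "avg (\<lambda>x. S - I - 1) \<le> avg (\<lambda>x. ?A x + ?B x)"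
    unfolding avg_def
  proof (intro integral_mono avg_int)
    show "bounded_borel (\<lambda>x. ?A x + ?B x)"
    proof -
      have "\<bar>?A x + ?B x\<bar> \<le> \<bar>S\<bar> + \<bar>I\<bar> + 2 * B" for x
        using B[rule_format, of x] B[rule_format, of "x + k"] by linarith
      then show ?thesis unfolding bounded_borel_def by auto
    qed
    show "bounded_borel (\<lambda>x. S - I - 1)" unfolding bounded_borel_def by auto
    fix x :: 'a
    have "S - I - 1 \<le> ?A x + ?B x"
      using euler_seq_lattice[OF k(1), of n x] by linarith
    then show "indicator (cball x0 1) x * (S - I - 1) \<le> indicator (cball x0 1) x * (?A x + ?B x)"
      by (intro mult_left_mono) auto
  qed
  also have "avg (\<lambda>x. ?A x + ?B x) = avg ?A + avg ?B"
    unfolding avg_def using avg_int[OF A] avg_int[OF Bb] by (simp add: distrib_left)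
  also have "avg (\<lambda>x. S - I - 1) = om * (S - I - 1)"
    unfolding avg_def by (simp add: measure_unit_cball)
  finally have 3: "c * (om * (S - I - 1)) \<le> c * (avg ?A + avg ?B)" using c_pos by simp
  have "(\<integral>z. ?v (x + z) \<partial>m) - (\<integral>z. ?v (y + z) \<partial>m) \<le> ?m * (S - I) - c * (avg ?A + avg ?B)"
    using 1 2 by (simp add: algebra_simps)
  also have "\<dots> \<le> (?m - c * om) * (S - I) + c * om" using 3 by (simp add: algebra_simps)
  also have "\<dots> \<le> (?m - c * om) * Q + c * om"
    using SI mass_lower by (intro add_right_mono mult_left_mono) auto
  finally have "h * ((\<integral>z. ?v (x + z) \<partial>m) - (\<integral>z. ?v (y + z) \<partial>m)) \<le> h * ((?m - c * om) * Q + c * om)"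
    using h_pos by simp
  moreover have "h * (f ?t x (?v x) - f ?t y (?v y)) \<le> h * F0"
    using f_osc[OF t, of x "?v x" y "?v y"] h_pos by simp
  moreover have "(1 - h * ?m) * (?v x - ?v y) \<le> (1 - h * ?m) * Q"
  proof (rule mult_left_mono[OF Q])
    have "h * C \<ge> 0" using h_pos C_nonneg by simp
    then show "0 \<le> 1 - h * ?m" using cfl by (simp add: algebra_simps)
  qed
  ultimately show ?thesis
    by (simp add: euler_step_eq[OF bb]) (simp add: algebra_simps)
qed

text \<open>The bound is the fixed point of the affine map in \<open>euler_seq_osc_step\<close>,
  hence it is preserved from the zero start. It contains neither the number of steps nor
  \<open>h\<close>, \<open>C\<close> or the total mass of \<open>m\<close>.\<close>

lemma euler_seq_osc: "u n x - u n y \<le> 1 + F0 / (c * om)"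
proof (induction n arbitrary: x y)
  case 0
  have "F0 \<ge> 0" using f_osc[of 0 0 0 0 0] by simp
  then show ?case using c_pos om_pos by simp
next
  case (Suc n)
  let ?Q = "1 + F0 / (c * om)"
  have "c * om * ?Q = c * om + F0" using c_pos om_pos by (simp add: field_simps)
  then have "h * c * om * ?Q = h * (c * om + F0)" by (simp only: mult.assoc)
  then show ?case using euler_seq_osc_step[OF Suc, of x y] by linarith
qed

text \<open>If \<open>M\<close> steps make up a whole number of periods, the iterates from index
  \<open>M\<close> on follow the original scheme. Their start differs from the constant
  \<open>u M 0\<close> by at most the oscillation; rounding to integers, so that the shifted
  sequence is again a solution, costs the additional 1.\<close>

lemma euler_seq_time_shift:
  assumes "real M * h = real j"
  shows "\<bar>u (n + M) x - u n x - u M 0\<bar> \<le> 2 + F0 / (c * om)"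
proof -
  let ?Q = "1 + F0 / (c * om)"
  have per: "f (t + real j) = f t" if "t \<ge> 0" for t
  proof (induction j)
    case (Suc j)
    have "f (t + real (Suc j)) x a = f (t + real j) x a" for x a
      using per_time[of "t + real j" x a] that by (simp add: algebra_simps)
    then show ?case using Suc by (simp add: fun_eq_iff)
  qed simp
  have step: "u (Suc n + M) x = euler_step m h (f (real n * h)) (u (n + M)) x" for n x
  proof -
    have "real (n + M) * h = real n * h + real j" using assms by (simp add: algebra_simps)
    then show ?thesis using per[of "real n * h"] h_pos by simp
  qed
  note bb = euler_seq_bounded_borel bounded_borel_shift[OF euler_seq_bounded_borel]
  have "u (n + M) x \<le> u n x + of_int \<lceil>u M 0 + ?Q\<rceil>"
    by (rule euler_comparison[where a = "\<lambda>n x. u (n + M) x" and b = "\<lambda>n x. u n x + of_int \<lceil>u M 0 + ?Q\<rceil>"])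
      (simp_all only: bb step euler_seq_int_shift, use euler_seq_osc[of M _ 0] in \<open>simp, smt (verit) le_of_int_ceiling\<close>)
  moreover have "u n x + of_int \<lfloor>u M 0 - ?Q\<rfloor> \<le> u (n + M) x"
    by (rule euler_comparison[where b = "\<lambda>n x. u (n + M) x" and a = "\<lambda>n x. u n x + of_int \<lfloor>u M 0 - ?Q\<rfloor>"])
      (simp_all only: bb step euler_seq_int_shift, use euler_seq_osc[of M 0] in \<open>simp, smt (verit) of_int_floor_le\<close>)
  ultimately show ?thesis by linarith
qed

end

section \<open>Mollification\<close>

text \<open>Without reflection of the kernel, so derivatives in \<open>q\<close> carry a minus sign.
  The kernel may be vector-valued so that its gradient and Hessian are convolved by the same
  operation.\<close>

definition convolve :: "('a::euclidean_space \<Rightarrow> 'b::euclidean_space) \<Rightarrow> ('a \<Rightarrow> real) \<Rightarrow> 'a \<Rightarrow> 'b" where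
  "convolve k w q = (\<integral>y. w y *\<^sub>R k (y - q) \<partial>lborel)"

definition compact_kernel :: "real \<Rightarrow> ('a::euclidean_space \<Rightarrow> 'b::real_normed_vector) \<Rightarrow> bool" where
  "compact_kernel \<kappa> k \<longleftrightarrow> continuous_on UNIV k \<and> (\<forall>x. \<kappa> \<le> norm x \<longrightarrow> k x = 0)"

lemma compact_kernel_bounded:
  fixes k :: "'a::euclidean_space \<Rightarrow> 'b::real_normed_vector"
  assumes "compact_kernel \<kappa> k"
  obtains M where "M > 0" "\<And>x. norm (k x) \<le> M"
proof -
  have "compact (k ` cball 0 \<kappa>)"
    using assms continuous_on_subset unfolding compact_kernel_def
    by (intro compact_continuous_image) (blast, simp)
  then obtain M where M: "M > 0" "\<forall>y\<in>k ` cball 0 \<kappa>. norm y \<le> M"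
    using compact_imp_bounded bounded_pos by blast
  have "norm (k x) \<le> M" for x
    using assms M unfolding compact_kernel_def by (cases "norm x \<le> \<kappa>") auto
  with M show ?thesis using that by blast
qed

lemma compact_kernel_uniform:
  fixes k :: "'a::euclidean_space \<Rightarrow> 'b::real_normed_vector"
  assumes k: "compact_kernel \<kappa> k" and e: "e > 0"
  obtains d where "d > 0" "\<And>x y. norm (x - y) < d \<Longrightarrow> norm (k x - k y) < e"
proof -
  have "uniformly_continuous_on (cball 0 (\<kappa> + 2)) k"
    using k continuous_on_subset unfolding compact_kernel_def
    by (intro compact_uniformly_continuous) (blast, simp)
  then obtain d where d: "d > 0"
    "\<And>x y. x \<in> cball 0 (\<kappa> + 2) \<Longrightarrow> y \<in> cball 0 (\<kappa> + 2) \<Longrightarrow> dist y x < d \<Longrightarrow> dist (k y) (k x) < e"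
    using e unfolding uniformly_continuous_on_def by blast
  have "norm (k x - k y) < e" if "norm (x - y) < min d 1" for x y
  proof (cases "norm x \<le> \<kappa> + 2 \<and> norm y \<le> \<kappa> + 2")
    case True
    then show ?thesis using d(2)[of y x] that by (auto simp: dist_norm)
  next
    \<comment> \<open>If one of the points lies outside radius \<open>\<kappa> + 2\<close>, the
      other, at distance below 1, is still outside radius \<open>\<kappa>\<close>; both values
      vanish.\<close>
    case False
    then have "norm x \<ge> \<kappa>" "norm y \<ge> \<kappa>"
      using that norm_triangle_ineq2[of x y] norm_triangle_ineq2[of y x] by (auto simp: norm_minus_commute)
    then show ?thesis using k e unfolding compact_kernel_def by simp
  qed
  then show ?thesis using that[of "min d 1"] d by simp
qed

lemma convolve_bound:
  fixes k :: "'a::euclidean_space \<Rightarrow> 'b::euclidean_space"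
  assumes [measurable]: "k \<in> borel_measurable borel" and w: "w \<in> borel_measurable borel" "\<And>x. \<bar>w x\<bar> \<le> B"
    and k: "\<And>a. norm (k a) \<le> E" "\<And>a. R \<le> norm a \<Longrightarrow> k a = 0"
  shows "integrable lborel (\<lambda>y. w y *\<^sub>R k (y - q))"
    and "norm (convolve k w q) \<le> B * E * measure lborel (cball (0::'a) R)"
proof -
  note [measurable] = w(1)
  have B: "B \<ge> 0" using w(2)[of 0] by linarith
  have E: "E \<ge> 0" using k(1)[of 0] norm_ge_zero order_trans by blast
  have fin: "integrable lborel (\<lambda>y. B * E * indicator (cball q R) y)"
    by (intro integrable_mult_right integrable_real_indicator) (auto intro: emeasure_bounded_finite[OF bounded_cball, simplified])
  have le: "norm (w y *\<^sub>R k (y - q)) \<le> B * E * indicator (cball q R) y" for y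
  proof (cases "norm (y - q) \<le> R")
    case True
    then show ?thesis using w(2) k(1) B by (simp add: dist_norm norm_minus_commute mult_mono)
  next
    case False
    then show ?thesis using k(2)[of "y - q"] B E by (simp add: indicator_def)
  qed
  show int: "integrable lborel (\<lambda>y. w y *\<^sub>R k (y - q))"
  proof (rule Bochner_Integration.integrable_bound[OF fin])
    show "AE y in lborel. norm (w y *\<^sub>R k (y - q)) \<le> norm (B * E * indicator (cball q R) y)"
      by (intro AE_I2 order_trans[OF le]) auto
  qed measurable
  have "norm (convolve k w q) \<le> (\<integral>y. norm (w y *\<^sub>R k (y - q)) \<partial>lborel)"
    unfolding convolve_def by (rule integral_norm_bound)
  also have "\<dots> \<le> (\<integral>y. B * E * indicator (cball q R) y \<partial>lborel)"
    by (rule integral_mono[OF integrable_norm[OF int] fin le])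
  also have "\<dots> = B * E * measure lborel (cball q R)" by simp
  also have "measure lborel (cball q R) = measure lborel (cball (0::'a) R)"
    by (cases "R \<ge> 0") (simp_all add: content_cball)
  finally show "norm (convolve k w q) \<le> B * E * measure lborel (cball (0::'a) R)" .
qed

lemma convolve_diff:
  fixes k :: "'a::euclidean_space \<Rightarrow> 'b::euclidean_space"
  shows "convolve k w (q + h) = convolve (\<lambda>a. k (a - h)) w q"
  by (simp add: convolve_def algebra_simps)

lemma compact_kernel_convolve:
  fixes k :: "'a::euclidean_space \<Rightarrow> 'b::euclidean_space"
  assumes "compact_kernel \<kappa> k" "bounded_borel w"
  shows "integrable lborel (\<lambda>y. w y *\<^sub>R k (y - q))"
    and "integrable lborel (\<lambda>y. w y *\<^sub>R k (y - q - h))"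
proof -
  obtain M where M: "\<And>x. norm (k x) \<le> M" using compact_kernel_bounded assms by blast
  obtain B where B: "w \<in> borel_measurable borel" "\<And>x. \<bar>w x\<bar> \<le> B" using assms unfolding bounded_borel_def by blast
  have "k \<in> borel_measurable borel"
    using assms unfolding compact_kernel_def by (intro borel_measurable_continuous_onI) simp
  note * = convolve_bound(1)[OF this B M, of \<kappa>]
  show "integrable lborel (\<lambda>y. w y *\<^sub>R k (y - q))" "integrable lborel (\<lambda>y. w y *\<^sub>R k (y - q - h))"
    using *[of q] *[of "q + h"] assms unfolding compact_kernel_def by (auto simp: diff_diff_eq)
qed

text \<open>\<open>w\<close> is only bounded and measurable, so the increment is moved onto the
  kernel, which is uniformly continuous.\<close>

lemma continuous_convolve:
  fixes k :: "'a::euclidean_space \<Rightarrow> 'b::euclidean_space"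
  assumes k: "compact_kernel \<kappa> k" and w: "bounded_borel w"
  shows "continuous_on UNIV (convolve k w)"
proof -
  obtain B where B: "w \<in> borel_measurable borel" "\<And>x. \<bar>w x\<bar> \<le> B" using w unfolding bounded_borel_def by blast
  \<comment> \<open>Radius \<open>\<kappa> + 1\<close> contains the supports of all kernels shifted
    by less than 1; the summand 1 keeps \<open>A\<close> positive.\<close>
  define A where "A = \<bar>B\<bar> * measure lborel (cball (0::'a) (\<kappa> + 1)) + 1"
  have A: "A > 0" unfolding A_def by (intro add_nonneg_pos mult_nonneg_nonneg) auto
  have mk: "k \<in> borel_measurable borel"
    using k unfolding compact_kernel_def by (intro borel_measurable_continuous_onI) simp
  have "\<exists>d>0. \<forall>q'. dist q' q < d \<longrightarrow> dist (convolve k w q') (convolve k w q) < e" if e: "e > 0" for e q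
  proof -
    obtain d where d: "d > 0" "\<And>x y. norm (x - y) < d \<Longrightarrow> norm (k x - k y) < e / A"
      using compact_kernel_uniform[OF k, of "e / A"] e A by auto
    show ?thesis
    proof (intro exI[of _ "min d 1"] conjI allI impI)
      fix q' assume q': "dist q' q < min d 1"
      define h where "h = q' - q"
      have h: "norm h < d" "norm h < 1" using q' by (auto simp: h_def dist_norm)
      let ?K = "\<lambda>a. k (a - h) - k a"
      have eq: "convolve k w q' - convolve k w q = convolve ?K w q"
      proof -
        have "q' = q + h" by (simp add: h_def)
        then have "convolve k w q' = convolve (\<lambda>a. k (a - h)) w q" by (simp add: convolve_diff)
        then show ?thesis unfolding convolve_def
          using compact_kernel_convolve[OF k w] by (simp add: scaleR_diff_right)
      qed
      have "norm (convolve ?K w q) \<le> B * (e / A) * measure lborel (cball (0::'a) (\<kappa> + 1))"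
      proof (rule convolve_bound(2)[OF _ B])
        show "?K \<in> borel_measurable borel" using mk by measurable
        show "norm (?K a) \<le> e / A" for a using d(2)[of "a - h" a] h by (auto intro: less_imp_le)
        show "?K a = 0" if "\<kappa> + 1 \<le> norm a" for a
        proof -
          have "norm (a - h) \<ge> \<kappa>" using norm_triangle_ineq2[of a h] h that by linarith
          then show ?thesis using k that unfolding compact_kernel_def by simp
        qed
      qed
      also have "\<dots> \<le> (e / A) * (\<bar>B\<bar> * measure lborel (cball (0::'a) (\<kappa> + 1)))"
      proof -
        have "B * (e / A) * measure lborel (cball (0::'a) (\<kappa> + 1)) = (e / A) * (B * measure lborel (cball (0::'a) (\<kappa> + 1)))"
          by (simp only: mult_ac)
        also have "\<dots> \<le> (e / A) * (\<bar>B\<bar> * measure lborel (cball (0::'a) (\<kappa> + 1)))"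
          using e A by (intro mult_left_mono mult_right_mono) auto
        finally show ?thesis .
      qed
      also have "\<dots> < (e / A) * A" using e A by (intro mult_strict_left_mono) (auto simp: A_def)
      also have "\<dots> = e" using A by simp
      finally show "dist (convolve k w q') (convolve k w q) < e" by (simp add: dist_norm eq)
    qed (use d in auto)
  qed
  then show ?thesis unfolding continuous_on_iff by blast
qed

text \<open>Again the increment falls on the kernel. Its Taylor remainder is uniformly small
  relative to \<open>norm h\<close> because \<open>k'\<close>, read as an operator-valued map, is
  continuous with compact support.\<close>

lemma has_derivative_convolve:
  fixes k :: "'a::euclidean_space \<Rightarrow> 'b::euclidean_space"
  assumes k: "compact_kernel \<kappa> k" and w: "bounded_borel w"
    and dk: "\<And>x. (k has_derivative k' x) (at x)"
    and k': "\<And>h. compact_kernel \<kappa> (\<lambda>x. k' x h)"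
  shows "(convolve k w has_derivative (\<lambda>h. - convolve (\<lambda>x. k' x h) w q)) (at q)"
proof -
  obtain B where B: "w \<in> borel_measurable borel" "\<And>x. \<bar>w x\<bar> \<le> B" using w unfolding bounded_borel_def by blast
  have bl: "bounded_linear (k' x)" for x using dk has_derivative_bounded_linear by blast
  note lin = bounded_linear.linear[OF bl]
  define kb where "kb x = Blinfun (k' x)" for x
  have kb: "blinfun_apply (kb x) = k' x" for x unfolding kb_def by (rule bounded_linear_Blinfun_apply[OF bl])
  have kbc: "compact_kernel \<kappa> kb"
    unfolding compact_kernel_def
  proof (intro conjI allI impI)
    show "continuous_on UNIV kb"
      using k' unfolding compact_kernel_def by (intro continuous_on_blinfun_componentwise) (simp add: kb)
    show "kb x = 0" if "\<kappa> \<le> norm x" for x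
      using k' that unfolding compact_kernel_def by (intro blinfun_eqI) (simp add: kb)
  qed
  define A where "A = \<bar>B\<bar> * measure lborel (cball (0::'a) (\<kappa> + 1)) + 1"
  have A: "A > 0" unfolding A_def by (intro add_nonneg_pos mult_nonneg_nonneg) auto
  note int = compact_kernel_convolve(1)[OF k' w]
  show ?thesis unfolding has_derivative_at_alt
  proof (intro conjI allI impI)
    have "linear (\<lambda>h. - convolve (\<lambda>x. k' x h) w q)"
    proof (rule linearI)
      show "- convolve (\<lambda>x. k' x (a + b)) w q = - convolve (\<lambda>x. k' x a) w q + - convolve (\<lambda>x. k' x b) w q" for a b
        using int by (simp add: convolve_def linear_add[OF lin] scaleR_add_right)
      show "- convolve (\<lambda>x. k' x (r *\<^sub>R b)) w q = r *\<^sub>R - convolve (\<lambda>x. k' x b) w q" for r b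
      proof -
        have "convolve (\<lambda>x. k' x (r *\<^sub>R b)) w q = (\<integral>y. r *\<^sub>R (w y *\<^sub>R k' (y - q) b) \<partial>lborel)"
          by (simp add: convolve_def linear_scale[OF lin] mult.commute)
        then show ?thesis by (simp only: convolve_def integral_scaleR_right scaleR_minus_right)
      qed
    qed
    then show "bounded_linear (\<lambda>h. - convolve (\<lambda>x. k' x h) w q)"
      by (simp add: linear_conv_bounded_linear)
    fix e :: real assume e: "e > 0"
    obtain d where d: "d > 0" "\<And>x y. norm (x - y) < d \<Longrightarrow> norm (kb x - kb y) < e / A"
      using compact_kernel_uniform[OF kbc, of "e / A"] e A by auto
    have lin_est: "norm (k (a - h) - k a + k' a h) \<le> norm h * (e / A)" if h: "norm h < d" for a h
    proof -
      have "norm (k (a - h) - k a - k' a (a - h - a)) \<le> norm (a - h - a) * (e / A)"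
      proof (rule differentiable_bound_linearization[of a "a - h" "cball a (norm h)" k k' a])
        show "a + t *\<^sub>R (a - h - a) \<in> cball a (norm h)" if "t \<in> {0..1}" for t
          using that by (simp add: dist_norm mult_left_le_one_le)
        show "(k has_derivative k' x) (at x within cball a (norm h))" for x
          using dk has_derivative_at_withinI by blast
        show "onorm (k' x - k' a) \<le> e / A" if x: "x \<in> cball a (norm h)" for x
        proof -
          have "norm (kb x - kb a) < e / A"
            using x h by (intro d(2)) (auto simp: dist_norm norm_minus_commute)
          then show ?thesis by (simp add: norm_blinfun.rep_eq minus_blinfun.rep_eq kb fun_diff_def less_imp_le)
        qed
      qed simp
      moreover have "k' a (a - h - a) = - k' a h" using linear_neg[OF lin] by simp
      ultimately show ?thesis by simp
    qed
    show "\<exists>d>0. \<forall>q'. norm (q' - q) < d \<longrightarrow>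
       norm (convolve k w q' - convolve k w q - (- convolve (\<lambda>x. k' x (q' - q)) w q)) \<le> e * norm (q' - q)"
    proof (intro exI[of _ "min d 1"] conjI allI impI)
      fix q' assume q': "norm (q' - q) < min d 1"
      define h where "h = q' - q"
      have h: "norm h < d" "norm h < 1" using q' by (auto simp: h_def)
      let ?K = "\<lambda>a. k (a - h) - k a + k' a h"
      have eq: "convolve k w q' - convolve k w q - (- convolve (\<lambda>x. k' x h) w q) = convolve ?K w q"
      proof -
        have "q' = q + h" by (simp add: h_def)
        then have "convolve k w q' = convolve (\<lambda>a. k (a - h)) w q" by (simp add: convolve_diff)
        then show ?thesis unfolding convolve_def
          using compact_kernel_convolve[OF k w] int by (simp add: scaleR_diff_right scaleR_add_right)
      qed
      have "norm (convolve ?K w q) \<le> B * (norm h * (e / A)) * measure lborel (cball (0::'a) (\<kappa> + 1))"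
      proof (rule convolve_bound(2)[OF _ B])
        have [measurable]: "k \<in> borel_measurable borel" "(\<lambda>x. k' x h) \<in> borel_measurable borel"
          using k k' unfolding compact_kernel_def by (auto intro!: borel_measurable_continuous_onI)
        show "?K \<in> borel_measurable borel" by measurable
        show "norm (?K a) \<le> norm h * (e / A)" for a by (rule lin_est[OF h(1)])
        show "?K a = 0" if "\<kappa> + 1 \<le> norm a" for a
        proof -
          have "norm (a - h) \<ge> \<kappa>" using norm_triangle_ineq2[of a h] h that by linarith
          then show ?thesis using k k' that unfolding compact_kernel_def by simp
        qed
      qed
      also have "\<dots> = (norm h * (e / A)) * (B * measure lborel (cball (0::'a) (\<kappa> + 1)))"
        by (simp add: mult_ac)
      also have "\<dots> \<le> (norm h * (e / A)) * A"
      proof (rule mult_left_mono)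
        have "B * measure lborel (cball (0::'a) (\<kappa> + 1)) \<le> \<bar>B\<bar> * measure lborel (cball (0::'a) (\<kappa> + 1))"
          by (intro mult_right_mono) auto
        then show "B * measure lborel (cball (0::'a) (\<kappa> + 1)) \<le> A" by (simp add: A_def)
      qed (use e A in auto)
      also have "\<dots> = e * norm h" using A by simp
      finally show "norm (convolve k w q' - convolve k w q - (- convolve (\<lambda>x. k' x (q' - q)) w q)) \<le> e * norm (q' - q)"
        using eq by (simp add: h_def)
    qed (use d in auto)
  qed
qed

section \<open>A compactly supported mollifying kernel with two continuous derivatives\<close>

lemma has_derivative_max_0_power:
  "((\<lambda>s. max 0 s ^ Suc (Suc n)) has_real_derivative real (Suc (Suc n)) * max 0 s ^ Suc n) (at (s::real))"
proof -
  consider "s > 0" | "s < 0" | "s = 0" by linarith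
  then show ?thesis
  proof cases
    case 1
    have "((\<lambda>s. s ^ Suc (Suc n)) has_real_derivative real (Suc (Suc n)) * s ^ Suc n) (at s)"
      using DERIV_pow[of "Suc (Suc n)" s UNIV] by simp
    then have "((\<lambda>s. max 0 s ^ Suc (Suc n)) has_real_derivative real (Suc (Suc n)) * s ^ Suc n) (at s)"
      by (rule has_field_derivative_transform_within_open[where S = "{0<..}"]) (use 1 in auto)
    then show ?thesis using 1 by simp
  next
    case 2
    have "((\<lambda>s. 0) has_real_derivative 0) (at s)" by simp
    then have "((\<lambda>s. max 0 s ^ Suc (Suc n)) has_real_derivative 0) (at s)"
      by (rule has_field_derivative_transform_within_open[where S = "{..<0}"]) (use 2 in auto)
    then show ?thesis using 2 by simp
  next
    \<comment> \<open>At the kink the difference quotient is at most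
      \<open>\<bar>h\<bar> ^ Suc n\<close>; here an exponent of at least two matters.\<close>
    case 3
    have "((\<lambda>h. max 0 h ^ Suc (Suc n) / h) \<longlongrightarrow> 0) (at (0::real))"
    proof (rule tendsto_0_le[where f = "\<lambda>h::real. \<bar>h\<bar> ^ Suc n" and K = 1])
      show "\<forall>\<^sub>F h in at (0::real). norm (max 0 h ^ Suc (Suc n) / h) \<le> norm (\<bar>h\<bar> ^ Suc n) * 1"
        by (auto simp: eventually_at abs_mult max_def power_abs mult_nonpos_nonneg intro!: exI[of _ 1])
      show "((\<lambda>h. \<bar>h\<bar> ^ Suc n) \<longlongrightarrow> 0) (at (0::real))"
        by (auto intro!: tendsto_eq_intros)
    qed
    then show ?thesis using 3 by (simp add: DERIV_def)
  qed
qed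

text \<open>The third power is the least integer exponent that makes a truncated polynomial of this
  kind twice continuously differentiable, and it keeps both derivatives explicit.\<close>

definition bump :: "real \<Rightarrow> 'a::euclidean_space \<Rightarrow> real" where
  "bump \<kappa> y = max 0 (\<kappa>\<^sup>2 - y \<bullet> y) ^ 3"

lemma bump_derivatives:
  fixes y :: "'a::euclidean_space"
  shows "(bump \<kappa> has_derivative (\<lambda>h. ((- 6 * max 0 (\<kappa>\<^sup>2 - y \<bullet> y) ^ 2) *\<^sub>R y) \<bullet> h)) (at y)"
    and "((\<lambda>y. (- 6 * max 0 (\<kappa>\<^sup>2 - y \<bullet> y) ^ 2) *\<^sub>R y) has_derivative
      (\<lambda>h. (24 * max 0 (\<kappa>\<^sup>2 - y \<bullet> y) * (y \<bullet> h)) *\<^sub>R y - (6 * max 0 (\<kappa>\<^sup>2 - y \<bullet> y) ^ 2) *\<^sub>R h)) (at y)"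
proof -
  have i: "((\<lambda>y. \<kappa>\<^sup>2 - y \<bullet> y) has_derivative (\<lambda>h. - 2 * (y \<bullet> h))) (at y)"
    by (auto intro!: derivative_eq_intros simp: inner_commute)
  have P3: "((\<lambda>s. max 0 s ^ 3) has_real_derivative 3 * max 0 s ^ 2) (at s)" for s :: real
    using has_derivative_max_0_power[of 1 s] by (simp add: numeral_eq_Suc)
  have P2: "((\<lambda>s. max 0 s ^ 2) has_real_derivative 2 * max 0 s) (at s)" for s :: real
    using has_derivative_max_0_power[of 0 s] by (simp add: numeral_eq_Suc)
  note c3 = DERIV_compose_FDERIV[OF P3 i]
  have c2: "((\<lambda>y. - 6 * max 0 (\<kappa>\<^sup>2 - y \<bullet> y) ^ 2) has_derivative (\<lambda>h. 24 * max 0 (\<kappa>\<^sup>2 - y \<bullet> y) * (y \<bullet> h))) (at y)"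
    by (rule has_derivative_eq_rhs[OF has_derivative_mult_right[OF DERIV_compose_FDERIV[OF P2 i]]])
       (simp add: fun_eq_iff)
  show "(bump \<kappa> has_derivative (\<lambda>h. ((- 6 * max 0 (\<kappa>\<^sup>2 - y \<bullet> y) ^ 2) *\<^sub>R y) \<bullet> h)) (at y)"
    unfolding bump_def[abs_def] by (rule has_derivative_eq_rhs[OF c3]) (auto simp: fun_eq_iff)
  show "((\<lambda>y. (- 6 * max 0 (\<kappa>\<^sup>2 - y \<bullet> y) ^ 2) *\<^sub>R y) has_derivative
      (\<lambda>h. (24 * max 0 (\<kappa>\<^sup>2 - y \<bullet> y) * (y \<bullet> h)) *\<^sub>R y - (6 * max 0 (\<kappa>\<^sup>2 - y \<bullet> y) ^ 2) *\<^sub>R h)) (at y)"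
    by (rule has_derivative_eq_rhs[OF has_derivative_scaleR[OF c2 has_derivative_ident]])
       (auto simp: fun_eq_iff algebra_simps)
qed

lemma bump_zero: "\<kappa> > 0 \<Longrightarrow> \<kappa> \<le> norm y \<Longrightarrow> max 0 (\<kappa>\<^sup>2 - y \<bullet> y) = 0"
  by (simp add: power2_norm_eq_inner[symmetric] power_mono)

lemma mollifier_exists:
  assumes \<kappa>: "\<kappa> > 0"
  obtains \<rho> :: "'a::euclidean_space \<Rightarrow> real" and L
  where "\<And>y. \<rho> y \<ge> 0" "compact_kernel \<kappa> \<rho>" "(\<integral>y. \<rho> y \<partial>lborel) = 1"
    "\<And>w B. w \<in> borel_measurable borel \<Longrightarrow> (\<And>x. \<bar>w x\<bar> \<le> B) \<Longrightarrow>
      \<exists>\<Gamma> \<Gamma>'. (\<forall>q. (convolve \<rho> w has_derivative (\<lambda>h. \<Gamma> q \<bullet> h)) (at q)) \<and>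
        (\<forall>q. (\<Gamma> has_derivative \<Gamma>' q) (at q)) \<and> (\<forall>h. continuous_on UNIV (\<lambda>q. \<Gamma>' q h)) \<and>
        (\<forall>q h. norm (\<Gamma>' q h) \<le> B * L * norm h)"
proof -
  define m where "m y = max 0 (\<kappa>\<^sup>2 - y \<bullet> y)" for y :: 'a
  define G where "G y = (- 6 * m y ^ 2) *\<^sub>R y" for y
  define G' where "G' y h = (24 * m y * (y \<bullet> h)) *\<^sub>R y - (6 * m y ^ 2) *\<^sub>R h" for y h
  have m_cont: "continuous_on UNIV m" unfolding m_def by (intro continuous_intros)
  have m0: "m y = 0" if "\<kappa> \<le> norm y" for y using bump_zero[OF \<kappa> that] by (simp add: m_def)
  have m_le: "0 \<le> m y" "m y \<le> \<kappa>\<^sup>2" for y unfolding m_def by auto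
  have b_eq: "bump \<kappa> y = m y ^ 3" for y by (simp add: bump_def m_def)
  have ckb: "compact_kernel \<kappa> (bump \<kappa> :: 'a \<Rightarrow> real)"
    unfolding compact_kernel_def b_eq[abs_def] using m0 by (auto intro!: continuous_intros m_cont)
  have ckG: "compact_kernel \<kappa> G"
    unfolding compact_kernel_def G_def using m0 by (auto intro!: continuous_intros m_cont)
  have ckG': "compact_kernel \<kappa> (\<lambda>y. G' y h)" for h
    unfolding compact_kernel_def G'_def using m0 by (auto intro!: continuous_intros m_cont)
  have dG: "(G has_derivative G' y) (at y)" for y
    using bump_derivatives(2)[of \<kappa> y] by (simp add: G_def[abs_def] G'_def[abs_def] m_def)
  have db: "(bump \<kappa> has_derivative (\<lambda>h. G y \<bullet> h)) (at y)" for y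
    using bump_derivatives(1)[of \<kappa> y] by (simp add: G_def m_def)
  have int: "integrable lborel (bump \<kappa> :: 'a \<Rightarrow> real)"
  proof -
    have "bounded_borel (\<lambda>_::'a. 1::real)" unfolding bounded_borel_def by auto
    from compact_kernel_convolve(1)[OF ckb this, of 0] show ?thesis by simp
  qed
  define Z where "Z = (\<integral>y. bump \<kappa> (y::'a) \<partial>lborel)"
  have Z: "Z > 0"
  proof -
    \<comment> \<open>The value of the bump at radius \<open>\<kappa> / 2\<close>, which bounds it
      from below on the half ball and makes the normalisation \<open>Z\<close> positive.\<close>
    define c where "c = (\<kappa>\<^sup>2 - (\<kappa>/2)\<^sup>2) ^ 3"
    have "\<kappa>\<^sup>2 > (\<kappa>/2)\<^sup>2" using \<kappa> by (simp add: power2_eq_square)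
    then have c: "c > 0" by (simp add: c_def)
    have "0 < c * measure lborel (cball (0::'a) (\<kappa>/2))" using c \<kappa> by (simp add: content_cball)
    also have "\<dots> = (\<integral>y. c * indicator (cball (0::'a) (\<kappa>/2)) y \<partial>lborel)" by simp
    also have "\<dots> \<le> Z" unfolding Z_def
    proof (rule integral_mono)
      show "integrable lborel (\<lambda>y. c * indicator (cball (0::'a) (\<kappa>/2)) y)"
        by (intro integrable_mult_right integrable_real_indicator) (auto intro: emeasure_bounded_finite[OF bounded_cball, simplified])
      show "c * indicator (cball 0 (\<kappa>/2)) y \<le> bump \<kappa> y" for y :: 'a
      proof (cases "norm y \<le> \<kappa>/2")
        case True
        then have "y \<bullet> y \<le> (\<kappa>/2)\<^sup>2" by (simp add: power2_norm_eq_inner[symmetric] power_mono)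
        then have "c \<le> bump \<kappa> y" unfolding c_def bump_def
          using \<open>\<kappa>\<^sup>2 > (\<kappa>/2)\<^sup>2\<close> by (intro power_mono) auto
        then show ?thesis using True by simp
      next
        case False
        then show ?thesis by (simp add: bump_def indicator_def)
      qed
    qed (rule int)
    finally show ?thesis .
  qed
  define \<rho> where "\<rho> y = bump \<kappa> y / Z" for y :: 'a
  \<comment> \<open>30 = 24 + 6 collects the two terms of the Hessian of the bump. \<open>L\<close>
    depends on \<open>\<kappa>\<close> and the dimension but not on \<open>w\<close>, so smoothed
    functions share a Hessian bound that is linear in their sup bound.\<close>
  define L where "L = (30 * \<kappa> ^ 4 / Z) * measure lborel (cball (0::'a) \<kappa>)"
  show ?thesis
  proof (rule that[of \<rho> L])
    show "\<rho> y \<ge> 0" for y using Z by (simp add: \<rho>_def bump_def)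
    show "compact_kernel \<kappa> \<rho>"
      using ckb Z unfolding compact_kernel_def \<rho>_def by (auto intro!: continuous_intros)
    show "(\<integral>y. \<rho> y \<partial>lborel) = 1" using Z by (simp add: \<rho>_def Z_def[symmetric])
    fix w :: "'a \<Rightarrow> real" and B assume w: "w \<in> borel_measurable borel" "\<And>x. \<bar>w x\<bar> \<le> B"
    then have bb: "bounded_borel w" unfolding bounded_borel_def by blast
    let ?\<Gamma> = "\<lambda>q. - (convolve G w q /\<^sub>R Z)" and ?\<Gamma>' = "\<lambda>q h. convolve (\<lambda>x. G' x h) w q /\<^sub>R Z"
    have \<rho>_eq: "convolve \<rho> w = (\<lambda>q. convolve (bump \<kappa>) w q / Z)"
      by (simp add: convolve_def \<rho>_def fun_eq_iff)
    show "\<exists>\<Gamma> \<Gamma>'. (\<forall>q. (convolve \<rho> w has_derivative (\<lambda>h. \<Gamma> q \<bullet> h)) (at q)) \<and>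
        (\<forall>q. (\<Gamma> has_derivative \<Gamma>' q) (at q)) \<and> (\<forall>h. continuous_on UNIV (\<lambda>q. \<Gamma>' q h)) \<and>
        (\<forall>q h. norm (\<Gamma>' q h) \<le> B * L * norm h)"
    proof (intro exI[of _ ?\<Gamma>] exI[of _ ?\<Gamma>'] conjI allI)
      show "(convolve \<rho> w has_derivative (\<lambda>h. ?\<Gamma> q \<bullet> h)) (at q)" for q
      proof -
        have "compact_kernel \<kappa> (\<lambda>x. G x \<bullet> h)" for h
          using ckG unfolding compact_kernel_def by (auto intro!: continuous_intros)
        from has_derivative_convolve[OF ckb bb db this, of q]
        have "(convolve \<rho> w has_derivative (\<lambda>h. - convolve (\<lambda>x. G x \<bullet> h) w q / Z)) (at q)"
          unfolding \<rho>_eq divide_inverse by (rule has_derivative_mult_left)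
        moreover have "convolve (\<lambda>x. G x \<bullet> h) w q = convolve G w q \<bullet> h" for h
          unfolding convolve_def
          by (subst integral_inner_left[symmetric])
             (use compact_kernel_convolve(1)[OF ckG bb] in \<open>auto simp: inner_scaleR_left\<close>)
        ultimately show ?thesis by (simp add: divide_inverse mult.commute)
      qed
      show "(?\<Gamma> has_derivative ?\<Gamma>' q) (at q)" for q
        using has_derivative_minus[OF has_derivative_scaleR_right[OF has_derivative_convolve[OF ckG bb dG ckG'], of "inverse Z" q]]
        by simp
      show "continuous_on UNIV (\<lambda>q. ?\<Gamma>' q h)" for h
        by (intro continuous_intros continuous_convolve[OF ckG' bb])
      show "norm (?\<Gamma>' q h) \<le> B * L * norm h" for q h
      proof -
        have "norm (convolve (\<lambda>x. G' x h) w q) \<le> B * (30 * \<kappa> ^ 4 * norm h) * measure lborel (cball (0::'a) \<kappa>)"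
        proof (rule convolve_bound(2)[OF _ w])
          show "(\<lambda>x. G' x h) \<in> borel_measurable borel"
            using ckG' unfolding compact_kernel_def by (auto intro!: borel_measurable_continuous_onI)
          show "G' a h = 0" if "\<kappa> \<le> norm a" for a using ckG' that unfolding compact_kernel_def by blast
          show "norm (G' a h) \<le> 30 * \<kappa> ^ 4 * norm h" for a
          proof (cases "\<kappa> \<le> norm a")
            case True then show ?thesis using ckG' \<kappa> unfolding compact_kernel_def by simp
          next
            case False
            have "norm (G' a h) \<le> norm ((24 * m a * (a \<bullet> h)) *\<^sub>R a) + norm ((6 * m a ^ 2) *\<^sub>R h)"
              unfolding G'_def by (rule norm_triangle_ineq4)
            also have "norm ((24 * m a * (a \<bullet> h)) *\<^sub>R a) = 24 * (m a * (\<bar>a \<bullet> h\<bar> * norm a))"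
              using m_le by (simp add: abs_mult)
            also have "\<dots> \<le> 24 * (\<kappa>\<^sup>2 * ((\<kappa> * norm h) * \<kappa>))"
            proof -
              have "\<bar>a \<bullet> h\<bar> \<le> norm a * norm h" by (rule Cauchy_Schwarz_ineq2)
              also have "\<dots> \<le> \<kappa> * norm h" using False by (intro mult_right_mono) auto
              finally show ?thesis using False \<kappa> m_le
                by (intro mult_left_mono mult_mono) auto
            qed
            also have "norm ((6 * m a ^ 2) *\<^sub>R h) \<le> 6 * (\<kappa>\<^sup>2)\<^sup>2 * norm h"
            proof -
              have "m a ^ 2 \<le> (\<kappa>\<^sup>2)\<^sup>2" using m_le by (intro power_mono) auto
              then show ?thesis by (simp add: mult_right_mono)
            qed
            finally show ?thesis by (simp add: algebra_simps power2_eq_square power4_eq_xxxx)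
          qed
        qed
        then have "norm (convolve (\<lambda>x. G' x h) w q) / Z \<le> B * (30 * \<kappa> ^ 4 * norm h) * measure lborel (cball (0::'a) \<kappa>) / Z"
          using Z by (intro divide_right_mono) auto
        then show ?thesis using Z by (simp add: L_def divide_inverse mult_ac)
      qed
    qed
  qed
qed

text \<open>Averaging against a probability density of radius \<open>\<kappa>\<close>. With
  \<open>c = 0\<close> it yields sup bounds; with \<open>c\<close> a value of the right-hand side it
  bounds the commutator of smoothing and nonlinearity.\<close>

lemma convolve_close:
  fixes \<rho> :: "'a::euclidean_space \<Rightarrow> real"
  assumes \<rho>: "\<And>y. \<rho> y \<ge> 0" "compact_kernel \<kappa> \<rho>" "(\<integral>y. \<rho> y \<partial>lborel) = 1"
    and w: "bounded_borel w" and close: "\<And>y. norm (y - q) < \<kappa> \<Longrightarrow> \<bar>w y - c\<bar> \<le> E"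
  shows "\<bar>convolve \<rho> w q - c\<bar> \<le> E"
proof -
  have m\<rho>: "\<rho> \<in> borel_measurable borel"
    using \<rho>(2) unfolding compact_kernel_def by (intro borel_measurable_continuous_onI) simp
  have 1: "(\<integral>y. \<rho> (y - q) \<partial>lborel) = 1"
    using lborel_integral_translate[OF m\<rho>, of "- q"] \<rho>(3) by simp
  have bc: "bounded_borel (\<lambda>_::'a. a::real)" for a unfolding bounded_borel_def by auto
  note iw = compact_kernel_convolve(1)[OF \<rho>(2) w, of q]
  note ic = compact_kernel_convolve(1)[OF \<rho>(2) bc, of _ q]
  have "convolve \<rho> w q - c = (\<integral>y. w y * \<rho> (y - q) \<partial>lborel) - (\<integral>y. c * \<rho> (y - q) \<partial>lborel)"
    by (simp add: convolve_def 1)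
  also have "\<dots> = (\<integral>y. w y * \<rho> (y - q) - c * \<rho> (y - q) \<partial>lborel)"
    using iw ic[of c] by simp
  finally have "\<bar>convolve \<rho> w q - c\<bar> \<le> (\<integral>y. \<bar>w y * \<rho> (y - q) - c * \<rho> (y - q)\<bar> \<partial>lborel)"
    using integral_abs_bound by simp
  also have "\<dots> \<le> (\<integral>y. E * \<rho> (y - q) \<partial>lborel)"
  proof (rule integral_mono)
    show "integrable lborel (\<lambda>y. \<bar>w y * \<rho> (y - q) - c * \<rho> (y - q)\<bar>)"
      using iw ic[of c] by (intro integrable_abs Bochner_Integration.integrable_diff) auto
    show "integrable lborel (\<lambda>y. E * \<rho> (y - q))" using ic[of E] by simp
    show "\<bar>w y * \<rho> (y - q) - c * \<rho> (y - q)\<bar> \<le> E * \<rho> (y - q)" for y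
    proof (cases "norm (y - q) < \<kappa>")
      case True
      have "\<bar>w y * \<rho> (y - q) - c * \<rho> (y - q)\<bar> = \<bar>w y - c\<bar> * \<rho> (y - q)"
        using \<rho>(1)[of "y - q"] by (simp add: left_diff_distrib[symmetric] abs_mult)
      also have "\<dots> \<le> E * \<rho> (y - q)" by (intro mult_right_mono close True \<rho>)
      finally show ?thesis .
    next
      case False
      then show ?thesis using \<rho>(2) unfolding compact_kernel_def by simp
    qed
  qed
  also have "\<dots> = E" by (simp add: 1)
  finally show ?thesis .
qed

section \<open>Truncated jump measures and smoothing of the scheme\<close>

definition levy_trunc :: "(real^'n \<Rightarrow> real) \<Rightarrow> real \<Rightarrow> (real^'n) measure" where
  "levy_trunc g \<delta> = density (levy_measure g) (\<lambda>z. ennreal (indicator {z. \<delta> < norm z} z))"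

context levy_kernel begin

lemma sets_levy_trunc [simp, measurable_cong]: "sets (levy_trunc g \<delta>) = sets borel"
  by (simp add: levy_trunc_def)

lemma levy_trunc_integral:
  fixes f :: "real^'n \<Rightarrow> real"
  assumes [measurable]: "f \<in> borel_measurable borel"
  shows "integral\<^sup>L (levy_trunc g \<delta>) f = (\<integral>z. indicator {z. \<delta> < norm z} z * f z \<partial>levy_measure g)"
  unfolding levy_trunc_def by (subst integral_density) auto

lemma finite_levy_trunc:
  assumes "\<delta> > 0"
  shows "finite_measure (levy_trunc g \<delta>)"
proof
  have "emeasure (levy_trunc g \<delta>) UNIV = (\<integral>\<^sup>+z. ennreal (indicator {z. \<delta> < norm z} z) \<partial>levy_measure g)"
    unfolding levy_trunc_def by (subst emeasure_density) auto
  also have "\<dots> \<le> (\<integral>\<^sup>+z. ennreal (levy_weight \<delta> z) \<partial>levy_measure g)"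
    by (intro nn_integral_mono ennreal_leI) (auto simp: levy_weight_def indicator_def)
  also have "\<dots> < \<infinity>"
    using integrable_levy_weight[OF assms] unfolding integrable_iff_bounded
    by (simp add: levy_weight_nonneg)
  finally show "emeasure (levy_trunc g \<delta>) (space (levy_trunc g \<delta>)) \<noteq> \<infinity>"
    by (simp add: levy_trunc_def)
qed

end

text \<open>\<open>v\<close> is smooth on the whole space-time, negative times included, but the
  residual is controlled only on \<open>{0..T}\<close>. The global quadratic bound and the sup bound
  make every increment of \<open>v\<close> integrable, so the splitting radius 1 is as good as any
  other.\<close>

definition approx_solution ::
  "(real^'n \<Rightarrow> real) \<Rightarrow> (real \<Rightarrow> real^'n \<Rightarrow> real \<Rightarrow> real) \<Rightarrow> real \<Rightarrow> real \<Rightarrow>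
   (real \<times> (real^'n) \<Rightarrow> real) \<Rightarrow> (real \<times> (real^'n) \<Rightarrow> real \<times> (real^'n)) \<Rightarrow> bool" where
  "approx_solution g f T \<eta> v \<Gamma> \<longleftrightarrow>
     C2_on space_time v \<and>
     (\<forall>q. (v has_derivative (\<lambda>h. \<Gamma> q \<bullet> h)) (at q)) \<and>
     (\<exists>\<Lambda>. \<forall>q k. \<bar>v (q + k) - v q - \<Gamma> q \<bullet> k\<bar> \<le> \<Lambda> * (norm k)\<^sup>2) \<and>
     (\<exists>B. \<forall>q. \<bar>v q\<bar> \<le> B) \<and>
     (\<forall>t\<in>{0..T}. \<forall>x. \<bar>fst (\<Gamma> (t, x))
        - mixed_op g 1 (\<lambda>y. v (t, y)) (\<lambda>y. v (t, y)) (snd (\<Gamma> (t, x))) x - f t x (v (t, x))\<bar> \<le> \<eta>)"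

text \<open>Extension by zero outside \<open>[0, T)\<close> gives a globally bounded Borel function
  that can be mollified. The artificial jumps at 0 and \<open>T\<close> are kept out of reach of the
  kernel by a time shift and a longer horizon.\<close>

definition step_interp :: "real \<Rightarrow> real \<Rightarrow> (nat \<Rightarrow> 'a \<Rightarrow> real) \<Rightarrow> real \<times> 'a \<Rightarrow> real" where
  "step_interp T h u q = (if 0 \<le> fst q \<and> fst q < T then u (nat \<lfloor>fst q / h\<rfloor>) (snd q) else 0)"

context euler_scheme begin

lemma euler_growth: "real n * h \<le> T \<Longrightarrow> (1 + h * C) ^ n \<le> exp (C * T)"
proof -
  assume n: "real n * h \<le> T"
  have "1 + h * C \<le> exp (h * C)" by (rule exp_ge_add_one_self)
  then have "(1 + h * C) ^ n \<le> exp (h * C) ^ n" using h_pos C_nonneg by (intro power_mono) auto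
  also have "\<dots> = exp (C * (real n * h))" by (simp add: exp_of_nat_mult[symmetric] mult_ac)
  also have "\<dots> \<le> exp (C * T)" using n C_nonneg by (simp add: mult_left_mono)
  finally show ?thesis .
qed

lemma euler_seq_time_lipschitz:
  assumes "n \<le> n'" "real n' * h \<le> T"
  shows "\<bar>u n' x - u n x\<bar> \<le> (F + 1) * exp (C * T) * (real (n' - n) * h)"
  using assms
proof (induction n' rule: dec_induct)
  case (step j)
  have jh: "real j * h \<le> T"
  proof -
    have "real j * h \<le> real (Suc j) * h" using h_pos by (simp add: algebra_simps)
    then show ?thesis using step by linarith
  qed
  have "\<bar>u (Suc j) x - u j x\<bar> \<le> h * ((F + 1) * (1 + h * C) ^ j)" by (rule euler_seq_increment)
  also have "\<dots> \<le> h * ((F + 1) * exp (C * T))"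
    using euler_growth[OF jh] h_pos F_nonneg by (intro mult_left_mono) auto
  finally have "\<bar>u (Suc j) x - u j x\<bar> \<le> (F + 1) * exp (C * T) * h" by (simp add: mult_ac)
  moreover have "\<bar>u j x - u n x\<bar> \<le> (F + 1) * exp (C * T) * (real (j - n) * h)" using step jh by blast
  moreover have "real (Suc j - n) = real (j - n) + 1" using step by (simp add: Suc_diff_le)
  ultimately show ?case by (simp add: algebra_simps del: euler_seq.simps)
qed simp

abbreviation w where "w T \<equiv> step_interp T h (euler_seq m h f)"

lemma nat_floor_div:
  assumes "0 \<le> s"
  shows "real (nat \<lfloor>s / h\<rfloor>) * h \<le> s" "s - h \<le> real (nat \<lfloor>s / h\<rfloor>) * h"
proof -
  have r: "real (nat \<lfloor>s / h\<rfloor>) = of_int \<lfloor>s / h\<rfloor>" using assms h_pos by simp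
  have "of_int \<lfloor>s / h\<rfloor> * h \<le> (s / h) * h" using h_pos by (intro mult_right_mono) auto
  then show "real (nat \<lfloor>s / h\<rfloor>) * h \<le> s" using r h_pos by simp
  have "(s / h - 1) * h \<le> of_int \<lfloor>s / h\<rfloor> * h" using h_pos by (intro mult_right_mono) linarith+
  then show "s - h \<le> real (nat \<lfloor>s / h\<rfloor>) * h" using r h_pos by (simp add: algebra_simps)
qed

lemma step_interp_lipschitz_aux:
  assumes "0 \<le> s" "s \<le> t" "t < T"
  shows "\<bar>w T (s, x) - w T (t, y)\<bar> \<le> (F + 1) * exp (C * T) * (\<bar>s - t\<bar> + h + norm (x - y))"
proof -
  let ?n = "nat \<lfloor>s / h\<rfloor>" and ?n' = "nat \<lfloor>t / h\<rfloor>" and ?L = "(F + 1) * exp (C * T)"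
  have nn: "?n \<le> ?n'" using assms h_pos by (intro nat_mono floor_mono divide_right_mono) auto
  note fs = nat_floor_div[of s] nat_floor_div[of t]
  have Th: "real ?n' * h \<le> T" "real ?n * h \<le> T" using fs assms by linarith+
  have "\<bar>u ?n' x - u ?n x\<bar> \<le> ?L * (real (?n' - ?n) * h)" by (rule euler_seq_time_lipschitz[OF nn Th(1)])
  also have "\<dots> \<le> ?L * (\<bar>s - t\<bar> + h)"
  proof (rule mult_left_mono)
    have "real (?n' - ?n) * h = real ?n' * h - real ?n * h" using nn by (simp add: of_nat_diff algebra_simps)
    then show "real (?n' - ?n) * h \<le> \<bar>s - t\<bar> + h" using fs assms by linarith
  qed (use F_nonneg in auto)
  finally have 1: "\<bar>u ?n' x - u ?n x\<bar> \<le> ?L * (\<bar>s - t\<bar> + h)" .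
  have "\<bar>u ?n' x - u ?n' y\<bar> \<le> (1 + h * C) ^ ?n' * norm (x - y)" by (rule euler_seq_lipschitz)
  also have "\<dots> \<le> exp (C * T) * norm (x - y)" using euler_growth[OF Th(1)] by (intro mult_right_mono) auto
  also have "\<dots> \<le> ?L * norm (x - y)" using F_nonneg by (intro mult_right_mono) auto
  finally have 2: "\<bar>u ?n' x - u ?n' y\<bar> \<le> ?L * norm (x - y)" .
  have "w T (s, x) = u ?n x" "w T (t, y) = u ?n' y" using assms by (auto simp: step_interp_def)
  then have "\<bar>w T (s, x) - w T (t, y)\<bar> \<le> ?L * (\<bar>s - t\<bar> + h) + ?L * norm (x - y)"
    using 1 2 by linarith
  then show ?thesis by (simp add: algebra_simps)
qed

lemma step_interp_lipschitz:
  assumes "0 \<le> s" "s < T" "0 \<le> t" "t < T"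
  shows "\<bar>w T (s, x) - w T (t, y)\<bar> \<le> (F + 1) * exp (C * T) * (\<bar>s - t\<bar> + h + norm (x - y))"
  using step_interp_lipschitz_aux[of s t T x y] step_interp_lipschitz_aux[of t s T y x] assms
  by (cases "s \<le> t") (auto simp: abs_minus_commute norm_minus_commute)

lemma step_interp_measurable [measurable]: "w T \<in> borel_measurable borel"
proof -
  have [measurable]: "u n \<in> borel_measurable borel" for n
    using euler_seq_bounded_borel unfolding bounded_borel_def by blast
  have "(\<lambda>q::real \<times> 'a. u (nat \<lfloor>fst q / h\<rfloor>) (snd q)) \<in> borel_measurable (borel \<Otimes>\<^sub>M borel)"
    by (rule measurable_compose_countable) measurable
  then have "w T \<in> borel_measurable (borel \<Otimes>\<^sub>M borel)"
    unfolding step_interp_def by measurable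
  then show ?thesis by (simp add: borel_prod)
qed

lemma step_interp_bound:
  assumes "T \<ge> 0"
  shows "\<bar>w T q\<bar> \<le> F * T"
proof (cases "0 \<le> fst q \<and> fst q < T")
  case True
  have "\<bar>u (nat \<lfloor>fst q / h\<rfloor>) (snd q)\<bar> \<le> F * (real (nat \<lfloor>fst q / h\<rfloor>) * h)" by (rule euler_seq_bound)
  also have "\<dots> \<le> F * T"
  proof (rule mult_left_mono[OF _ F_nonneg])
    show "real (nat \<lfloor>fst q / h\<rfloor>) * h \<le> T" using nat_floor_div(1)[of "fst q"] True by linarith
  qed
  finally show ?thesis using True by (simp add: step_interp_def)
next
  case False
  then have "w T q = 0" unfolding step_interp_def by (rule if_not_P)
  then show ?thesis using assms F_nonneg by simp
qed

lemma step_interp_bounded_borel: "T \<ge> 0 \<Longrightarrow> bounded_borel (w T)"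
  unfolding bounded_borel_def using step_interp_measurable step_interp_bound by blast

lemma step_interp_scheme:
  assumes "0 \<le> s" "s + h < T"
  shows "w T (s + h, x) - w T (s, x) =
    h * ((\<integral>z. w T (s, x + z) - w T (s, x) \<partial>m) + f (real (nat \<lfloor>s / h\<rfloor>) * h) x (w T (s, x)))"
proof -
  have "\<lfloor>(s + h) / h\<rfloor> = \<lfloor>s / h\<rfloor> + 1" using h_pos by (simp add: add_divide_distrib)
  then have "nat \<lfloor>(s + h) / h\<rfloor> = Suc (nat \<lfloor>s / h\<rfloor>)"
    using assms h_pos by (simp add: nat_add_distrib)
  then show ?thesis using assms h_pos by (simp add: step_interp_def euler_step_def)
qed

text \<open>Fubini: the truncated operator is linear and translation invariant, hence commutes with
  the convolution, although jumps are in space only and the kernel acts in space-time.\<close>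

lemma convolve_truncated_op:
  fixes \<rho> :: "real \<times> 'a \<Rightarrow> real"
  assumes \<rho>: "compact_kernel \<kappa> \<rho>" and W: "bounded_borel W"
  shows "bounded_borel (\<lambda>q. \<integral>z. W (q + (0, z)) - W q \<partial>m)"
    and "integrable m (\<lambda>z. convolve \<rho> W (q + (0, z)) - convolve \<rho> W q)"
    and "convolve \<rho> (\<lambda>q. \<integral>z. W (q + (0, z)) - W q \<partial>m) q
      = (\<integral>z. convolve \<rho> W (q + (0, z)) - convolve \<rho> W q \<partial>m)"
proof -
  obtain B where [measurable]: "W \<in> borel_measurable borel" and B: "\<And>q. \<bar>W q\<bar> \<le> B"
    using W unfolding bounded_borel_def by blast
  have B0: "B \<ge> 0" using B[of 0] by linarith
  have [measurable]: "\<rho> \<in> borel_measurable borel"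
    using \<rho> unfolding compact_kernel_def by (intro borel_measurable_continuous_onI) simp
  interpret P: pair_sigma_finite "lborel :: (real \<times> 'a) measure" m
    by (intro pair_sigma_finite.intro sigma_finite_lborel sigma_finite_measure_axioms)
  have emb [measurable]: "(\<lambda>z::'a. (0::real, z)) \<in> borel_measurable borel"
    by (intro borel_measurable_continuous_onI continuous_intros)
  have [measurable]: "(\<lambda>p. W (fst p + (0, snd p))) \<in> borel_measurable (lborel \<Otimes>\<^sub>M m)"
    by measurable
  have [measurable]: "(\<lambda>(q, z). W (q + (0, z)) - W q) \<in> borel_measurable (lborel \<Otimes>\<^sub>M m)"
    unfolding split_beta' by measurable
  have d: "\<bar>W a - W b\<bar> \<le> 2 * B" for a b using B[of a] B[of b] by linarith
  show bb: "bounded_borel (\<lambda>q. \<integral>z. W (q + (0, z)) - W q \<partial>m)"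
    unfolding bounded_borel_def
  proof (intro conjI exI allI)
    have "(\<lambda>q. \<integral>z. W (q + (0, z)) - W q \<partial>m) \<in> borel_measurable lborel"
      by (rule borel_measurable_lebesgue_integral) measurable
    then show "(\<lambda>q. \<integral>z. W (q + (0, z)) - W q \<partial>m) \<in> borel_measurable borel" by simp
    show "\<bar>\<integral>z. W (q + (0, z)) - W q \<partial>m\<bar> \<le> 2 * B * measure m UNIV" for q
    proof -
      have "\<bar>\<integral>z. W (q + (0, z)) - W q \<partial>m\<bar> \<le> (\<integral>z. \<bar>W (q + (0, z)) - W q\<bar> \<partial>m)"
        by (rule integral_abs_bound)
      also have "\<dots> \<le> (\<integral>z. 2 * B \<partial>m)"
        by (rule integral_mono_AE') (use d B0 in auto)
      finally show ?thesis by (simp add: mult_ac)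
    qed
  qed
  define J where "J y z = \<rho> (y - q) * (W (y + (0, z)) - W y)" for y z
  have [measurable]: "(\<lambda>(y, z). J y z) \<in> borel_measurable (lborel \<Otimes>\<^sub>M m)"
    unfolding J_def split_beta' by measurable
  have conv0: "bounded_borel (\<lambda>_::real \<times> 'a. 1::real)" unfolding bounded_borel_def by auto
  have ir: "integrable lborel (\<lambda>y. \<rho> (y - q))" using compact_kernel_convolve(1)[OF \<rho> conv0, of q] by simp
  have iz: "integrable m (\<lambda>z. J y z)" for y
  proof (rule integrable_const_bound[where B = "\<bar>\<rho> (y - q)\<bar> * (2 * B)"])
    show "AE z in m. norm (J y z) \<le> \<bar>\<rho> (y - q)\<bar> * (2 * B)"
      by (intro AE_I2) (auto simp: J_def abs_mult intro!: mult_left_mono d)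
    show "J y \<in> borel_measurable m" unfolding J_def by measurable
  qed
  have J: "integrable (lborel \<Otimes>\<^sub>M m) (\<lambda>(y, z). J y z)"
  proof (rule P.Fubini_integrable)
    show "integrable lborel (\<lambda>y. \<integral>z. norm (case (y, z) of (y, z) \<Rightarrow> J y z) \<partial>m)"
    proof (rule Bochner_Integration.integrable_bound)
      show "integrable lborel (\<lambda>y. \<rho> (y - q) * (2 * B * measure m UNIV))" using ir by simp
      show "AE y in lborel. norm (\<integral>z. norm (case (y, z) of (y, z) \<Rightarrow> J y z) \<partial>m)
          \<le> norm (\<rho> (y - q) * (2 * B * measure m UNIV))"
      proof (rule AE_I2)
        fix y
        have "(\<integral>z. \<bar>J y z\<bar> \<partial>m) \<le> (\<integral>z. \<bar>\<rho> (y - q)\<bar> * (2 * B) \<partial>m)"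
          by (rule integral_mono_AE') (auto simp: J_def abs_mult B0 intro!: mult_left_mono d)
        also have "\<dots> = \<bar>\<rho> (y - q)\<bar> * (2 * B * measure m UNIV)" by simp
        finally show "norm (\<integral>z. norm (case (y, z) of (y, z) \<Rightarrow> J y z) \<partial>m)
          \<le> norm (\<rho> (y - q) * (2 * B * measure m UNIV))"
          using B0 by (simp add: abs_mult integral_nonneg_AE)
      qed
    qed measurable
    show "AE y in lborel. integrable m (\<lambda>z. case (y, z) of (y, z) \<Rightarrow> J y z)" using iz by simp
  qed measurable
  have inner: "(\<integral>y. J y z \<partial>lborel) = convolve \<rho> W (q + (0, z)) - convolve \<rho> W q" for z
  proof -
    have [measurable]: "(\<lambda>y. W (y + (0, z))) \<in> borel_measurable borel" by measurable
    have bz: "bounded_borel (\<lambda>y. W (y + (0, z)))" unfolding bounded_borel_def using B by auto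
    have "convolve \<rho> W (q + (0, z)) = (\<integral>y. W y * \<rho> (y - (q + (0, z))) \<partial>lborel)"
      by (simp add: convolve_def)
    also have "\<dots> = (\<integral>y. W ((0, z) + y) * \<rho> ((0, z) + y - (q + (0, z))) \<partial>lborel)"
      by (rule lborel_integral_translate[symmetric]) measurable
    also have "\<dots> = (\<integral>y. W (y + (0, z)) * \<rho> (y - q) \<partial>lborel)"
      by (simp add: add.commute)
    finally have "convolve \<rho> W (q + (0, z)) = (\<integral>y. W (y + (0, z)) * \<rho> (y - q) \<partial>lborel)" .
    then show ?thesis
      using compact_kernel_convolve(1)[OF \<rho> W, of q] compact_kernel_convolve(1)[OF \<rho> bz, of q]
      by (simp add: J_def convolve_def algebra_simps)
  qed
  show "integrable m (\<lambda>z. convolve \<rho> W (q + (0, z)) - convolve \<rho> W q)"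
    using P.integrable_snd[OF J] by (simp add: inner)
  have "convolve \<rho> (\<lambda>q. \<integral>z. W (q + (0, z)) - W q \<partial>m) q = (\<integral>y. (\<integral>z. J y z \<partial>m) \<partial>lborel)"
    by (simp add: convolve_def J_def mult.commute)
  also have "\<dots> = (\<integral>z. (\<integral>y. J y z \<partial>lborel) \<partial>m)"
    using P.Fubini_integral[OF J] by simp
  finally show "convolve \<rho> (\<lambda>q. \<integral>z. W (q + (0, z)) - W q \<partial>m) q
      = (\<integral>z. convolve \<rho> W (q + (0, z)) - convolve \<rho> W q \<partial>m)" by (simp add: inner)
qed

text \<open>The smoothed interpolant satisfies the scheme at \<open>Q\<close> with \<open>f\<close>
  frozen at \<open>(t, x, V Q)\<close>. Everything linear commutes with smoothing; only the
  variation of \<open>f\<close> over the support of the kernel remains.\<close>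

lemma convolve_step_interp_close:
  fixes \<rho> :: "real \<times> 'a \<Rightarrow> real" and \<kappa> t T :: real and x :: 'a
  assumes \<rho>: "\<And>y. \<rho> y \<ge> 0" "compact_kernel \<kappa> \<rho>" "(\<integral>y. \<rho> y \<partial>lborel) = 1"
    and \<kappa>: "0 < \<kappa>" "h \<le> \<kappa>" and t: "0 \<le> t" "t + 3 * \<kappa> < T"
  defines "V \<equiv> convolve \<rho> (w T)" and "L \<equiv> (F + 1) * exp (C * T)" and "Q \<equiv> (t + \<kappa>, x)"
  shows "\<bar>V Q - u (nat \<lfloor>t / h\<rfloor>) x\<bar> \<le> 4 * \<kappa> * L"
    and "\<bar>(V (Q + (h, 0)) - V Q) / h - (\<integral>z. V (Q + (0, z)) - V Q \<partial>m) - f t x (V Q)\<bar> \<le> 4 * \<kappa> * (C * (1 + 2 * L))"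
proof -
  have T: "T \<ge> 0" using t \<kappa> by linarith
  have L: "L \<ge> 0" using F_nonneg by (simp add: L_def)
  let ?W = "w T"
  have bw: "bounded_borel ?W" by (rule step_interp_bounded_borel[OF T])
  \<comment> \<open>The centre is delayed by \<open>\<kappa>\<close>, so the kernel sees only times
    between \<open>t\<close> and \<open>t + 2 * \<kappa>\<close>, which are nonnegative; one further
    step \<open>h \<le> \<kappa>\<close> still ends before \<open>T\<close>.\<close>
  have near: "0 \<le> s \<and> s + h < T \<and> \<bar>s - t\<bar> \<le> 2 * \<kappa> \<and> norm (\<xi> - x) \<le> \<kappa>" if "norm ((s, \<xi>) - Q) < \<kappa>" for s \<xi>
  proof -
    have "\<bar>s - (t + \<kappa>)\<bar> < \<kappa>" "norm (\<xi> - x) < \<kappa>"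
      using that norm_fst_le[of "s - (t + \<kappa>)" "\<xi> - x"] norm_snd_le[of "\<xi> - x" "s - (t + \<kappa>)"]
      by (auto simp: Q_def)
    then show ?thesis using t \<kappa> by linarith
  qed
  have tw: "?W (t, x) = u (nat \<lfloor>t / h\<rfloor>) x" using t \<kappa> by (simp add: step_interp_def)
  have close: "\<bar>?W (s, \<xi>) - ?W (t, x)\<bar> \<le> 4 * \<kappa> * L" if "norm ((s, \<xi>) - Q) < \<kappa>" for s \<xi>
  proof -
    have "\<bar>?W (s, \<xi>) - ?W (t, x)\<bar> \<le> L * (\<bar>s - t\<bar> + h + norm (\<xi> - x))"
      unfolding L_def using near[OF that] t \<kappa> h_pos by (intro step_interp_lipschitz) auto
    also have "\<dots> \<le> L * (4 * \<kappa>)" using near[OF that] \<kappa> L by (intro mult_left_mono) auto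
    finally show ?thesis by (simp add: mult_ac)
  qed
  show VW: "\<bar>V Q - u (nat \<lfloor>t / h\<rfloor>) x\<bar> \<le> 4 * \<kappa> * L"
    unfolding V_def using convolve_close[OF \<rho> bw, of Q "?W (t, x)" "4 * \<kappa> * L"] close tw by fastforce
  let ?A = "\<lambda>q. \<integral>z. ?W (q + (0, z)) - ?W q \<partial>m"
  let ?S = "\<lambda>q. ?W (q + (h, 0))"
  let ?R = "\<lambda>q. (?S q - ?W q) / h - ?A q"
  note A = convolve_truncated_op[OF \<rho>(2) bw]
  have bS: "bounded_borel ?S"
    using bw step_interp_measurable[of T] unfolding bounded_borel_def by (auto intro: measurable_compose)
  have bD: "bounded_borel ?R"
  proof -
    obtain B1 B2 B3 where B: "?S \<in> borel_measurable borel" "\<And>q. \<bar>?S q\<bar> \<le> B1"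
      "?W \<in> borel_measurable borel" "\<And>q. \<bar>?W q\<bar> \<le> B2" "?A \<in> borel_measurable borel" "\<And>q. \<bar>?A q\<bar> \<le> B3"
      using bS bw A(1) unfolding bounded_borel_def by blast
    have "\<bar>?R q\<bar> \<le> (B1 + B2) / h + B3" for q
    proof -
      have "\<bar>(?S q - ?W q) / h\<bar> \<le> (B1 + B2) / h"
        using B(2)[of q] B(4)[of q] h_pos by (simp add: divide_right_mono)
      then show ?thesis using B(6)[of q] by linarith
    qed
    moreover have "?R \<in> borel_measurable borel" using B by measurable
    ultimately show ?thesis unfolding bounded_borel_def by blast
  qed
  have "\<bar>convolve \<rho> ?R Q - f t x (V Q)\<bar> \<le> 4 * \<kappa> * (C * (1 + 2 * L))"
  proof (rule convolve_close[OF \<rho> bD])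
    fix y assume y: "norm (y - Q) < \<kappa>"
    obtain s \<xi> where y_eq: "y = (s, \<xi>)" by (cases y)
    note n = near[OF y[unfolded y_eq]]
    let ?N = "real (nat \<lfloor>s / h\<rfloor>) * h"
    have R: "?R y = f ?N \<xi> (?W y)"
    proof -
      have "?S y - ?W y = h * (?A y + f ?N \<xi> (?W y))"
        using step_interp_scheme[of s T \<xi>] n by (simp add: y_eq)
      then have "(?S y - ?W y) / h = ?A y + f ?N \<xi> (?W y)" using h_pos by simp
      then show ?thesis by simp
    qed
    have N: "?N \<ge> 0" "\<bar>?N - t\<bar> \<le> 3 * \<kappa>" using nat_floor_div[of s] n \<kappa> h_pos by (auto simp: abs_le_iff)
    have "\<bar>?W y - V Q\<bar> \<le> 8 * \<kappa> * L"
      using close[OF y[unfolded y_eq]] VW tw unfolding y_eq by linarith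
    \<comment> \<open>\<open>3 * \<kappa>\<close> for the grid time (\<open>2 * \<kappa>\<close>
      plus a step), \<open>\<kappa>\<close> for space and \<open>8 * \<kappa> * L\<close> for the
      value, which is compared through \<open>?W (t, x)\<close>.\<close>
    then have "\<bar>?N - t\<bar> + norm (\<xi> - x) + \<bar>?W y - V Q\<bar> \<le> 4 * \<kappa> * (1 + 2 * L)"
      using N n by (simp add: algebra_simps)
    then have "C * (\<bar>?N - t\<bar> + norm (\<xi> - x) + \<bar>?W y - V Q\<bar>) \<le> C * (4 * \<kappa> * (1 + 2 * L))"
      using C_nonneg by (rule mult_left_mono)
    then show "\<bar>?R y - f t x (V Q)\<bar> \<le> 4 * \<kappa> * (C * (1 + 2 * L))"
      using f_lipschitz[OF N(1) t(1), of \<xi> "?W y" x "V Q"] unfolding R by (simp add: mult_ac)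
  qed
  also have "convolve \<rho> ?R Q = (convolve \<rho> ?S Q - V Q) / h - convolve \<rho> ?A Q"
  proof -
    have "integrable lborel (\<lambda>y. ?S y * \<rho> (y - Q))" "integrable lborel (\<lambda>y. ?W y * \<rho> (y - Q))"
      "integrable lborel (\<lambda>y. ?A y * \<rho> (y - Q))"
      using compact_kernel_convolve(1)[OF \<rho>(2) bS, of Q] compact_kernel_convolve(1)[OF \<rho>(2) bw, of Q]
        compact_kernel_convolve(1)[OF \<rho>(2) A(1), of Q] by auto
    moreover have "convolve \<rho> ?R Q
      = (\<integral>y. (?S y * \<rho> (y - Q) - ?W y * \<rho> (y - Q)) / h - ?A y * \<rho> (y - Q) \<partial>lborel)"
      unfolding convolve_def by (rule Bochner_Integration.integral_cong) (auto simp: left_diff_distrib diff_divide_distrib)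
    ultimately show ?thesis by (simp add: convolve_def V_def)
  qed
  also have "convolve \<rho> ?S Q = V (Q + (h, 0))"
  proof -
    have [measurable]: "\<rho> \<in> borel_measurable borel"
      using \<rho>(2) unfolding compact_kernel_def by (intro borel_measurable_continuous_onI) simp
    have "V (Q + (h, 0)) = (\<integral>y. ?W y * \<rho> (y - (Q + (h, 0))) \<partial>lborel)"
      by (simp add: V_def convolve_def)
    also have "\<dots> = (\<integral>y. ?W ((h, 0) + y) * \<rho> ((h, 0) + y - (Q + (h, 0))) \<partial>lborel)"
      by (rule lborel_integral_translate[symmetric]) measurable
    also have "\<dots> = convolve \<rho> ?S Q" by (simp add: convolve_def add.commute)
    finally show ?thesis by simp
  qed
  also have "convolve \<rho> ?A Q = (\<integral>z. V (Q + (0, z)) - V Q \<partial>m)" unfolding V_def by (rule A(3))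
  finally show "\<bar>(V (Q + (h, 0)) - V Q) / h - (\<integral>z. V (Q + (0, z)) - V Q \<partial>m) - f t x (V Q)\<bar> \<le> 4 * \<kappa> * (C * (1 + 2 * L))" .
qed

end

section \<open>Approximate classical solutions\<close>

locale nonlocal_rhs = levy_kernel g + rhs f C F
  for g :: "real^'n \<Rightarrow> real" and f :: "real \<Rightarrow> real^'n \<Rightarrow> real \<Rightarrow> real" and C F :: real

context levy_kernel begin

lemma integrable_inner_square:
  assumes "s > 0"
  shows "integrable (levy_measure g) (\<lambda>z. indicator (cball 0 s) z * (norm z)\<^sup>2)"
proof (rule Bochner_Integration.integrable_bound[OF integrable_levy_weight[OF assms]])
  show "(\<lambda>z. indicator (cball 0 s) z * (norm (z::real^'n))\<^sup>2) \<in> borel_measurable (levy_measure g)"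
  proof -
    have "(\<lambda>z. indicator (cball 0 s) z * (norm (z::real^'n))\<^sup>2) \<in> borel_measurable borel"
      by (intro borel_measurable_times borel_measurable_indicator borel_measurable_power borel_measurable_norm) auto
    then show ?thesis by simp
  qed
qed (auto simp: levy_weight_def indicator_def)

lemma levy_inner_small_integral:
  obtains A where "A \<ge> 0"
    "\<And>s. s > 0 \<Longrightarrow> (\<integral>z. indicator (cball 0 s) z * (norm z)\<^sup>2 \<partial>levy_measure g) \<le> A * s"
proof -
  obtain A where A: "A \<ge> 0"
    "\<And>s. s > 0 \<Longrightarrow> (\<integral>\<^sup>+z. ennreal (indicator (cball 0 s) z * (norm z)\<^sup>2) \<partial>levy_measure g) \<le> ennreal (A * s)"
    using levy_inner_small by blast
  have "(\<integral>z. indicator (cball 0 s) z * (norm z)\<^sup>2 \<partial>levy_measure g) \<le> A * s" if s: "s > 0" for s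
  proof -
    have "ennreal (\<integral>z. indicator (cball 0 s) z * (norm z)\<^sup>2 \<partial>levy_measure g)
      = (\<integral>\<^sup>+z. ennreal (indicator (cball 0 s) z * (norm z)\<^sup>2) \<partial>levy_measure g)"
      by (rule nn_integral_eq_integral[symmetric]) (auto simp: integrable_inner_square[OF s])
    also have "\<dots> \<le> ennreal (A * s)" by (rule A(2)[OF s])
    finally show ?thesis using A(1) s by simp
  qed
  then show ?thesis using that A(1) by blast
qed

lemma integrable_mixed_smooth:
  assumes s: "s > 0" and m: "U \<in> borel_measurable borel" and bd: "\<And>y. \<bar>U y\<bar> \<le> B"
    and q: "\<And>z. \<bar>U (x + z) - U x - d \<bullet> z\<bar> \<le> \<Lambda> * (norm z)\<^sup>2"
  shows "integrable (levy_measure g) (mixed_increment s U U d x)"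
proof (rule integrable_mixed_increment[OF s m m q])
  fix z :: "real^'n"
  have B: "B \<ge> 0" using bd[of 0] by linarith
  have "\<bar>U (x + z) - U x\<bar> \<le> 2 * B" using bd[of "x + z"] bd[of x] by linarith
  also have "\<dots> \<le> 2 * B * (1 + sqrt (norm z))" using B by (simp add: algebra_simps)
  finally show "\<bar>U (x + z) - U x\<bar> \<le> 2 * B * (1 + sqrt (norm z))" .
qed

text \<open>Written with splitting radius \<open>\<delta>\<close>, the full operator has the same
  outer part as the truncated one, so only the compensated small jumps differ.\<close>

lemma truncated_op_close:
  assumes \<delta>: "0 < \<delta>" and m: "U \<in> borel_measurable borel" and bd: "\<And>y. \<bar>U y\<bar> \<le> B"
    and q: "\<And>z. \<bar>U (x + z) - U x - d \<bullet> z\<bar> \<le> \<Lambda> * (norm z)\<^sup>2" and \<Lambda>: "\<Lambda> \<ge> 0"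
    and A: "(\<integral>z. indicator (cball 0 \<delta>) z * (norm z)\<^sup>2 \<partial>levy_measure g) \<le> A * \<delta>"
  shows "\<bar>mixed_op g 1 U U d x - (\<integral>z. U (x + z) - U x \<partial>levy_trunc g \<delta>)\<bar> \<le> \<Lambda> * (A * \<delta>)"
proof -
  note [measurable] = m
  let ?o = "\<lambda>z. indicator {z. \<delta> < norm z} z * (U (x + z) - U x)"
  let ?i = "\<lambda>z. mixed_increment \<delta> U U d x z - ?o z"
  have int: "integrable (levy_measure g) (mixed_increment \<delta> U U d x)"
    by (rule integrable_mixed_smooth[OF \<delta> m bd q])
  have io: "integrable (levy_measure g) ?o"
    using int by (rule Bochner_Integration.integrable_bound)
      (use m in \<open>measurable, auto simp: mixed_increment_def indicator_def\<close>)
  have o: "(\<integral>z. U (x + z) - U x \<partial>levy_trunc g \<delta>) = (\<integral>z. ?o z \<partial>levy_measure g)"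
    by (rule levy_trunc_integral) measurable
  have "mixed_op g 1 U U d x = mixed_op g \<delta> U U d x"
    by (rule mixed_op_radius(2)[OF \<delta> zero_less_one int, symmetric])
  then have "mixed_op g 1 U U d x - (\<integral>z. U (x + z) - U x \<partial>levy_trunc g \<delta>) = (\<integral>z. ?i z \<partial>levy_measure g)"
    unfolding o mixed_op_def using int io by simp
  then have "\<bar>mixed_op g 1 U U d x - (\<integral>z. U (x + z) - U x \<partial>levy_trunc g \<delta>)\<bar>
      \<le> (\<integral>z. \<bar>?i z\<bar> \<partial>levy_measure g)" by (simp only: integral_abs_bound)
  also have "\<dots> \<le> (\<integral>z. \<Lambda> * (indicator (cball 0 \<delta>) z * (norm z)\<^sup>2) \<partial>levy_measure g)"
  proof (rule integral_mono)
    show "integrable (levy_measure g) (\<lambda>z. \<bar>?i z\<bar>)" using int io by simp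
    show "integrable (levy_measure g) (\<lambda>z. \<Lambda> * (indicator (cball 0 \<delta>) z * (norm z)\<^sup>2))"
      using integrable_inner_square[OF \<delta>] by simp
    show "\<bar>?i z\<bar> \<le> \<Lambda> * (indicator (cball 0 \<delta>) z * (norm z)\<^sup>2)" for z
      using q[of z] by (auto simp: mixed_increment_def indicator_def)
  qed
  also have "\<dots> \<le> \<Lambda> * (A * \<delta>)" using A \<Lambda> by (simp add: mult_left_mono)
  finally show ?thesis .
qed

end

context nonlocal_rhs begin

text \<open>The error budget is a third of \<open>\<eta>\<close> each for the variation of the
  right-hand side (width \<open>\<kappa>\<close>), the missing small jumps (radius
  \<open>\<delta>\<close>) and the time difference quotient (step \<open>h\<close>).\<close>

theorem approx_solution_exists:
  assumes T: "T \<ge> 0" and \<eta>: "\<eta> > 0"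
  obtains v \<Gamma> \<delta> H where "approx_solution g f T \<eta> v \<Gamma>" "0 < \<delta>" "\<delta> < 1" "0 < (H::nat)"
    "euler_scheme f C F (levy_trunc g \<delta>) (1 / real H)"
    "\<And>t x. 0 \<le> t \<Longrightarrow> t \<le> T \<Longrightarrow>
      \<bar>v (t, x) - euler_seq (levy_trunc g \<delta>) (1 / real H) f (nat \<lfloor>t * real H\<rfloor>) x\<bar> \<le> \<eta>"
proof -
  \<comment> \<open>\<open>\<kappa> \<le> 1\<close> and \<open>t \<le> T\<close> give
    \<open>t + 3 * \<kappa> < T'\<close>, so the cut-off of the interpolant is never felt.\<close>
  define T' where "T' = T + 4"
  define L where "L = (F + 1) * exp (C * T')"
  have L: "L > 0" using F_nonneg by (simp add: L_def add_nonneg_pos)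
  \<comment> \<open>With \<open>C + 1\<close> in place of \<open>C\<close> the same choice also
    bounds \<open>4 * \<kappa> * L\<close>, the distance to the scheme, when \<open>C\<close> is
    zero.\<close>
  define \<kappa> where "\<kappa> = min 1 (\<eta> / (12 * ((C + 1) * (1 + 2 * L))))"
  have CL: "(C + 1) * (1 + 2 * L) > 0" using C_nonneg L by (intro mult_pos_pos) auto
  have \<kappa>: "0 < \<kappa>" "\<kappa> \<le> 1" using \<eta> CL by (auto simp: \<kappa>_def)
  have \<kappa>3: "4 * \<kappa> * ((C + 1) * (1 + 2 * L)) \<le> \<eta> / 3"
  proof -
    have "\<kappa> \<le> \<eta> / (12 * ((C + 1) * (1 + 2 * L)))" by (simp add: \<kappa>_def)
    then show ?thesis using CL by (simp add: field_simps)
  qed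
  have \<kappa>f: "4 * \<kappa> * (C * (1 + 2 * L)) \<le> \<eta> / 3"
  proof -
    have "4 * \<kappa> * (C * (1 + 2 * L)) \<le> 4 * \<kappa> * ((C + 1) * (1 + 2 * L))"
      using \<kappa> L by (intro mult_left_mono mult_right_mono) auto
    with \<kappa>3 show ?thesis by linarith
  qed
  have \<kappa>L: "4 * \<kappa> * L \<le> \<eta>"
  proof -
    have "L \<le> (C + 1) * (1 + 2 * L)" using L C_nonneg by (simp add: algebra_simps)
    then have "4 * \<kappa> * L \<le> 4 * \<kappa> * ((C + 1) * (1 + 2 * L))" using \<kappa> by (intro mult_left_mono) auto
    with \<kappa>3 \<eta> show ?thesis by linarith
  qed
  obtain \<rho> :: "real \<times> (real^'n) \<Rightarrow> real" and L\<rho> where \<rho>: "\<And>y. \<rho> y \<ge> 0" "compact_kernel \<kappa> \<rho>" "(\<integral>y. \<rho> y \<partial>lborel) = 1"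
    and moll: "\<And>w B. w \<in> borel_measurable borel \<Longrightarrow> (\<And>x. \<bar>w x\<bar> \<le> B) \<Longrightarrow>
      \<exists>\<Gamma> \<Gamma>'. (\<forall>q. (convolve \<rho> w has_derivative (\<lambda>h. \<Gamma> q \<bullet> h)) (at q)) \<and>
        (\<forall>q. (\<Gamma> has_derivative \<Gamma>' q) (at q)) \<and> (\<forall>h. continuous_on UNIV (\<lambda>q. \<Gamma>' q h)) \<and>
        (\<forall>q h. norm (\<Gamma>' q h) \<le> B * L\<rho> * norm h)"
    using mollifier_exists[OF \<kappa>(1)] by metis
  define B where "B = F * T'"
  define \<Lambda> where "\<Lambda> = \<bar>B * L\<rho>\<bar>"
  have \<Lambda>: "\<Lambda> \<ge> 0" by (simp add: \<Lambda>_def)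
  obtain A where A: "A \<ge> 0"
    "\<And>s. s > 0 \<Longrightarrow> (\<integral>z. indicator (cball 0 s) z * (norm z)\<^sup>2 \<partial>levy_measure g) \<le> A * s"
    using levy_inner_small_integral by blast
  define \<delta> where "\<delta> = min (1/2) (\<eta> / (3 * (\<Lambda> * A + 1)))"
  have LA: "\<Lambda> * A + 1 > 0" using \<Lambda> A(1) by (simp add: add_nonneg_pos)
  have \<delta>: "0 < \<delta>" "\<delta> < 1" using \<eta> LA by (auto simp: \<delta>_def)
  have \<delta>3: "\<Lambda> * (A * \<delta>) \<le> \<eta> / 3"
  proof -
    have "\<delta> \<le> \<eta> / (3 * (\<Lambda> * A + 1))" by (simp add: \<delta>_def)
    then have "(\<Lambda> * A + 1) * \<delta> \<le> \<eta> / 3" using LA by (simp add: field_simps)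
    then show ?thesis using \<delta> by (simp add: algebra_simps)
  qed
  let ?m = "levy_trunc g \<delta>"
  \<comment> \<open>The summands of the lower bound secure, in turn,
    \<open>h \<le> \<kappa>\<close>, the difference quotient error and the CFL condition. The step
    is the inverse of an integer so that a unit period consists of exactly \<open>H\<close>
    steps.\<close>
  obtain H :: nat where H: "1 / \<kappa> + 3 * \<Lambda> / \<eta> + measure ?m UNIV + C + 1 < real H"
    using reals_Archimedean2 by blast
  have nn: "1 / \<kappa> \<ge> 0" "3 * \<Lambda> / \<eta> \<ge> 0" "measure ?m UNIV \<ge> 0" using \<kappa> \<Lambda> \<eta> by auto
  have Hp: "real H > 0" using H nn C_nonneg by linarith
  define h where "h = 1 / real H"
  have h: "h > 0" "h \<le> \<kappa>" "h * \<Lambda> \<le> \<eta> / 3" "h * (measure ?m UNIV + C) \<le> 1"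
  proof -
    show "h > 0" using Hp by (simp add: h_def)
    have "1 / \<kappa> \<le> real H" using H nn C_nonneg by linarith
    then show "h \<le> \<kappa>" using \<kappa> Hp by (simp add: h_def field_simps)
    have "3 * \<Lambda> / \<eta> \<le> real H" using H nn C_nonneg by linarith
    then show "h * \<Lambda> \<le> \<eta> / 3" using \<eta> Hp by (simp add: h_def field_simps)
    have "measure ?m UNIV + C \<le> real H" using H nn by linarith
    then show "h * (measure ?m UNIV + C) \<le> 1" using Hp by (simp add: h_def field_simps)
  qed
  interpret E: euler_scheme f C F ?m h
    by (intro euler_scheme.intro rhs_axioms finite_levy_trunc euler_scheme_axioms.intro sets_levy_trunc \<delta> h)
  have T': "T' \<ge> 0" using T by (simp add: T'_def)
  let ?w = "step_interp T' h (euler_seq ?m h f)"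
  define V where "V = convolve \<rho> ?w"
  have wB: "\<bar>?w q\<bar> \<le> B" for q unfolding B_def by (rule E.step_interp_bound[OF T'])
  obtain \<Gamma>0 \<Gamma>' where G: "\<And>q. (V has_derivative (\<lambda>h. \<Gamma>0 q \<bullet> h)) (at q)"
    "\<And>q. (\<Gamma>0 has_derivative \<Gamma>' q) (at q)" "\<And>h. continuous_on UNIV (\<lambda>q. \<Gamma>' q h)"
    "\<And>q h. norm (\<Gamma>' q h) \<le> B * L\<rho> * norm h"
    using moll[OF E.step_interp_measurable wB] unfolding V_def by blast
  have G4: "norm (\<Gamma>' q h) \<le> \<Lambda> * norm h" for q h
    using G(4)[of q h] by (rule order_trans) (auto simp: \<Lambda>_def intro!: mult_right_mono)
  \<comment> \<open>The time delay of \<open>convolve_step_interp_close\<close>, built into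
    \<open>v\<close>.\<close>
  define a where "a = (\<kappa>, 0 :: real^'n)"
  define v where "v q = V (q + a)" for q
  define \<Gamma> where "\<Gamma> q = \<Gamma>0 (q + a)" for q
  have sh: "((\<lambda>q. q + a) has_derivative (\<lambda>h. h)) (at q)" for q by (auto intro!: derivative_eq_intros)
  have dv: "(v has_derivative (\<lambda>h. \<Gamma> q \<bullet> h)) (at q)" for q
    using has_derivative_compose[OF sh G(1)] by (simp add: v_def[abs_def] \<Gamma>_def)
  have d\<Gamma>: "(\<Gamma> has_derivative \<Gamma>' (q + a)) (at q)" for q
    using has_derivative_compose[OF sh G(2)] by (simp add: \<Gamma>_def[abs_def])
  have c\<Gamma>: "continuous_on UNIV (\<lambda>q. \<Gamma>' (q + a) h)" for h
    by (rule continuous_on_compose2[OF G(3)]) (auto intro!: continuous_intros)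
  have quad: "\<bar>v (q + k) - v q - \<Gamma> q \<bullet> k\<bar> \<le> \<Lambda> * (norm k)\<^sup>2" for q k
    by (rule linearization_bound_UNIV[OF dv d\<Gamma> G4])
  have bd: "\<bar>v q\<bar> \<le> B" for q
    using convolve_close[OF \<rho> E.step_interp_bounded_borel[OF T'], of "q + a" 0 B] wB
    by (simp add: v_def V_def)
  have eqn: "\<bar>fst (\<Gamma> (t, x)) - mixed_op g 1 (\<lambda>y. v (t, y)) (\<lambda>y. v (t, y)) (snd (\<Gamma> (t, x))) x - f t x (v (t, x))\<bar> \<le> \<eta>"
    if t: "0 \<le> t" "t \<le> T" for t x
  proof -
    define d where "d = snd (\<Gamma> (t, x))"
    have Q: "v (t, x) = V (t + \<kappa>, x)" by (simp add: v_def a_def)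
    have qz: "\<bar>v (t, x + z) - v (t, x) - d \<bullet> z\<bar> \<le> \<Lambda> * (norm z)\<^sup>2" for z
      using quad[of "(t, x)" "(0, z)"] by (simp add: d_def inner_prod_def)
    have cv: "continuous_on UNIV v" 
      using has_derivative_continuous[OF dv] by (rule continuous_at_imp_continuous_on[OF ballI])
    have mU: "(\<lambda>y. v (t, y)) \<in> borel_measurable borel"
      by (intro borel_measurable_continuous_onI continuous_on_compose2[OF cv]) (auto intro!: continuous_intros)
    have 1: "\<bar>mixed_op g 1 (\<lambda>y. v (t, y)) (\<lambda>y. v (t, y)) d x - (\<integral>z. v (t, x + z) - v (t, x) \<partial>?m)\<bar> \<le> \<eta> / 3"
      using truncated_op_close[OF \<delta>(1) mU bd qz \<Lambda> A(2)[OF \<delta>(1)]] \<delta>3 by linarith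
    have "t + 3 * \<kappa> < T'" using t \<kappa> by (simp add: T'_def)
    from E.convolve_step_interp_close(2)[OF \<rho> \<kappa>(1) h(2) t(1) this, of x]
    have 2: "\<bar>(v (t + h, x) - v (t, x)) / h - (\<integral>z. v (t, x + z) - v (t, x) \<partial>?m) - f t x (v (t, x))\<bar> \<le> \<eta> / 3"
      using \<kappa>f unfolding L_def[symmetric] V_def[symmetric] by (simp add: v_def a_def algebra_simps)
    \<comment> \<open>The scheme controls a forward difference; the global Hessian bound replaces it
      by the time derivative at the cost \<open>h * \<Lambda>\<close>.\<close>
    have "\<bar>v (t + h, x) - v (t, x) - h * fst (\<Gamma> (t, x))\<bar> \<le> \<Lambda> * h\<^sup>2"
      using quad[of "(t, x)" "(h, 0)"] h(1) by (simp add: inner_prod_def mult.commute)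
    then have "\<bar>v (t + h, x) - v (t, x) - h * fst (\<Gamma> (t, x))\<bar> / h \<le> \<Lambda> * h\<^sup>2 / h"
      using h(1) by (intro divide_right_mono) auto
    also have "\<Lambda> * h\<^sup>2 / h = h * \<Lambda>" using h(1) by (simp add: power2_eq_square)
    also have "\<bar>v (t + h, x) - v (t, x) - h * fst (\<Gamma> (t, x))\<bar> / h = \<bar>(v (t + h, x) - v (t, x) - h * fst (\<Gamma> (t, x))) / h\<bar>"
      using h(1) by simp
    also have "(v (t + h, x) - v (t, x) - h * fst (\<Gamma> (t, x))) / h = (v (t + h, x) - v (t, x)) / h - fst (\<Gamma> (t, x))"
      using h(1) by (simp add: diff_divide_distrib)
    finally have 3: "\<bar>(v (t + h, x) - v (t, x)) / h - fst (\<Gamma> (t, x))\<bar> \<le> \<eta> / 3" using h(3) by linarith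
    show ?thesis using 1 2 3 unfolding d_def by linarith
  qed
  have near: "\<bar>v (t, x) - euler_seq ?m (1 / real H) f (nat \<lfloor>t * real H\<rfloor>) x\<bar> \<le> \<eta>" if t: "0 \<le> t" "t \<le> T" for t x
  proof -
    have "t + 3 * \<kappa> < T'" using t \<kappa> by (simp add: T'_def)
    from E.convolve_step_interp_close(1)[OF \<rho> \<kappa>(1) h(2) t(1) this, of x]
    have "\<bar>v (t, x) - euler_seq ?m h f (nat \<lfloor>t / h\<rfloor>) x\<bar> \<le> \<eta>"
      using \<kappa>L unfolding L_def[symmetric] V_def[symmetric] by (simp add: v_def a_def)
    then show ?thesis by (simp add: h_def)
  qed
  show ?thesis
  proof (rule that[of v \<Gamma> \<delta> H])
    show "approx_solution g f T \<eta> v \<Gamma>"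
      unfolding approx_solution_def
    proof (intro conjI allI ballI exI)
      show "C2_on space_time v" by (rule C2_onI[OF dv d\<Gamma> c\<Gamma>])
      show "(v has_derivative (\<lambda>h. \<Gamma> q \<bullet> h)) (at q)" for q by (rule dv)
      show "\<bar>v (q + k) - v q - \<Gamma> q \<bullet> k\<bar> \<le> \<Lambda> * (norm k)\<^sup>2" for q k by (rule quad)
      show "\<bar>v q\<bar> \<le> B" for q by (rule bd)
    qed (rule eqn; simp)
    show "euler_scheme f C F ?m (1 / real H)" using E.euler_scheme_axioms by (simp only: h_def)
    show "0 < H" using Hp by simp
    show "\<bar>v (t, x) - euler_seq ?m (1 / real H) f (nat \<lfloor>t * real H\<rfloor>) x\<bar> \<le> \<eta>" if "0 \<le> t" "t \<le> T" for t x
      by (rule near[OF that])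
  qed (rule \<delta>)+
qed

end

section \<open>Slices of test functions and maxima of semicontinuous functions\<close>

lemma slice_derivatives:
  fixes \<phi> :: "real \<times> 'a::euclidean_space \<Rightarrow> real"
  assumes "(\<phi> has_derivative (\<lambda>h. d \<bullet> h)) (at (t, x))"
  shows "deriv (\<lambda>t. \<phi> (t, x)) t = fst d"
    and "((\<lambda>y. \<phi> (t, y)) has_derivative (\<lambda>h. snd d \<bullet> h)) (at x)"
    and "gradient (\<lambda>y. \<phi> (t, y)) x = snd d"
proof -
  have "((\<lambda>s. (s, x)) has_derivative (\<lambda>h. (h, 0))) (at t)" by (auto intro!: derivative_eq_intros)
  from has_derivative_compose[OF this, of \<phi> "\<lambda>h. d \<bullet> h"] assms
  have "((\<lambda>s. \<phi> (s, x)) has_derivative (\<lambda>h. d \<bullet> (h, 0))) (at t)" by simp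
  then have "((\<lambda>s. \<phi> (s, x)) has_real_derivative fst d) (at t)"
    by (simp add: has_field_derivative_def inner_prod_def)
  then show "deriv (\<lambda>t. \<phi> (t, x)) t = fst d" by (rule DERIV_imp_deriv)
  have "((\<lambda>y. (t, y)) has_derivative (\<lambda>h. (0, h))) (at x)" by (auto intro!: derivative_eq_intros)
  from has_derivative_compose[OF this, of \<phi> "\<lambda>h. d \<bullet> h"] assms
  have "((\<lambda>y. \<phi> (t, y)) has_derivative (\<lambda>h. d \<bullet> (0, h))) (at x)" by simp
  then show s: "((\<lambda>y. \<phi> (t, y)) has_derivative (\<lambda>h. snd d \<bullet> h)) (at x)" by (simp add: inner_prod_def)
  from gradient_eq[OF s] show "gradient (\<lambda>y. \<phi> (t, y)) x = snd d" .
qed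

lemma at_within_space_time: "0 < t \<Longrightarrow> at (t, x) within space_time = at (t, x)"
  by (rule at_within_open_subset[of _ "{0<..} \<times> UNIV"]) (auto simp: space_time_def open_Times)

lemma C2_test_function:
  fixes \<phi> :: "real \<times> (real^'n) \<Rightarrow> real"
  assumes "C2_on space_time \<phi>"
  obtains G where "\<And>t x. 0 < t \<Longrightarrow> (\<phi> has_derivative (\<lambda>h. G (t, x) \<bullet> h)) (at (t, x))"
    "continuous_on space_time G"
    "\<And>K. K \<subseteq> space_time \<Longrightarrow> compact K \<Longrightarrow> convex K \<Longrightarrow>
       \<exists>\<Lambda>\<ge>0. \<forall>a\<in>K. \<forall>b\<in>K. \<bar>\<phi> b - \<phi> a - G a \<bullet> (b - a)\<bar> \<le> \<Lambda> * (norm (b - a))\<^sup>2"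
proof -
  from C2_on_gradient_field[OF assms] obtain G
    where G: "\<And>q. q \<in> space_time \<Longrightarrow> (\<phi> has_derivative (\<lambda>h. G q \<bullet> h)) (at q within space_time)"
    "continuous_on space_time G"
    "\<And>K. K \<subseteq> space_time \<Longrightarrow> compact K \<Longrightarrow> convex K \<Longrightarrow>
       \<exists>\<Lambda>\<ge>0. \<forall>a\<in>K. \<forall>b\<in>K. \<bar>\<phi> b - \<phi> a - G a \<bullet> (b - a)\<bar> \<le> \<Lambda> * (norm (b - a))\<^sup>2" by blast
  have "(\<phi> has_derivative (\<lambda>h. G (t, x) \<bullet> h)) (at (t, x))" if "0 < t" for t x
    using G(1)[of "(t, x)"] that at_within_space_time[OF that, of x] by (simp add: space_time_def)
  then show ?thesis using that G(2,3) by blast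
qed

lemma slice_measurable:
  fixes \<phi> :: "real \<times> (real^'n) \<Rightarrow> real"
  assumes "\<And>x. (\<phi> has_derivative (\<lambda>h. G x \<bullet> h)) (at (t, x))"
  shows "(\<lambda>x. \<phi> (t, x)) \<in> borel_measurable borel"
  by (intro borel_measurable_continuous_onI continuous_at_imp_continuous_on ballI
      has_derivative_continuous[OF slice_derivatives(2)[OF assms]])

lemma usc_slice_measurable:
  fixes u :: "real \<times> (real^'n) \<Rightarrow> real"
  assumes "upper_semicontinuous_on space_time u" "t \<ge> 0"
  shows "(\<lambda>x. u (t, x)) \<in> borel_measurable borel"
proof (rule borel_measurableI_less)
  fix a
  have "open {x. u (t, x) < a}"
    unfolding open_dist
  proof
    fix x assume "x \<in> {x. u (t, x) < a}"
    then have "a - u (t, x) > 0" by simp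
    then have "\<forall>\<^sub>F q in at (t, x) within space_time. u q < u (t, x) + (a - u (t, x))"
      using assms unfolding upper_semicontinuous_on_def space_time_def by blast
    then obtain d where d: "d > 0" "\<And>q. q \<in> space_time \<Longrightarrow> q \<noteq> (t, x) \<Longrightarrow> dist q (t, x) < d \<Longrightarrow> u q < a"
      unfolding eventually_at by auto
    show "\<exists>e>0. \<forall>y. dist y x < e \<longrightarrow> y \<in> {x. u (t, x) < a}"
    proof (intro exI[of _ d] conjI allI impI)
      fix y assume "dist y x < d"
      then show "y \<in> {x. u (t, x) < a}"
        using d(2)[of "(t, y)"] assms(2) \<open>x \<in> {x. u (t, x) < a}\<close>
        by (cases "y = x") (auto simp: space_time_def dist_Pair_Pair)
    qed (rule d)
  qed
  then show "{x \<in> space borel. u (t, x) < a} \<in> sets borel" by simp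
qed

text \<open>A maximizing sequence is rewritten as \<open>s * d + c \<le> u\<close> up to a vanishing
  error. Here \<open>c\<close> and \<open>d\<close> pass to the limit by continuity, and upper
  semicontinuity of \<open>u\<close> suffices on the right.\<close>

lemma usc_quotient_attains_sup:
  fixes u c d :: "'a::metric_space \<Rightarrow> real"
  assumes K: "compact K" "K \<noteq> {}" "K \<subseteq> S" and u: "upper_semicontinuous_on S u"
    and c: "continuous_on K c" and d: "continuous_on K d" "\<And>q. q \<in> K \<Longrightarrow> d q > 0"
    and M: "\<And>q. q \<in> K \<Longrightarrow> (u q - c q) / d q \<le> M"
  shows "\<exists>q\<in>K. \<forall>q'\<in>K. (u q' - c q') / d q' \<le> (u q - c q) / d q"
proof -
  let ?R = "\<lambda>q. (u q - c q) / d q"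
  define s where "s = (SUP q\<in>K. ?R q)"
  have bdd: "bdd_above (?R ` K)" using M by (auto intro!: bdd_aboveI2)
  have s: "?R q \<le> s" if "q \<in> K" for q unfolding s_def by (rule cSUP_upper[OF that bdd])
  have "\<exists>q\<in>K. s - 1 / real (Suc n) < ?R q" for n
    using less_cSUP_iff[OF K(2) bdd, of "s - 1 / real (Suc n)"] unfolding s_def by simp
  then obtain x where x: "\<And>n. x n \<in> K" "\<And>n. s - 1 / real (Suc n) < ?R (x n)" by metis
  obtain q r where q: "q \<in> K" "strict_mono (r :: nat \<Rightarrow> nat)" "(x \<circ> r) \<longlonglongrightarrow> q"
    using K(1) x(1) unfolding compact_def by blast
  let ?y = "\<lambda>n. x (r n)"
  have yq: "?y \<longlonglongrightarrow> q" using q(3) by (simp add: o_def)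
  have yK: "?y n \<in> K" for n by (rule x(1))
  have dl: "(\<lambda>n. d (?y n)) \<longlonglongrightarrow> d q" "(\<lambda>n. c (?y n)) \<longlonglongrightarrow> c q"
    using continuous_on_tendsto_compose[OF d(1) yq q(1)] continuous_on_tendsto_compose[OF c yq q(1)] yK by auto
  have "(\<lambda>n. 1 / real (Suc (r n))) \<longlonglongrightarrow> 0"
    using LIMSEQ_subseq_LIMSEQ[OF LIMSEQ_inverse_real_of_nat q(2)] by (simp add: o_def inverse_eq_divide)
  then have lim: "(\<lambda>n. (s - 1 / real (Suc (r n))) * d (?y n) + c (?y n)) \<longlonglongrightarrow> (s - 0) * d q + c q"
    by (intro tendsto_intros dl)
  have "s * d q + c q \<le> u q + e" if e: "e > 0" for e
  proof (rule tendsto_upperbound[OF lim[simplified]])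
    have "\<forall>\<^sub>F y in at q within S. u y < u q + e"
      using u e K(3) q(1) unfolding upper_semicontinuous_on_def by blast
    then obtain \<delta> where \<delta>: "\<delta> > 0" "\<And>y. y \<in> S \<Longrightarrow> y \<noteq> q \<Longrightarrow> dist y q < \<delta> \<Longrightarrow> u y < u q + e"
      unfolding eventually_at by auto
    have "\<forall>\<^sub>F n in sequentially. dist (?y n) q < \<delta>" using yq \<delta>(1) by (rule tendstoD)
    then show "\<forall>\<^sub>F n in sequentially. (s - 1 / (1 + real (r n))) * d (?y n) + c (?y n) \<le> u q + e"
    proof eventually_elim
      case (elim n)
      have "u (?y n) \<le> u q + e" using \<delta>(2)[of "?y n"] elim yK K(3) e by (cases "?y n = q") force+
      moreover have "(s - 1 / real (Suc (r n))) * d (?y n) \<le> u (?y n) - c (?y n)"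
        using x(2)[of "r n"] d(2)[OF yK[of n]] by (simp add: pos_less_divide_eq less_imp_le)
      ultimately show ?case by simp
    qed
  qed simp
  then have "s * d q + c q \<le> u q" by (rule field_le_epsilon)
  then have "s \<le> ?R q" using d(2)[OF q(1)] by (simp add: pos_le_divide_eq)
  then show ?thesis using s q(1) order_trans by blast
qed

text \<open>A weight that is unbounded at infinity and on which the operator is bounded; the growth is
  logarithmic because only moments of order less than one of the jump measure are finite.\<close>

definition log_weight :: "'a::euclidean_space \<Rightarrow> real" where
  "log_weight x = 1 + ln (1 + x \<bullet> x)"

definition log_weight_grad :: "'a::euclidean_space \<Rightarrow> 'a" where
  "log_weight_grad x = (2 / (1 + x \<bullet> x)) *\<^sub>R x"

definition log_weight_hess :: "'a::euclidean_space \<Rightarrow> 'a \<Rightarrow> 'a" where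
  "log_weight_hess x h = (2 / (1 + x \<bullet> x)) *\<^sub>R h - (4 * (x \<bullet> h) / (1 + x \<bullet> x)\<^sup>2) *\<^sub>R x"

lemma one_plus_inner_pos: "1 + x \<bullet> x > 0" for x :: "'a::euclidean_space"
  by (simp add: add_pos_nonneg)

lemma log_weight_ge_1: "log_weight x \<ge> 1"
  by (simp add: log_weight_def)

lemma log_weight_derivative: "(log_weight has_derivative (\<lambda>h. log_weight_grad x \<bullet> h)) (at x)"
  unfolding log_weight_def[abs_def] log_weight_grad_def using one_plus_inner_pos[of x]
  by (auto intro!: derivative_eq_intros simp: inner_commute field_simps)

lemma log_weight_grad_derivative: "(log_weight_grad has_derivative log_weight_hess x) (at x)"
proof -
  have i: "((\<lambda>y. 1 + y \<bullet> y) has_derivative (\<lambda>h. 2 * (x \<bullet> h))) (at x)"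
    by (auto intro!: derivative_eq_intros simp: inner_commute)
  have p: "1 + x \<bullet> x \<noteq> 0" using one_plus_inner_pos[of x] by simp
  have "((\<lambda>y. 2 / (1 + y \<bullet> y)) has_derivative (\<lambda>h. - (4 * (x \<bullet> h) / (1 + x \<bullet> x)\<^sup>2))) (at x)"
    by (rule has_derivative_eq_rhs[OF has_derivative_divide[OF has_derivative_const i p]])
       (use p in \<open>auto simp: fun_eq_iff power2_eq_square field_simps\<close>)
  from has_derivative_scaleR[OF this has_derivative_ident]
  show ?thesis unfolding log_weight_grad_def[abs_def] log_weight_hess_def[abs_def]
    by (rule has_derivative_eq_rhs) (auto simp: fun_eq_iff)
qed

lemma log_weight_hess_bound: "norm (log_weight_hess x h) \<le> 6 * norm h"
proof -
  let ?p = "1 + x \<bullet> x"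
  have p: "?p \<ge> 1" by simp
  have "norm (log_weight_hess x h) \<le> norm ((2 / ?p) *\<^sub>R h) + norm ((4 * (x \<bullet> h) / ?p\<^sup>2) *\<^sub>R x)"
    unfolding log_weight_hess_def by (rule norm_triangle_ineq4)
  also have "norm ((2 / ?p) *\<^sub>R h) \<le> 2 * norm h"
  proof -
    have "2 / ?p \<le> 2" using p by (simp add: divide_le_eq)
    then have "2 / ?p * norm h \<le> 2 * norm h" by (rule mult_right_mono) simp
    then show ?thesis using p by simp
  qed
  also have "norm ((4 * (x \<bullet> h) / ?p\<^sup>2) *\<^sub>R x) \<le> 4 * norm h"
  proof -
    have "\<bar>x \<bullet> h\<bar> * norm x \<le> norm x * norm h * norm x"
      by (intro mult_right_mono Cauchy_Schwarz_ineq2) auto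
    also have "\<dots> = (x \<bullet> x) * norm h" by (simp add: power2_norm_eq_inner[symmetric] power2_eq_square)
    also have "\<dots> \<le> ?p\<^sup>2 * norm h"
    proof (rule mult_right_mono)
      have "x \<bullet> x \<le> ?p * 1" by simp
      also have "\<dots> \<le> ?p * ?p" using p by (intro mult_left_mono) auto
      finally show "x \<bullet> x \<le> ?p\<^sup>2" by (simp add: power2_eq_square)
    qed simp
    finally have "\<bar>x \<bullet> h\<bar> * norm x \<le> ?p\<^sup>2 * norm h" .
    moreover have "?p\<^sup>2 > 0" using p by (intro zero_less_power) linarith
    ultimately have "4 * (\<bar>x \<bullet> h\<bar> * norm x) / ?p\<^sup>2 \<le> 4 * norm h"
      by (simp add: pos_divide_le_eq mult_ac)
    then show ?thesis by (simp add: abs_mult mult_ac)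
  qed
  finally show ?thesis by simp
qed

lemma log_weight_quad:
  "\<bar>log_weight (x + z) - log_weight x - log_weight_grad x \<bullet> z\<bar> \<le> 6 * (norm z)\<^sup>2"
  by (rule linearization_bound_UNIV[OF log_weight_derivative log_weight_grad_derivative log_weight_hess_bound])

text \<open>The inequality \<open>1 + |x + z|^2 \<le> 2 (1 + |x|^2) (1 + |z|^2)\<close> becomes a
  bound independent of \<open>x\<close> after taking logarithms, and \<open>ln (1 + |z|^2)\<close>
  is at most \<open>4 * ln (1 + sqrt (norm z))\<close>.\<close>

lemma log_weight_increment_aux:
  fixes x z :: "'a::euclidean_space"
  shows "log_weight (x + z) - log_weight x \<le> 4 * (1 + sqrt (norm z))"
proof -
  have "1 + (norm (x + z))\<^sup>2 \<le> 2 * (1 + (norm x)\<^sup>2) * (1 + (norm z)\<^sup>2)"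
  proof -
    have "(norm (x + z))\<^sup>2 \<le> (norm x + norm z)\<^sup>2" by (intro power_mono norm_triangle_ineq) auto
    also have "\<dots> \<le> 2 * (norm x)\<^sup>2 + 2 * (norm z)\<^sup>2"
      using sum_squares_bound[of "norm x" "norm z"] by (simp add: power2_sum)
    finally show ?thesis by (simp add: algebra_simps) (smt (verit) mult_nonneg_nonneg zero_le_power2)
  qed
  then have "ln (1 + (norm (x + z))\<^sup>2) \<le> ln (2 * (1 + (norm x)\<^sup>2) * (1 + (norm z)\<^sup>2))"
    by (intro ln_mono) (auto simp: add_pos_nonneg)
  also have "\<dots> = ln 2 + ln (1 + (norm x)\<^sup>2) + ln (1 + (norm z)\<^sup>2)"
  proof -
    have "ln (2 * a * b) = ln 2 + ln a + ln b" if "a > 0" "b > 0" for a b :: real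
      using that ln_mult[of "2 * a" b] ln_mult[of 2 a] by simp
    from this[of "1 + (norm x)\<^sup>2" "1 + (norm z)\<^sup>2"] show ?thesis by (simp only: zero_less_one add_pos_nonneg zero_le_power2)
  qed
  finally have 1: "log_weight (x + z) - log_weight x \<le> ln 2 + ln (1 + (norm z)\<^sup>2)"
    by (simp add: log_weight_def power2_norm_eq_inner)
  let ?s = "sqrt (norm z)"
  have s: "?s \<ge> 0" by simp
  have "(norm z)\<^sup>2 = ?s ^ 4" by (simp add: power4_eq_xxxx power2_eq_square)
  then have "1 + (norm z)\<^sup>2 \<le> (1 + ?s) ^ 4"
    using s by (simp add: power4_eq_xxxx algebra_simps)
  then have "ln (1 + (norm z)\<^sup>2) \<le> ln ((1 + ?s) ^ 4)"
    by (intro ln_mono) (auto simp: add_pos_nonneg)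
  also have "\<dots> = 4 * ln (1 + ?s)" using s by (simp add: ln_realpow add_pos_nonneg)
  also have "\<dots> \<le> 4 * ?s" using ln_add_one_self_le_self[OF s] by simp
  finally show ?thesis using 1 ln_le_minus_one[of "2::real"] by simp
qed

lemma log_weight_increment:
  fixes x z :: "'a::euclidean_space"
  shows "\<bar>log_weight (x + z) - log_weight x\<bar> \<le> 4 * (1 + sqrt (norm z))"
  using log_weight_increment_aux[of x z] log_weight_increment_aux[of "x + z" "- z"] by (simp add: abs_le_iff)

lemma log_weight_coercive:
  obtains R where "\<And>x::'a::euclidean_space. R < norm x \<Longrightarrow> c \<le> log_weight x"
proof -
  have "c \<le> log_weight x" if "exp c < norm x" for x :: 'a
  proof -
    have "1 \<le> norm x * norm x + 1" by simp
    have "norm x \<le> 1 + (norm x)\<^sup>2"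
      by (smt (verit) power2_eq_square mult_le_cancel_left1 norm_ge_zero zero_le_power2 mult_left_le)
    then have "exp c \<le> 1 + x \<bullet> x" using that by (simp add: power2_norm_eq_inner)
    then have "c \<le> ln (1 + x \<bullet> x)" using one_plus_inner_pos[of x] by (simp add: ln_ge_iff)
    then show ?thesis by (simp add: log_weight_def)
  qed
  then show ?thesis using that by blast
qed

lemma log_weight_continuous: "continuous_on S log_weight"
  using has_derivative_continuous[OF log_weight_derivative]
  by (intro continuous_at_imp_continuous_on) auto

lemma log_weight_grad_continuous: "continuous_on S log_weight_grad"
  using has_derivative_continuous[OF log_weight_grad_derivative]
  by (intro continuous_at_imp_continuous_on) auto

context levy_kernel begin

text \<open>The factor 10 dominates both the constant 6 of the second-order increments of
  \<open>log_weight\<close> and the constant 4 of its large increments.\<close>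

definition weight_bound :: "real \<Rightarrow> real" where
  "weight_bound s = 10 * (\<integral>z. levy_weight s z \<partial>levy_measure g)"

lemma weight_bound_nonneg: "weight_bound s \<ge> 0"
  unfolding weight_bound_def by (simp add: integral_nonneg_AE levy_weight_nonneg)

lemma log_weight_op:
  assumes s: "s > 0"
  shows "integrable (levy_measure g) (mixed_increment s log_weight log_weight (log_weight_grad x) x)"
    and "mixed_op g s log_weight log_weight (log_weight_grad x) x \<le> weight_bound s"
proof -
  have m: "(log_weight :: real^'n \<Rightarrow> real) \<in> borel_measurable borel"
    by (intro borel_measurable_continuous_onI log_weight_continuous)
  show i: "integrable (levy_measure g) (mixed_increment s log_weight log_weight (log_weight_grad x) x)"
    by (rule integrable_mixed_increment[OF s m m log_weight_quad log_weight_increment])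
  have "mixed_op g s log_weight log_weight (log_weight_grad x) x \<le> (\<integral>z. 10 * levy_weight s z \<partial>levy_measure g)"
    unfolding mixed_op_def
  proof (rule integral_mono[OF i])
    show "mixed_increment s log_weight log_weight (log_weight_grad x) x z \<le> 10 * levy_weight s z" for z
    proof (cases "norm z \<le> s")
      case True
      have "log_weight (x + z) - log_weight x - log_weight_grad x \<bullet> z \<le> 6 * (norm z)\<^sup>2"
        using log_weight_quad[of x z] by linarith
      also have "\<dots> \<le> 10 * (norm z)\<^sup>2" by simp
      finally show ?thesis using True by (simp add: mixed_increment_def levy_weight_def)
    next
      case False
      have "log_weight (x + z) - log_weight x \<le> 4 * (1 + sqrt (norm z))"
        using log_weight_increment[of x z] by linarith
      also have "\<dots> \<le> 10 * (1 + sqrt (norm z))" by simp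
      finally show ?thesis using False by (simp add: mixed_increment_def levy_weight_def)
    qed
  qed (use integrable_levy_weight[OF s] in simp)
  then show "mixed_op g s log_weight log_weight (log_weight_grad x) x \<le> weight_bound s"
    by (simp add: weight_bound_def)
qed

end

text \<open>The first term blocks contact near the final time, the second contact at infinity; their
  exponential rates are tuned independently in the comparison proof.\<close>

lemma C2_on_barrier:
  fixes A B K K' T :: real
  shows "C2_on S (\<lambda>(t, x::'a::euclidean_space). A * exp (K' * (t - T)) + B * exp (K * t) * log_weight x)"
    and "((\<lambda>(t, x). A * exp (K' * (t - T)) + B * exp (K * t) * log_weight x) has_derivative
      (\<lambda>h. (A * K' * exp (K' * (t - T)) + B * K * exp (K * t) * log_weight x,
            (B * exp (K * t)) *\<^sub>R log_weight_grad x) \<bullet> h)) (at (t, x::'a))"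
proof -
  let ?b = "\<lambda>q::real \<times> 'a. A * exp (K' * (fst q - T)) + B * exp (K * fst q) * log_weight (snd q)"
  let ?G = "\<lambda>q::real \<times> 'a. (A * K' * exp (K' * (fst q - T)) + B * K * exp (K * fst q) * log_weight (snd q),
            (B * exp (K * fst q)) *\<^sub>R log_weight_grad (snd q))"
  let ?G' = "\<lambda>q h::real \<times> 'a. (A * K'\<^sup>2 * exp (K' * (fst q - T)) * fst h
       + B * K\<^sup>2 * exp (K * fst q) * log_weight (snd q) * fst h
       + B * K * exp (K * fst q) * (log_weight_grad (snd q) \<bullet> snd h),
      (B * K * exp (K * fst q) * fst h) *\<^sub>R log_weight_grad (snd q)
       + (B * exp (K * fst q)) *\<^sub>R log_weight_hess (snd q) (snd h))"
  have L: "((\<lambda>q::real \<times> 'a. log_weight (snd q)) has_derivative (\<lambda>h. log_weight_grad (snd q) \<bullet> snd h)) (at q)" for q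
    by (rule has_derivative_compose[OF _ log_weight_derivative]) (auto intro!: derivative_eq_intros)
  have LG: "((\<lambda>q::real \<times> 'a. log_weight_grad (snd q)) has_derivative (\<lambda>h. log_weight_hess (snd q) (snd h))) (at q)" for q
    by (rule has_derivative_compose[OF _ log_weight_grad_derivative]) (auto intro!: derivative_eq_intros)
  have d: "(?b has_derivative (\<lambda>h. ?G q \<bullet> h)) (at q)" for q
    by (auto intro!: derivative_eq_intros L simp: inner_prod_def algebra_simps)
  have d2: "(?G has_derivative ?G' q) (at q)" for q
    by (auto intro!: derivative_eq_intros L LG simp: fun_eq_iff algebra_simps power2_eq_square)
  have cs: "continuous_on UNIV (\<lambda>q::real \<times> 'a. log_weight (snd q))"
    "continuous_on UNIV (\<lambda>q::real \<times> 'a. log_weight_grad (snd q))"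
    by (rule continuous_on_compose2[OF log_weight_continuous] continuous_on_compose2[OF log_weight_grad_continuous];
        auto intro: continuous_intros)+
  have hc: "continuous_on UNIV (\<lambda>q::real \<times> 'a. log_weight_hess (snd q) h)" for h
    unfolding log_weight_hess_def using one_plus_inner_pos[THEN less_imp_neq, symmetric]
    by (intro continuous_intros) auto
  have "C2_on S ?b"
    by (rule C2_onI[OF d d2]) (intro continuous_intros cs hc)
  then show "C2_on S (\<lambda>(t, x::'a). A * exp (K' * (t - T)) + B * exp (K * t) * log_weight x)"
    by (simp add: split_beta')
  show "((\<lambda>(t, x). A * exp (K' * (t - T)) + B * exp (K * t) * log_weight x) has_derivative
      (\<lambda>h. (A * K' * exp (K' * (t - T)) + B * K * exp (K * t) * log_weight x,
            (B * exp (K * t)) *\<^sub>R log_weight_grad x) \<bullet> h)) (at (t, x::'a))"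
    using d[of "(t, x)"] by (simp add: split_beta')
qed

section \<open>Comparison\<close>

text \<open>Only the interior inequality, at times before \<open>T\<close>, so that it also fits
  functions satisfying the equation on a bounded horizon. Semicontinuity, bounds and initial values
  are required separately; supersolutions enter as negatives.\<close>

definition visc_sub ::
  "(real^'n \<Rightarrow> real) \<Rightarrow> real \<Rightarrow> (real \<Rightarrow> real^'n \<Rightarrow> real \<Rightarrow> real) \<Rightarrow> real \<Rightarrow> (real \<times> (real^'n) \<Rightarrow> real) \<Rightarrow> bool" where
  "visc_sub g r f T u \<longleftrightarrow>
     (\<forall>t0 x0 \<tau> \<phi>. 0 < t0 \<longrightarrow> t0 < T \<longrightarrow> 0 < \<tau> \<longrightarrow> \<tau> < t0 \<longrightarrow> C2_on space_time \<phi> \<longrightarrow>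
        (\<forall>q \<in> {t0 - \<tau><..<t0 + \<tau>} \<times> ball x0 r. u q - \<phi> q \<le> u (t0, x0) - \<phi> (t0, x0)) \<longrightarrow>
        deriv (\<lambda>t. \<phi> (t, x0)) t0 \<le>
          I1_inner g r (\<lambda>x. \<phi> (t0, x)) x0 + I1_outer g r (\<lambda>x. u (t0, x)) x0 + f t0 x0 (u (t0, x0)))"

lemma approx_solutionD:
  assumes "approx_solution g f T \<eta> v \<Gamma>"
  obtains \<Lambda> B where "\<Lambda> \<ge> 0" "B \<ge> 0" "C2_on space_time v"
    "\<And>q. (v has_derivative (\<lambda>h. \<Gamma> q \<bullet> h)) (at q)"
    "\<And>t x z. \<bar>v (t, x + z) - v (t, x) - snd (\<Gamma> (t, x)) \<bullet> z\<bar> \<le> \<Lambda> * (norm z)\<^sup>2"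
    "\<And>q. \<bar>v q\<bar> \<le> B" "\<And>t. (\<lambda>x. v (t, x)) \<in> borel_measurable borel"
    "\<And>t x. 0 \<le> t \<Longrightarrow> t \<le> T \<Longrightarrow> \<bar>fst (\<Gamma> (t, x))
        - mixed_op g 1 (\<lambda>y. v (t, y)) (\<lambda>y. v (t, y)) (snd (\<Gamma> (t, x))) x - f t x (v (t, x))\<bar> \<le> \<eta>"
proof -
  obtain \<Lambda> B where *: "C2_on space_time v" "\<And>q. (v has_derivative (\<lambda>h. \<Gamma> q \<bullet> h)) (at q)"
    "\<And>q k. \<bar>v (q + k) - v q - \<Gamma> q \<bullet> k\<bar> \<le> \<Lambda> * (norm k)\<^sup>2" "\<And>q. \<bar>v q\<bar> \<le> B"
    and eqn: "\<forall>t\<in>{0..T}. \<forall>x. \<bar>fst (\<Gamma> (t, x))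
        - mixed_op g 1 (\<lambda>y. v (t, y)) (\<lambda>y. v (t, y)) (snd (\<Gamma> (t, x))) x - f t x (v (t, x))\<bar> \<le> \<eta>"
    using assms unfolding approx_solution_def by blast
  have q: "\<bar>v (t, x + z) - v (t, x) - snd (\<Gamma> (t, x)) \<bullet> z\<bar> \<le> \<bar>\<Lambda>\<bar> * (norm z)\<^sup>2" for t x z
  proof -
    have "\<bar>v (t, x + z) - v (t, x) - snd (\<Gamma> (t, x)) \<bullet> z\<bar> \<le> \<Lambda> * (norm z)\<^sup>2"
      using *(3)[of "(t, x)" "(0, z)"] by (simp add: inner_prod_def)
    also have "\<dots> \<le> \<bar>\<Lambda>\<bar> * (norm z)\<^sup>2" by (intro mult_right_mono) auto
    finally show ?thesis .
  qed
  have "B \<ge> 0" using *(4)[of 0] by linarith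
  then show ?thesis
    by (rule that[OF abs_ge_zero _ *(1,2) q *(4) slice_measurable[OF *(2)]]) (use eqn in auto)
qed

context levy_kernel begin

lemma approx_solution_integrable:
  assumes "approx_solution g f T \<eta> v \<Gamma>" "s > 0"
  shows "integrable (levy_measure g) (mixed_increment s (\<lambda>y. v (t, y)) (\<lambda>y. v (t, y)) (snd (\<Gamma> (t, x))) x)"
proof -
  obtain \<Lambda> B where "\<And>t x z. \<bar>v (t, x + z) - v (t, x) - snd (\<Gamma> (t, x)) \<bullet> z\<bar> \<le> \<Lambda> * (norm z)\<^sup>2"
    "\<And>q. \<bar>v q\<bar> \<le> B" "\<And>t. (\<lambda>x. v (t, x)) \<in> borel_measurable borel"
    using approx_solutionD[OF assms(1)] by metis
  then show ?thesis by (intro integrable_mixed_smooth assms(2))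
qed

lemma approx_solution_eqn:
  assumes v: "approx_solution g f T \<eta> v \<Gamma>" and s: "s > 0" and t: "0 \<le> t" "t \<le> T"
  shows "\<bar>fst (\<Gamma> (t, x)) - mixed_op g s (\<lambda>y. v (t, y)) (\<lambda>y. v (t, y)) (snd (\<Gamma> (t, x))) x - f t x (v (t, x))\<bar> \<le> \<eta>"
proof -
  have "mixed_op g 1 (\<lambda>y. v (t, y)) (\<lambda>y. v (t, y)) (snd (\<Gamma> (t, x))) x
      = mixed_op g s (\<lambda>y. v (t, y)) (\<lambda>y. v (t, y)) (snd (\<Gamma> (t, x))) x"
    by (rule mixed_op_radius(2)[OF zero_less_one s approx_solution_integrable[OF v zero_less_one]])
  moreover have "\<bar>fst (\<Gamma> (t, x))
        - mixed_op g 1 (\<lambda>y. v (t, y)) (\<lambda>y. v (t, y)) (snd (\<Gamma> (t, x))) x - f t x (v (t, x))\<bar> \<le> \<eta>"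
    using v t unfolding approx_solution_def by auto
  ultimately show ?thesis by simp
qed

text \<open>A subsolution against a smooth approximate solution. Allowing the right-hand sides to
  differ by \<open>\<epsilon> * log_weight x\<close> lets the same statement treat residuals of
  approximations, uniqueness and changes of \<open>p\<close> and \<open>L\<close>.\<close>

theorem comparison:
  assumes r: "r > 0" and sub: "visc_sub g r f1 T u" and usc: "upper_semicontinuous_on space_time u"
    and u0: "\<And>x. u (0, x) \<le> \<eta>" and uM: "\<And>t x. 0 < t \<Longrightarrow> t \<le> T \<Longrightarrow> \<bar>u (t, x)\<bar> \<le> M"
    and v: "approx_solution g f2 T \<eta> v \<Gamma>" and v0: "\<And>x. - \<eta> \<le> v (0, x)"
    and \<eta>: "\<eta> \<ge> 0" and \<epsilon>: "\<epsilon> \<ge> 0" and C: "C \<ge> 0"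
    and lip: "\<And>t x a b. 0 < t \<Longrightarrow> \<bar>f2 t x a - f2 t x b\<bar> \<le> C * \<bar>a - b\<bar>"
    and f12: "\<And>t x a. 0 < t \<Longrightarrow> t \<le> T \<Longrightarrow> f1 t x a \<le> f2 t x a + \<epsilon> * log_weight x"
    and t1: "0 \<le> t1" "t1 < T"
  shows "u (t1, x1) \<le> v (t1, x1) + (2 * \<eta> + \<epsilon>) * exp ((C + weight_bound r + 1) * t1) * log_weight x1"
proof (rule ccontr)
  define P where "P = weight_bound r"
  \<comment> \<open>\<open>C\<close> pays for the nonlinearity acting on the barrier,
    \<open>P\<close> for the operator acting on the weight; the 1 is the surplus that produces the
    contradiction.\<close>
  define K where "K = C + P + 1"
  define B0 where "B0 = 2 * \<eta> + \<epsilon>"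
  have P: "P \<ge> 0" unfolding P_def by (rule weight_bound_nonneg)
  have K: "K > 0" using C P by (simp add: K_def)
  assume "\<not> ?thesis"
  then have neg: "v (t1, x1) + B0 * exp (K * t1) * log_weight x1 < u (t1, x1)" by (simp add: B0_def K_def P_def)
  define gap where "gap = u (t1, x1) - v (t1, x1) - B0 * exp (K * t1) * log_weight x1"
  have gap: "gap > 0" using neg by (simp add: gap_def)
  obtain \<Lambda> Bv where \<Lambda>: "\<Lambda> \<ge> 0" and Bv: "Bv \<ge> 0" and v2: "C2_on space_time v"
    and dv: "\<And>q. (v has_derivative (\<lambda>h. \<Gamma> q \<bullet> h)) (at q)"
    and vq: "\<And>t x z. \<bar>v (t, x + z) - v (t, x) - snd (\<Gamma> (t, x)) \<bullet> z\<bar> \<le> \<Lambda> * (norm z)\<^sup>2"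
    and vB: "\<And>q. \<bar>v q\<bar> \<le> Bv" and vm: "\<And>t. (\<lambda>x. v (t, x)) \<in> borel_measurable borel"
    using approx_solutionD[OF v] by metis
  define A where "A = \<bar>M\<bar> + \<eta> + Bv + 1"
  have A: "A > 0" using \<eta> Bv by (simp add: A_def add_nonneg_pos)
  have uvA: "u (t, x) - v (t, x) \<le> A" if "0 \<le> t" "t \<le> T" for t x
  proof (cases "t = 0")
    case True
    then show ?thesis using u0[of x] vB[of "(t, x)"] by (simp add: A_def)
  next
    case False
    then have "\<bar>u (t, x)\<bar> \<le> M" using uM[of t x] that by simp
    then show ?thesis using vB[of "(t, x)"] \<eta> unfolding A_def by linarith
  qed
  \<comment> \<open>At least \<open>C\<close>, to absorb the nonlinearity acting on
    \<open>\<theta>\<close>; and large enough that \<open>\<theta> t1\<close> is below the gap,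
    although \<open>\<theta> T = A\<close> dominates \<open>u - v\<close>.\<close>
  define K' where "K' = max C ((A / gap) / (T - t1))"
  have K': "K' \<ge> C" by (simp add: K'_def)
  define \<theta> where "\<theta> t = A * exp (K' * (t - T))" for t
  have \<theta>pos: "\<theta> t > 0" for t using A by (simp add: \<theta>_def)
  have \<theta>gap: "\<theta> t1 < gap"
  proof -
    define y where "y = K' * (T - t1)"
    have "(A / gap) / (T - t1) * (T - t1) \<le> y"
      unfolding y_def using t1 by (intro mult_right_mono) (auto simp: K'_def)
    then have "A / gap \<le> y" using t1 by simp
    then have "A / gap < exp y" using exp_ge_add_one_self[of y] by linarith
    then have "A < gap * exp y" using gap by (simp add: field_simps)
    moreover have "\<theta> t1 = A * exp (- y)" by (simp add: \<theta>_def y_def algebra_simps)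
    ultimately have "\<theta> t1 * exp y < gap * exp y" by (simp add: exp_minus field_simps)
    then show ?thesis by simp
  qed
  (* The maximum B of the quotient R is the smallest factor for which v + \<theta> + B d stays above u,
     so this function touches u from above; \<theta> excludes contact at the final time T. *)
  define c where "c q = v q + \<theta> (fst q)" for q
  define d where "d q = exp (K * fst q) * log_weight (snd q)" for q :: "real \<times> (real^'n)"
  define R where "R q = (u q - c q) / d q" for q
  have d1: "d (t, x) \<ge> 1" if "t \<ge> 0" for t x
  proof -
    have "1 * 1 \<le> exp (K * t) * log_weight x" using that K by (intro mult_mono log_weight_ge_1) auto
    then show ?thesis by (simp add: d_def)
  qed
  define B1 where "B1 = R (t1, x1)"
  have B1: "B0 < B1"
  proof -
    have "B0 * d (t1, x1) < u (t1, x1) - c (t1, x1)"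
      using \<theta>gap by (simp add: d_def c_def gap_def mult.assoc)
    then show ?thesis using d1[OF t1(1), of x1] by (simp add: B1_def R_def pos_less_divide_eq)
  qed
  have B0: "B0 \<ge> 0" using \<eta> \<epsilon> by (simp add: B0_def)
  have RA: "R (t, x) \<le> A / log_weight x" if t: "0 \<le> t" "t \<le> T" for t x
  proof -
    have "u (t, x) - c (t, x) \<le> A" using uvA[OF t, of x] \<theta>pos[of t] by (simp add: c_def)
    then have "R (t, x) \<le> A / d (t, x)" unfolding R_def using d1[OF t(1), of x] by (intro divide_right_mono) auto
    also have "\<dots> \<le> A / log_weight x"
    proof (intro divide_left_mono mult_pos_pos)
      have "1 * log_weight x \<le> exp (K * t) * log_weight x"
        using K t log_weight_ge_1[of x] by (intro mult_right_mono) auto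
      then show "log_weight x \<le> d (t, x)" by (simp add: d_def)
    qed (use A d1[OF t(1), of x] log_weight_ge_1[of x] in auto)
    finally show ?thesis .
  qed
  \<comment> \<open>Beyond radius \<open>\<rho>\<close> the quotient is at most \<open>B1\<close>,
    its value at \<open>(t1, x1)\<close>. Hence the maximum over a compact set is the maximum over
    all of space.\<close>
  obtain \<rho> where \<rho>: "\<And>x::real^'n. \<rho> < norm x \<Longrightarrow> A / B1 \<le> log_weight x" using log_weight_coercive by blast
  define Kc where "Kc = {0..T} \<times> (cball 0 (max \<rho> (norm x1)) :: (real^'n) set)"
  have Kc: "compact Kc" "Kc \<noteq> {}" "Kc \<subseteq> space_time" "(t1, x1) \<in> Kc"
    using t1 by (auto simp: Kc_def space_time_def intro!: compact_Times)
  have vc: "continuous_on UNIV v"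
    using has_derivative_continuous[OF dv] by (rule continuous_at_imp_continuous_on[OF ballI])
  have "\<exists>q\<in>Kc. \<forall>q'\<in>Kc. (u q' - c q') / d q' \<le> (u q - c q) / d q"
  proof (rule usc_quotient_attains_sup[OF Kc(1-3) usc])
    show "continuous_on Kc c" unfolding c_def \<theta>_def
      by (intro continuous_intros continuous_on_subset[OF vc]) auto
    show "continuous_on Kc d" unfolding d_def
      by (intro continuous_intros continuous_on_compose2[OF log_weight_continuous[of UNIV]]) auto
    show "d q > 0" if "q \<in> Kc" for q
      using that d1[of "fst q" "snd q"] by (cases q) (auto simp: Kc_def)
    show "(u q - c q) / d q \<le> A" if qK: "q \<in> Kc" for q
    proof -
      obtain t x where q: "q = (t, x)" "0 \<le> t" "t \<le> T" using qK by (cases q) (auto simp: Kc_def)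
      have "R q \<le> A / log_weight x" using RA q by simp
      also have "\<dots> \<le> A / 1" using log_weight_ge_1[of x] A by (intro divide_left_mono) auto
      finally show ?thesis by (simp add: R_def)
    qed
  qed
  then obtain t0 x0 where q0: "(t0, x0) \<in> Kc" and mx: "\<And>q. q \<in> Kc \<Longrightarrow> R q \<le> R (t0, x0)"
    unfolding R_def by (metis surj_pair)
  define B where "B = R (t0, x0)"
  have BB1: "B1 \<le> B" using mx[OF Kc(4)] by (simp add: B_def B1_def)
  have Bp: "B0 < B" "B > 0" using BB1 B1 B0 by linarith+
  have RB: "R (t, x) \<le> B" if t: "0 \<le> t" "t \<le> T" for t x
  proof (cases "(t, x) \<in> Kc")
    case True then show ?thesis using mx by (simp add: B_def)
  next
    case False
    then have "\<rho> < norm x" using t by (auto simp: Kc_def)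
    from \<rho>[OF this] have "A / log_weight x \<le> B1"
      using B1 B0 A log_weight_ge_1[of x] by (simp add: field_simps)
    then show ?thesis using RA[OF t, of x] BB1 by linarith
  qed
  define \<beta> where "\<beta> = (\<lambda>(t, x::real^'n). A * exp (K' * (t - T)) + B * exp (K * t) * log_weight x)"
  define \<Phi> where "\<Phi> q = v q + \<beta> q" for q
  have \<Phi>_eq: "\<Phi> (t, x) = c (t, x) + B * d (t, x)" for t x
    by (simp add: \<Phi>_def \<beta>_def c_def d_def \<theta>_def mult.assoc)
  have le: "u (t, x) \<le> \<Phi> (t, x)" if t: "0 \<le> t" "t \<le> T" for t x
  proof -
    have "u (t, x) - c (t, x) \<le> B * d (t, x)"
      using RB[OF t, of x] d1[OF t(1), of x] by (simp add: R_def pos_divide_le_eq)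
    then show ?thesis by (simp add: \<Phi>_eq)
  qed
  have t0: "0 \<le> t0" "t0 \<le> T" using q0 by (auto simp: Kc_def)
  have eq: "u (t0, x0) = \<Phi> (t0, x0)"
    using d1[OF t0(1), of x0] by (simp add: \<Phi>_eq B_def R_def)
  have "t0 \<noteq> T"
  proof
    assume "t0 = T"
    then have "u (t0, x0) - c (t0, x0) \<le> 0" using uvA[OF t0, of x0] by (simp add: c_def \<theta>_def)
    then have "B \<le> 0" unfolding B_def R_def using d1[OF t0(1), of x0] by (simp add: divide_nonpos_pos)
    then show False using Bp by simp
  qed
  moreover have "t0 \<noteq> 0"
  proof
    assume 0: "t0 = 0"
    have "u (t0, x0) - c (t0, x0) \<le> 2 * \<eta>"
      using u0[of x0] v0[of x0] \<theta>pos[of 0] by (simp add: c_def 0)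
    then have "B \<le> 2 * \<eta> / d (t0, x0)" unfolding B_def R_def
      using d1[OF t0(1), of x0] by (intro divide_right_mono) auto
    also have "\<dots> \<le> 2 * \<eta> / 1" using d1[OF t0(1), of x0] \<eta> by (intro divide_left_mono) auto
    finally show False using Bp \<epsilon> by (simp add: B0_def)
  qed
  ultimately have t0': "0 < t0" "t0 < T" using t0 by auto
  define G where "G = \<Gamma> (t0, x0) + (A * K' * exp (K' * (t0 - T)) + B * K * exp (K * t0) * log_weight x0,
            (B * exp (K * t0)) *\<^sub>R log_weight_grad x0)"
  have \<Phi>2: "C2_on space_time \<Phi>"
    unfolding \<Phi>_def[abs_def] by (intro C2_on_add v2) (unfold \<beta>_def, rule C2_on_barrier(1))
  have d\<Phi>: "(\<Phi> has_derivative (\<lambda>h. G \<bullet> h)) (at (t0, x0))"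
    using has_derivative_add[OF dv C2_on_barrier(2)[of A K' T B K t0 x0]]
    unfolding \<Phi>_def[abs_def] \<beta>_def G_def inner_add_left .
  \<comment> \<open>Keeps the test neighbourhood inside \<open>[0, T]\<close>, where
    \<open>u \<le> \<Phi>\<close> is known.\<close>
  define \<tau> where "\<tau> = min (t0 / 2) (T - t0)"
  have \<tau>: "0 < \<tau>" "\<tau> < t0" using t0' by (auto simp: \<tau>_def)
  have visc: "deriv (\<lambda>t. \<Phi> (t, x0)) t0 \<le>
    I1_inner g r (\<lambda>x. \<Phi> (t0, x)) x0 + I1_outer g r (\<lambda>x. u (t0, x)) x0 + f1 t0 x0 (u (t0, x0))"
  proof (rule sub[unfolded visc_sub_def, rule_format, OF t0' \<tau> \<Phi>2])
    fix q assume "q \<in> {t0 - \<tau><..<t0 + \<tau>} \<times> ball x0 r"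
    then obtain t x where q: "q = (t, x)" "t0 - \<tau> < t" "t < t0 + \<tau>" by auto
    have "0 \<le> t" "t \<le> T" using q \<tau> t0' unfolding \<tau>_def by linarith+
    then show "u q - \<Phi> q \<le> u (t0, x0) - \<Phi> (t0, x0)" using le eq q by simp
  qed
  have dG: "deriv (\<lambda>t. \<Phi> (t, x0)) t0 = fst G" by (rule slice_derivatives(1)[OF d\<Phi>])
  have op: "I1_inner g r (\<lambda>x. \<Phi> (t0, x)) x0 + I1_outer g r (\<lambda>x. u (t0, x)) x0
    = mixed_op g r (\<lambda>x. \<Phi> (t0, x)) (\<lambda>x. u (t0, x)) (snd G) x0"
    and op_le: "mixed_op g r (\<lambda>x. \<Phi> (t0, x)) (\<lambda>x. u (t0, x)) (snd G) x0
      \<le> mixed_op g r (\<lambda>y. v (t0, y)) (\<lambda>y. v (t0, y)) (snd (\<Gamma> (t0, x0))) x0 + B * exp (K * t0) * P"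
  proof -
    let ?b = "B * exp (K * t0)" and ?e = "log_weight_grad x0" and ?dv = "snd (\<Gamma> (t0, x0))"
    let ?v = "\<lambda>y. v (t0, y)" and ?u = "\<lambda>y. u (t0, y)" and ?\<Phi> = "\<lambda>y. \<Phi> (t0, y)"
    have sG: "snd G = ?dv + ?b *\<^sub>R ?e" by (simp add: G_def)
    have \<Phi>x: "?\<Phi> y = ?v y + (\<theta> t0 + ?b * log_weight y)" for y by (simp add: \<Phi>_def \<beta>_def \<theta>_def)
    have lm: "(log_weight :: real^'n \<Rightarrow> real) \<in> borel_measurable borel"
      by (intro borel_measurable_continuous_onI log_weight_continuous)
    have \<Phi>m: "?\<Phi> \<in> borel_measurable borel" unfolding \<Phi>x using vm[of t0] lm by measurable
    have um: "?u \<in> borel_measurable borel" using usc_slice_measurable[OF usc] t0 by blast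
    have iv: "integrable (levy_measure g) (mixed_increment r ?v ?v ?dv x0)"
      by (rule approx_solution_integrable[OF v r])
    note il = log_weight_op[OF r, of x0]
    have inc: "mixed_increment r ?\<Phi> ?\<Phi> (snd G) x0 z
        = mixed_increment r ?v ?v ?dv x0 z + ?b * mixed_increment r log_weight log_weight ?e x0 z" for z
      by (simp add: mixed_increment_def \<Phi>x sG inner_add_left algebra_simps)
    have i\<Phi>: "integrable (levy_measure g) (mixed_increment r ?\<Phi> ?\<Phi> (snd G) x0)"
      unfolding inc using iv il(1) by simp
    have M: "M \<ge> 0" using uM[OF t0'(1) less_imp_le[OF t0'(2)], of x0] by linarith
    have iu: "integrable (levy_measure g) (mixed_increment r ?\<Phi> ?u (snd G) x0)"
    proof (rule Bochner_Integration.integrable_bound)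
      show "integrable (levy_measure g) (\<lambda>z. \<bar>mixed_increment r ?\<Phi> ?\<Phi> (snd G) x0 z\<bar> + 2 * M * levy_weight r z)"
        using i\<Phi> integrable_levy_weight[OF r] by simp
      show "mixed_increment r ?\<Phi> ?u (snd G) x0 \<in> borel_measurable (levy_measure g)"
        using mixed_increment_measurable[OF \<Phi>m um] by simp
      have "\<bar>u (t0, x0 + z) - u (t0, x0)\<bar> \<le> 2 * M * (1 + sqrt (norm z))" for z
      proof -
        have "\<bar>u (t0, x0 + z) - u (t0, x0)\<bar> \<le> 2 * M"
          using uM[OF t0'(1) less_imp_le[OF t0'(2)], of x0]
            uM[OF t0'(1) less_imp_le[OF t0'(2)], of "x0 + z"] by linarith
        also have "\<dots> \<le> 2 * M * (1 + sqrt (norm z))" using M by (simp add: algebra_simps)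
        finally show ?thesis .
      qed
      then show "AE z in levy_measure g. norm (mixed_increment r ?\<Phi> ?u (snd G) x0 z)
        \<le> norm (\<bar>mixed_increment r ?\<Phi> ?\<Phi> (snd G) x0 z\<bar> + 2 * M * levy_weight r z)"
        using M by (intro AE_I2) (auto simp: mixed_increment_def levy_weight_def intro: add_increasing)
    qed
    show "I1_inner g r ?\<Phi> x0 + I1_outer g r ?u x0 = mixed_op g r ?\<Phi> ?u (snd G) x0"
      by (rule I1_inner_plus_outer[OF r \<Phi>m um slice_derivatives(3)[OF d\<Phi>] iu])
    \<comment> \<open>Since \<open>u \<le> \<Phi>\<close> with equality at the contact point, large
      jumps of \<open>u\<close> gain at most those of \<open>\<Phi>\<close>. The resulting operator
      is linear in \<open>\<Phi>\<close>, and the spatially constant \<open>\<theta> t0\<close>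
      drops out.\<close>
    have "mixed_op g r ?\<Phi> ?u (snd G) x0 \<le> mixed_op g r ?\<Phi> ?\<Phi> (snd G) x0"
      by (rule mixed_op_mono[OF iu i\<Phi>]) (use le[OF t0] eq in auto)
    also have "\<dots> = mixed_op g r ?v ?v ?dv x0 + ?b * mixed_op g r log_weight log_weight ?e x0"
      unfolding mixed_op_def inc using iv il(1) by simp
    also have "\<dots> \<le> mixed_op g r ?v ?v ?dv x0 + ?b * P"
      using il(2) Bp by (intro add_left_mono mult_left_mono) (auto simp: P_def)
    finally show "mixed_op g r ?\<Phi> ?u (snd G) x0 \<le> mixed_op g r ?v ?v ?dv x0 + ?b * P" .
  qed
  have main: "fst G \<le> mixed_op g r (\<lambda>y. v (t0, y)) (\<lambda>y. v (t0, y)) (snd (\<Gamma> (t0, x0))) x0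
      + B * exp (K * t0) * P + f1 t0 x0 (u (t0, x0))"
    using visc op_le unfolding dG op by linarith
  define X where "X = B * exp (K * t0) * log_weight x0"
  have w1: "log_weight x0 \<ge> 1" by (rule log_weight_ge_1)
  have bX: "B * exp (K * t0) \<le> X"
    unfolding X_def using mult_left_mono[OF w1, of "B * exp (K * t0)"] Bp by simp
  have bXP: "B * exp (K * t0) * P \<le> P * X" using mult_right_mono[OF bX P] by (simp add: mult.commute)
  have "f1 t0 x0 (u (t0, x0)) \<le> f2 t0 x0 (u (t0, x0)) + \<epsilon> * log_weight x0"
    using f12 t0' by simp
  moreover have "f2 t0 x0 (u (t0, x0)) \<le> f2 t0 x0 (v (t0, x0)) + C * (\<theta> t0 + X)"
  proof -
    have "u (t0, x0) - v (t0, x0) = \<theta> t0 + X" using eq by (simp add: \<Phi>_def \<beta>_def \<theta>_def X_def)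
    moreover have "\<theta> t0 + X \<ge> 0"
    proof -
      have "0 < B * exp (K * t0)" using Bp by simp
      then show ?thesis using \<theta>pos[of t0] bX by linarith
    qed
    ultimately have "\<bar>u (t0, x0) - v (t0, x0)\<bar> = \<theta> t0 + X" by linarith
    then show ?thesis using lip[OF t0'(1), of x0 "u (t0, x0)" "v (t0, x0)"] by simp
  qed
  moreover have "mixed_op g r (\<lambda>y. v (t0, y)) (\<lambda>y. v (t0, y)) (snd (\<Gamma> (t0, x0))) x0 + f2 t0 x0 (v (t0, x0))
      \<le> fst (\<Gamma> (t0, x0)) + \<eta>"
    using approx_solution_eqn[OF v r t0, of x0] by linarith
  moreover have "fst G = fst (\<Gamma> (t0, x0)) + K' * \<theta> t0 + K * X"
    by (simp add: G_def \<theta>_def X_def mult_ac)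
  \<comment> \<open>The residual bound for \<open>v\<close> cancels the terms with
    \<open>\<Gamma>\<close>. By the choice of \<open>K\<close> and \<open>K'\<close> only
    \<open>X\<close> survives on the left, so \<open>B\<close> is at most
    \<open>\<eta> + \<epsilon>\<close>, below \<open>B0\<close>.\<close>
  ultimately have "K' * \<theta> t0 + K * X \<le> \<eta> + P * X + \<epsilon> * log_weight x0 + C * (\<theta> t0 + X)"
    using main bXP by linarith
  moreover have "C * \<theta> t0 \<le> K' * \<theta> t0" using K' \<theta>pos[of t0] by (intro mult_right_mono) auto
  ultimately have "X \<le> \<eta> + \<epsilon> * log_weight x0" by (simp add: K_def algebra_simps)
  also have "\<dots> \<le> (\<eta> + \<epsilon>) * log_weight x0"
    using mult_left_mono[OF w1 \<eta>] by (simp add: distrib_right)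
  finally have "B * exp (K * t0) \<le> \<eta> + \<epsilon>" using w1 by (simp add: X_def)
  moreover have "B * 1 \<le> B * exp (K * t0)" using Bp K t0 by (intro mult_left_mono) auto
  ultimately have "B \<le> \<eta> + \<epsilon>" by linarith
  then show False using Bp \<eta> by (simp add: B0_def)
qed

end

section \<open>Stability\<close>

text \<open>Test functions are compared on the open ball of radius \<open>r\<close>, but the
  singular integral runs over the closed one; continuity closes the gap.\<close>

lemma le_on_cball_of_ball:
  fixes a b :: "'a::euclidean_space \<Rightarrow> real"
  assumes r: "r > 0" and c: "continuous_on UNIV a" "continuous_on UNIV b"
    and le: "\<And>y. y \<in> ball x r \<Longrightarrow> a y \<le> b y" and y: "y \<in> cball x r"
  shows "a y \<le> b y"
proof -
  have "closed {y. a y \<le> b y}" by (rule closed_Collect_le[OF c])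
  moreover have "ball x r \<subseteq> {y. a y \<le> b y}" using le by blast
  ultimately have "closure (ball x r) \<subseteq> {y. a y \<le> b y}" by (rule closure_minimal[rotated])
  then show ?thesis using y r by auto
qed

lemma approx_solution_mono:
  assumes "approx_solution g f T \<eta> v \<Gamma>" "T' \<le> T" "\<eta> \<le> \<eta>'"
  shows "approx_solution g f T' \<eta>' v \<Gamma>"
proof -
  have "\<bar>fst (\<Gamma> (t, x)) - mixed_op g 1 (\<lambda>y. v (t, y)) (\<lambda>y. v (t, y)) (snd (\<Gamma> (t, x))) x - f t x (v (t, x))\<bar> \<le> \<eta>'"
    if "t \<in> {0..T'}" for t x
  proof -
    have "t \<in> {0..T}" using that assms(2) by auto
    with assms(1) have "\<bar>fst (\<Gamma> (t, x)) - mixed_op g 1 (\<lambda>y. v (t, y)) (\<lambda>y. v (t, y)) (snd (\<Gamma> (t, x))) x - f t x (v (t, x))\<bar> \<le> \<eta>"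
      unfolding approx_solution_def by blast
    then show ?thesis using assms(3) by (rule order_trans)
  qed
  then show ?thesis using assms(1) unfolding approx_solution_def by blast
qed

context levy_kernel begin

lemma test_increment_integrable:
  fixes \<phi> :: "real \<times> (real^'n) \<Rightarrow> real"
  assumes r: "r > 0" and t: "t > 0"
    and G: "\<And>t x. 0 < t \<Longrightarrow> (\<phi> has_derivative (\<lambda>h. G (t, x) \<bullet> h)) (at (t, x))"
      "\<And>K. K \<subseteq> space_time \<Longrightarrow> compact K \<Longrightarrow> convex K \<Longrightarrow>
       \<exists>\<Lambda>\<ge>0. \<forall>a\<in>K. \<forall>b\<in>K. \<bar>\<phi> b - \<phi> a - G a \<bullet> (b - a)\<bar> \<le> \<Lambda> * (norm (b - a))\<^sup>2"
    and u: "u \<in> borel_measurable borel" "\<And>y. \<bar>u y\<bar> \<le> M"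
  shows "integrable (levy_measure g) (mixed_increment r (\<lambda>y. \<phi> (t, y)) u (snd (G (t, x))) x)"
proof -
  let ?K = "{t} \<times> cball x r"
  have "?K \<subseteq> space_time" "compact ?K" "convex ?K"
    using t by (auto simp: space_time_def intro!: compact_Times convex_Times)
  from G(2)[OF this] obtain \<Lambda> where \<Lambda>:
    "\<And>a b. a \<in> ?K \<Longrightarrow> b \<in> ?K \<Longrightarrow> \<bar>\<phi> b - \<phi> a - G a \<bullet> (b - a)\<bar> \<le> \<Lambda> * (norm (b - a))\<^sup>2" by blast
  have M: "M \<ge> 0" using u(2)[of 0] by linarith
  show ?thesis
  proof (rule integrable_mixed_increment[OF r slice_measurable[OF G(1)[OF t]] u(1)])
    show "\<bar>\<phi> (t, x + z) - \<phi> (t, x) - snd (G (t, x)) \<bullet> z\<bar> \<le> \<Lambda> * (norm z)\<^sup>2" if "norm z \<le> r" for z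
      using \<Lambda>[of "(t, x)" "(t, x + z)"] that r by (simp add: inner_prod_def dist_norm)
    show "\<bar>u (x + z) - u x\<bar> \<le> (2 * M) * (1 + sqrt (norm z))" for z
    proof -
      have "\<bar>u (x + z) - u x\<bar> \<le> 2 * M" using u(2)[of "x + z"] u(2)[of x] by linarith
      also have "\<dots> \<le> (2 * M) * (1 + sqrt (norm z))" using M by (simp add: algebra_simps)
      finally show ?thesis .
    qed
  qed
qed

text \<open>At an interior maximum of \<open>v - \<phi>\<close> the gradients agree and the
  increments of \<open>\<phi>\<close> dominate those of \<open>v\<close>, so the pointwise equation
  passes to \<open>\<phi>\<close>; the residual is moved into the right-hand side.\<close>

lemma approx_solution_visc_sub:
  assumes v: "approx_solution g f T \<eta> v \<Gamma>" and r: "r > 0"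
  shows "visc_sub g r (\<lambda>t x a. f t x a + \<eta>) T v"
  unfolding visc_sub_def
proof (intro allI impI)
  fix t0 x0 \<tau> and \<phi> :: "real \<times> (real^'n) \<Rightarrow> real"
  assume t0: "0 < t0" "t0 < T" and \<tau>: "0 < \<tau>" "\<tau> < t0" and \<phi>: "C2_on space_time \<phi>"
    and mx: "\<forall>q\<in>{t0 - \<tau><..<t0 + \<tau>} \<times> ball x0 r. v q - \<phi> q \<le> v (t0, x0) - \<phi> (t0, x0)"
  obtain \<Lambda> B where dv: "\<And>q. (v has_derivative (\<lambda>h. \<Gamma> q \<bullet> h)) (at q)"
    and vB: "\<And>q. \<bar>v q\<bar> \<le> B" and vm: "\<And>t. (\<lambda>x. v (t, x)) \<in> borel_measurable borel"
    using approx_solutionD[OF v] by metis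
  obtain G where G: "\<And>t x. 0 < t \<Longrightarrow> (\<phi> has_derivative (\<lambda>h. G (t, x) \<bullet> h)) (at (t, x))"
    "\<And>K. K \<subseteq> space_time \<Longrightarrow> compact K \<Longrightarrow> convex K \<Longrightarrow>
       \<exists>\<Lambda>\<ge>0. \<forall>a\<in>K. \<forall>b\<in>K. \<bar>\<phi> b - \<phi> a - G a \<bullet> (b - a)\<bar> \<le> \<Lambda> * (norm (b - a))\<^sup>2"
    using C2_test_function[OF \<phi>] by metis
  let ?q = "(t0, x0)"
  have "((\<lambda>q. v q - \<phi> q) has_derivative (\<lambda>h. \<Gamma> ?q \<bullet> h - G ?q \<bullet> h)) (at ?q)"
    by (rule has_derivative_diff[OF dv G(1)[OF t0(1)]])
  then have "(\<lambda>h. \<Gamma> ?q \<bullet> h - G ?q \<bullet> h) = (\<lambda>h. 0)"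
    by (rule differential_zero_maxmin[of ?q "{t0 - \<tau><..<t0 + \<tau>} \<times> ball x0 r", rotated 2])
       (use \<tau> r mx in \<open>auto intro!: open_Times\<close>)
  from fun_cong[OF this, of "\<Gamma> ?q - G ?q"]
  have "(\<Gamma> ?q - G ?q) \<bullet> (\<Gamma> ?q - G ?q) = 0" by (simp only: inner_diff_left)
  then have GG: "\<Gamma> ?q = G ?q" by simp
  let ?\<phi> = "\<lambda>y. \<phi> (t0, y)" and ?v = "\<lambda>y. v (t0, y)" and ?d = "snd (G ?q)"
  have i\<phi>: "integrable (levy_measure g) (mixed_increment r ?\<phi> ?v ?d x0)"
    by (rule test_increment_integrable[OF r t0(1) G vm vB])
  have iv: "integrable (levy_measure g) (mixed_increment r ?v ?v ?d x0)"
    using approx_solution_integrable[OF v r, of t0 x0] by (simp add: GG)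
  have c: "continuous_on UNIV ?v" "continuous_on UNIV ?\<phi>"
    using has_derivative_continuous[OF slice_derivatives(2)[OF dv]]
      has_derivative_continuous[OF slice_derivatives(2)[OF G(1)[OF t0(1)]]]
    by (auto intro!: continuous_at_imp_continuous_on)
  have le: "v (t0, x0 + z) - v (t0, x0) \<le> \<phi> (t0, x0 + z) - \<phi> (t0, x0)" if z: "norm z \<le> r" for z
  proof -
    have "v (t0, x0 + z) \<le> \<phi> (t0, x0 + z) + (v (t0, x0) - \<phi> (t0, x0))"
    proof (rule le_on_cball_of_ball[OF r c(1), where b = "\<lambda>y. \<phi> (t0, y) + (v (t0, x0) - \<phi> (t0, x0))" and x = x0])
      show "continuous_on UNIV (\<lambda>y. \<phi> (t0, y) + (v (t0, x0) - \<phi> (t0, x0)))" by (intro continuous_intros c)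
      show "v (t0, y) \<le> \<phi> (t0, y) + (v (t0, x0) - \<phi> (t0, x0))" if "y \<in> ball x0 r" for y
        using bspec[OF mx, of "(t0, y)"] that \<tau> by auto
    qed (use z in \<open>simp add: dist_norm\<close>)
    then show ?thesis by linarith
  qed
  have "mixed_op g r ?v ?v ?d x0 \<le> mixed_op g r ?\<phi> ?v ?d x0"
    by (rule mixed_op_mono[OF iv i\<phi>]) (use le in auto)
  moreover have "fst (G ?q) \<le> mixed_op g r ?v ?v ?d x0 + f t0 x0 (v ?q) + \<eta>"
    using approx_solution_eqn[OF v r, of t0 x0] t0 unfolding GG by linarith
  moreover have "I1_inner g r ?\<phi> x0 + I1_outer g r ?v x0 = mixed_op g r ?\<phi> ?v ?d x0"
    by (rule I1_inner_plus_outer[OF r slice_measurable[OF G(1)[OF t0(1)]] vm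
        slice_derivatives(3)[OF G(1)[OF t0(1)]] i\<phi>])
  moreover have "deriv (\<lambda>t. \<phi> (t, x0)) t0 = fst (G ?q)" by (rule slice_derivatives(1)[OF G(1)[OF t0(1)]])
  ultimately show "deriv (\<lambda>t. \<phi> (t, x0)) t0
      \<le> I1_inner g r ?\<phi> x0 + I1_outer g r ?v x0 + (f t0 x0 (v ?q) + \<eta>)" by linarith
qed

lemma mixed_op_tendsto:
  assumes s: "s > 0"
    and m: "\<And>j. \<phi> j \<in> borel_measurable borel" "\<And>j. u j \<in> borel_measurable borel"
      "\<phi>0 \<in> borel_measurable borel" "u0 \<in> borel_measurable borel"
    and bi: "\<And>j z. norm z \<le> s \<Longrightarrow> \<bar>\<phi> j (x j + z) - \<phi> j (x j) - d j \<bullet> z\<bar> \<le> \<Lambda> * (norm z)\<^sup>2"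
    and bo: "\<And>j z. s < norm z \<Longrightarrow> \<bar>u j (x j + z) - u j (x j)\<bar> \<le> A"
    and li: "\<And>z. norm z \<le> s \<Longrightarrow>
      (\<lambda>j. \<phi> j (x j + z) - \<phi> j (x j) - d j \<bullet> z) \<longlonglongrightarrow> \<phi>0 (x0 + z) - \<phi>0 x0 - d0 \<bullet> z"
    and lo: "\<And>z. s < norm z \<Longrightarrow> (\<lambda>j. u j (x j + z) - u j (x j)) \<longlonglongrightarrow> u0 (x0 + z) - u0 x0"
  shows "(\<lambda>j. mixed_op g s (\<phi> j) (u j) (d j) (x j)) \<longlonglongrightarrow> mixed_op g s \<phi>0 u0 d0 x0"
  unfolding mixed_op_def
proof (rule integral_dominated_convergence[where w = "\<lambda>z. (\<bar>\<Lambda>\<bar> + \<bar>A\<bar>) * levy_weight s z"])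
  show "integrable (levy_measure g) (\<lambda>z. (\<bar>\<Lambda>\<bar> + \<bar>A\<bar>) * levy_weight s z)"
    using integrable_levy_weight[OF s] by simp
  show "AE z in levy_measure g. (\<lambda>j. mixed_increment s (\<phi> j) (u j) (d j) (x j) z) \<longlonglongrightarrow> mixed_increment s \<phi>0 u0 d0 x0 z"
    by (rule AE_I2) (use li lo in \<open>auto simp: mixed_increment_def\<close>)
  show "AE z in levy_measure g. norm (mixed_increment s (\<phi> j) (u j) (d j) (x j) z) \<le> (\<bar>\<Lambda>\<bar> + \<bar>A\<bar>) * levy_weight s z" for j
  proof (rule AE_I2)
    fix z :: "real^'n"
    have "\<Lambda> * (norm z)\<^sup>2 \<le> (\<bar>\<Lambda>\<bar> + \<bar>A\<bar>) * (norm z)\<^sup>2" by (intro mult_right_mono) auto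
    moreover have "A \<le> (\<bar>\<Lambda>\<bar> + \<bar>A\<bar>) * (1 + sqrt (norm z))"
    proof -
      have "A \<le> (\<bar>\<Lambda>\<bar> + \<bar>A\<bar>) * 1" by simp
      also have "\<dots> \<le> (\<bar>\<Lambda>\<bar> + \<bar>A\<bar>) * (1 + sqrt (norm z))" by (intro mult_left_mono) auto
      finally show ?thesis .
    qed
    ultimately show "norm (mixed_increment s (\<phi> j) (u j) (d j) (x j) z) \<le> (\<bar>\<Lambda>\<bar> + \<bar>A\<bar>) * levy_weight s z"
      using bi[of z j] bo[of z j] by (auto simp: mixed_increment_def levy_weight_def)
  qed
qed (use m mixed_increment_measurable in auto)

end

context nonlocal_rhs begin

lemma f_tendsto:
  assumes "(\<lambda>j. t j) \<longlonglongrightarrow> t0" "(\<lambda>j. x j) \<longlonglongrightarrow> x0" "(\<lambda>j. a j) \<longlonglongrightarrow> a0" "\<And>j. t j \<ge> 0" "t0 \<ge> 0"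
  shows "(\<lambda>j. f (t j) (x j) (a j)) \<longlonglongrightarrow> f t0 x0 a0"
proof (rule LIM_zero_cancel, rule Lim_null_comparison)
  show "\<forall>\<^sub>F j in sequentially. norm (f (t j) (x j) (a j) - f t0 x0 a0)
      \<le> C * (\<bar>t j - t0\<bar> + norm (x j - x0) + \<bar>a j - a0\<bar>)"
    using f_lipschitz assms(4,5) by simp
  have "(\<lambda>j. C * (\<bar>t j - t0\<bar> + norm (x j - x0) + \<bar>a j - a0\<bar>)) \<longlonglongrightarrow> C * (\<bar>t0 - t0\<bar> + norm (x0 - x0) + \<bar>a0 - a0\<bar>)"
    by (intro tendsto_intros assms)
  then show "(\<lambda>j. C * (\<bar>t j - t0\<bar> + norm (x j - x0) + \<bar>a j - a0\<bar>)) \<longlonglongrightarrow> 0" by simp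
qed

text \<open>A quadratic penalty \<open>\<gamma>\<close> makes the maximum strict, so maximum points
  of the approximations converge to it. There the approximate equation holds classically and passes
  to the limit by dominated convergence; \<open>\<gamma>\<close> is removed last.\<close>

lemma visc_sub_limit:
  assumes r: "r > 0"
    and v: "\<And>j. approx_solution g f (real j) (1 / real (Suc j)) (v j) (\<Gamma> j)"
    and lim: "\<And>S R. uniform_limit ({0..S} \<times> cball 0 R) v w sequentially"
    and w: "continuous_on space_time w"
    and bd: "\<And>j t x. 0 \<le> t \<Longrightarrow> t \<le> real j \<Longrightarrow> \<bar>v j (t, x)\<bar> \<le> F * t + 1"
    and wbd: "\<And>t x. 0 \<le> t \<Longrightarrow> \<bar>w (t, x)\<bar> \<le> F * t + 1"
  shows "visc_sub g r f T w"
  unfolding visc_sub_def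
proof (intro allI impI)
  fix t0 x0 \<tau> and \<phi> :: "real \<times> (real^'n) \<Rightarrow> real"
  assume t0: "0 < t0" "t0 < T" and \<tau>: "0 < \<tau>" "\<tau> < t0" and \<phi>: "C2_on space_time \<phi>"
    and mx: "\<forall>q\<in>{t0 - \<tau><..<t0 + \<tau>} \<times> ball x0 r. w q - \<phi> q \<le> w (t0, x0) - \<phi> (t0, x0)"
  obtain G where G: "\<And>t x. 0 < t \<Longrightarrow> (\<phi> has_derivative (\<lambda>h. G (t, x) \<bullet> h)) (at (t, x))"
    "\<And>K. K \<subseteq> space_time \<Longrightarrow> compact K \<Longrightarrow> convex K \<Longrightarrow>
       \<exists>\<Lambda>\<ge>0. \<forall>a\<in>K. \<forall>b\<in>K. \<bar>\<phi> b - \<phi> a - G a \<bullet> (b - a)\<bar> \<le> \<Lambda> * (norm (b - a))\<^sup>2"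
    and Gc: "continuous_on space_time G"
    using C2_test_function[OF \<phi>] by metis
  \<comment> \<open>Half the radius: around a moving maximum point the inner ball must stay inside
    the region where the test inequality is known.\<close>
  let ?q = "(t0, x0)" and ?s = "r / 2"
  let ?\<phi> = "\<lambda>y. \<phi> (t0, y)" and ?w = "\<lambda>y. w (t0, y)" and ?d = "snd (G ?q)"
  have s: "?s > 0" using r by simp
  have dv: "\<And>j q. (v j has_derivative (\<lambda>h. \<Gamma> j q \<bullet> h)) (at q)"
    and vm: "\<And>j t. (\<lambda>x. v j (t, x)) \<in> borel_measurable borel"
    using approx_solutionD[OF v] by metis+
  have vc: "continuous_on UNIV (v j)" for j
    using has_derivative_continuous[OF dv] by (rule continuous_at_imp_continuous_on[OF ballI])
  have \<phi>c: "continuous_on {q. 0 < fst q} \<phi>"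
    using has_derivative_continuous[OF G(1)] by (intro continuous_at_imp_continuous_on) auto
  have wc: "continuous_on UNIV ?w"
    by (rule continuous_on_compose2[OF w]) (use t0 in \<open>auto intro!: continuous_intros simp: space_time_def\<close>)
  have wm: "?w \<in> borel_measurable borel" using wc by (rule borel_measurable_continuous_onI)
  \<comment> \<open>Spatial radius \<open>3 * r / 4\<close>: the inner ball of radius
    \<open>r / 2\<close> plus a displacement of at most \<open>r / 4\<close>.\<close>
  define K where "K = {t0 - \<tau>/2..t0 + \<tau>/2} \<times> cball x0 (3 * r / 4)"
  have K: "compact K" "convex K" "K \<subseteq> space_time" "K \<noteq> {}" "?q \<in> K"
    using t0 \<tau> r by (auto simp: K_def space_time_def intro!: compact_Times convex_Times)
  have Kpos: "0 < fst q" if "q \<in> K" for q using that \<tau> by (auto simp: K_def)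
  have K\<phi>: "continuous_on K \<phi>" by (rule continuous_on_subset[OF \<phi>c]) (use Kpos in auto)
  have KG: "continuous_on K G" by (rule continuous_on_subset[OF Gc K(3)])
  have Kw: "continuous_on K w" by (rule continuous_on_subset[OF w K(3)])
  obtain \<Lambda> where \<Lambda>: "\<Lambda> \<ge> 0"
    "\<And>a b. a \<in> K \<Longrightarrow> b \<in> K \<Longrightarrow> \<bar>\<phi> b - \<phi> a - G a \<bullet> (b - a)\<bar> \<le> \<Lambda> * (norm (b - a))\<^sup>2"
    using G(2)[OF K(3,1,2)] by blast
  define I2 where "I2 = (\<integral>z. indicator (cball 0 ?s) z * (norm (z::real^'n))\<^sup>2 \<partial>levy_measure g)"
  have ulim: "uniform_limit K v w sequentially"
  proof (rule uniform_limit_on_subset[OF lim])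
    show "K \<subseteq> {0..t0 + \<tau>/2} \<times> cball 0 (norm x0 + 3 * r / 4)"
    proof
      fix q assume "q \<in> K"
      then obtain t x where q: "q = (t, x)" "t0 - \<tau>/2 \<le> t" "t \<le> t0 + \<tau>/2" "dist x0 x \<le> 3 * r / 4" by (auto simp: K_def)
      have "norm x \<le> norm x0 + dist x0 x" 
        using norm_triangle_sub[of x x0] by (simp add: dist_norm norm_minus_commute)
      then show "q \<in> {0..t0 + \<tau>/2} \<times> cball 0 (norm x0 + 3 * r / 4)" using q \<tau> by auto
    qed
  qed
  have i\<phi>s: "integrable (levy_measure g) (mixed_increment s' ?\<phi> ?w ?d x0)" if "s' > 0" for s'
    by (rule test_increment_integrable[OF that t0(1) G wm wbd[OF less_imp_le[OF t0(1)]]])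
  \<comment> \<open>\<open>\<gamma> * I2\<close> is the contribution of the penalty to the singular
    part of the operator; its gradient vanishes at the contact point.\<close>
  have key: "fst (G ?q) \<le> mixed_op g ?s ?\<phi> ?w ?d x0 + \<gamma> * I2 + f t0 x0 (w ?q)" if \<gamma>: "\<gamma> > 0" for \<gamma>
  proof -
    define \<phi>' where "\<phi>' q = \<phi> q + \<gamma> * ((q - ?q) \<bullet> (q - ?q))" for q
    define G' where "G' q = G q + (2 * \<gamma>) *\<^sub>R (q - ?q)" for q
    have dsq: "((\<lambda>q. \<gamma> * ((q - ?q) \<bullet> (q - ?q))) has_derivative (\<lambda>h. ((2 * \<gamma>) *\<^sub>R (q - ?q)) \<bullet> h)) (at q)" for q
    proof -
      have D: "((\<lambda>q. q - ?q) has_derivative (\<lambda>h. h)) (at q)" by (auto intro!: derivative_eq_intros)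
      show ?thesis
        by (rule has_derivative_eq_rhs[OF has_derivative_mult_right[OF has_derivative_inner[OF D D]]])
           (simp add: fun_eq_iff inner_commute)
    qed
    have d\<phi>': "(\<phi>' has_derivative (\<lambda>h. G' (t, x) \<bullet> h)) (at (t, x))" if "0 < t" for t x
      using has_derivative_add[OF G(1)[OF that] dsq] unfolding \<phi>'_def[abs_def] G'_def inner_add_left .
    have K\<phi>': "continuous_on K \<phi>'" unfolding \<phi>'_def by (intro continuous_intros K\<phi>)
    have KG': "continuous_on K G'" unfolding G'_def by (intro continuous_intros KG)
    have quad': "\<bar>\<phi>' b - \<phi>' a - G' a \<bullet> (b - a)\<bar> \<le> (\<Lambda> + \<gamma>) * (norm (b - a))\<^sup>2" if "a \<in> K" "b \<in> K" for a b
    proof -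
      define n where "n = (norm (b - a))\<^sup>2"
      have sq: "y \<bullet> y - x \<bullet> x - 2 * (x \<bullet> (y - x)) = (y - x) \<bullet> (y - x)" for x y :: "real \<times> (real^'n)"
        by (simp add: inner_diff_left inner_diff_right inner_commute)
      have "\<phi>' b - \<phi>' a - G' a \<bullet> (b - a) = (\<phi> b - \<phi> a - G a \<bullet> (b - a))
          + \<gamma> * ((b - ?q) \<bullet> (b - ?q) - (a - ?q) \<bullet> (a - ?q) - 2 * ((a - ?q) \<bullet> (b - a)))"
        by (simp only: \<phi>'_def G'_def inner_add_left inner_scaleR_left) (simp only: algebra_simps)
      also have "(b - ?q) \<bullet> (b - ?q) - (a - ?q) \<bullet> (a - ?q) - 2 * ((a - ?q) \<bullet> (b - a)) = n"
        using sq[of "b - ?q" "a - ?q"] by (simp add: n_def power2_norm_eq_inner)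
      finally have "\<phi>' b - \<phi>' a - G' a \<bullet> (b - a) = (\<phi> b - \<phi> a - G a \<bullet> (b - a)) + \<gamma> * n" .
      moreover have "\<gamma> * n \<ge> 0" using \<gamma> by (simp add: n_def)
      moreover have "\<bar>\<phi> b - \<phi> a - G a \<bullet> (b - a)\<bar> \<le> \<Lambda> * n" using \<Lambda>(2)[OF that] by (simp add: n_def)
      ultimately show ?thesis unfolding n_def[symmetric] distrib_right by linarith
    qed
    have "\<exists>q\<in>K. \<forall>q'\<in>K. v j q' - \<phi>' q' \<le> v j q - \<phi>' q" for j
      by (rule continuous_attains_sup[OF K(1,4)]) (intro continuous_intros continuous_on_subset[OF vc] K\<phi>' subset_UNIV)
    then obtain y where y: "\<And>j. y j \<in> K" "\<And>j q'. q' \<in> K \<Longrightarrow> v j q' - \<phi>' q' \<le> v j (y j) - \<phi>' (y j)" by metis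
    have mxK: "w q - \<phi> q \<le> w ?q - \<phi> ?q" if "q \<in> K" for q
      by (rule bspec[OF mx]) (use that \<tau> r in \<open>auto simp: K_def\<close>)
    \<comment> \<open>An error below \<open>\<gamma> * e\<^sup>2 / 2\<close> at both points cannot
      outweigh the penalty at distance \<open>e\<close>.\<close>
    have ylim: "y \<longlonglongrightarrow> ?q"
    proof (rule tendstoI)
      fix e :: real assume e: "e > 0"
      then have "\<gamma> * e\<^sup>2 / 2 > 0" using \<gamma> by simp
      from uniform_limitD[OF ulim this]
      show "\<forall>\<^sub>F j in sequentially. dist (y j) ?q < e"
      proof eventually_elim
        case (elim j)
        have "\<bar>v j (y j) - w (y j)\<bar> < \<gamma> * e\<^sup>2 / 2" "\<bar>v j ?q - w ?q\<bar> < \<gamma> * e\<^sup>2 / 2"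
          using elim y(1)[of j] K(5) by (auto simp: dist_real_def)
        moreover have "v j ?q - \<phi> ?q \<le> v j (y j) - \<phi> (y j) - \<gamma> * (norm (y j - ?q))\<^sup>2"
          using y(2)[OF K(5), of j] by (simp add: \<phi>'_def power2_norm_eq_inner)
        ultimately have "\<gamma> * (norm (y j - ?q))\<^sup>2 < \<gamma> * e\<^sup>2" using mxK[OF y(1)[of j]] by linarith
        then have "(norm (y j - ?q))\<^sup>2 < e\<^sup>2" using \<gamma> by simp
        then show ?case using e by (simp add: dist_norm power_less_imp_less_base)
      qed
    qed
    have "\<forall>\<^sub>F j in sequentially. dist (y j) ?q < min (\<tau>/2) (r/4) \<and> t0 + \<tau> < real j"
    proof (rule eventually_conj)
      show "\<forall>\<^sub>F j in sequentially. dist (y j) ?q < min (\<tau>/2) (r/4)"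
        by (rule tendstoD[OF ylim]) (use \<tau> r in auto)
      obtain n :: nat where "t0 + \<tau> < real n" using reals_Archimedean2 by blast
      then show "\<forall>\<^sub>F j in sequentially. t0 + \<tau> < real j"
        unfolding eventually_sequentially by (intro exI[of _ n]) auto
    qed
    \<comment> \<open>From index \<open>N\<close> on the maximum points are interior to
      \<open>K\<close> and the horizon \<open>j\<close> of the approximations exceeds all times
      involved.\<close>
    then obtain N where N: "\<And>j. j \<ge> N \<Longrightarrow> dist (y j) ?q < min (\<tau>/2) (r/4) \<and> t0 + \<tau> < real j"
      unfolding eventually_sequentially by blast
    define Y where "Y j = y (j + N)" for j
    define V where "V j = v (j + N)" for j
    define t where "t j = fst (Y j)" for j
    define x where "x j = snd (Y j)" for j
    have Yt: "Y j = (t j, x j)" for j by (simp add: t_def x_def)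
    have YK: "Y j \<in> K" for j by (simp add: Y_def y)
    have Ylim: "Y \<longlonglongrightarrow> ?q" unfolding Y_def using ylim by (rule LIMSEQ_ignore_initial_segment)
    have near: "\<bar>t j - t0\<bar> < \<tau>/2" "norm (x j - x0) < r/4" "t0 + \<tau> < real (j + N)" for j
    proof -
      have "dist (t j, x j) ?q < min (\<tau>/2) (r/4)" using N[of "j + N"] Yt[of j] by (simp add: Y_def)
      then show "\<bar>t j - t0\<bar> < \<tau>/2" "norm (x j - x0) < r/4"
        using norm_fst_le[of "t j - t0" "x j - x0"] norm_snd_le[of "x j - x0" "t j - t0"] by (auto simp: dist_norm)
      show "t0 + \<tau> < real (j + N)" using N[of "j + N"] by simp
    qed
    have tpos: "0 < t j" "t j \<le> real (j + N)" "t j \<le> t0 + \<tau>" for j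
      using near[of j] \<tau> by linarith+
    have tb: "t0 - \<tau>/2 < t j" "t j < t0 + \<tau>/2" for j
      using near(1)[of j] by linarith+
    have xz: "(t j, x j + z) \<in> K" if "norm z \<le> ?s" for j z
    proof -
      have "norm (x0 - (x j + z)) \<le> norm (x j - x0) + norm z"
        using norm_triangle_ineq[of "x j - x0" z] norm_minus_commute[of x0 "x j + z"] by (simp add: algebra_simps)
      then show ?thesis using near(2)[of j] tb[of j] that by (auto simp: K_def dist_norm)
    qed
    have Geq: "\<Gamma> (j + N) (Y j) = G' (Y j)" for j
    proof -
      have "((\<lambda>q. V j q - \<phi>' q) has_derivative (\<lambda>h. \<Gamma> (j + N) (Y j) \<bullet> h - G' (Y j) \<bullet> h)) (at (Y j))"
        unfolding V_def Yt by (rule has_derivative_diff[OF dv d\<phi>'[OF tpos(1)]])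
      then have "(\<lambda>h. \<Gamma> (j + N) (Y j) \<bullet> h - G' (Y j) \<bullet> h) = (\<lambda>h. 0)"
      proof (rule differential_zero_maxmin[of "Y j" "{t0 - \<tau>/2<..<t0 + \<tau>/2} \<times> ball x0 (3 * r / 4)", rotated 2])
        show "Y j \<in> {t0 - \<tau>/2<..<t0 + \<tau>/2} \<times> ball x0 (3 * r / 4)"
          using near(2)[of j] tb[of j] r by (auto simp: Yt dist_norm norm_minus_commute)
        show "(\<forall>q\<in>{t0 - \<tau>/2<..<t0 + \<tau>/2} \<times> ball x0 (3 * r / 4). V j q - \<phi>' q \<le> V j (Y j) - \<phi>' (Y j)) \<or>
          (\<forall>q\<in>{t0 - \<tau>/2<..<t0 + \<tau>/2} \<times> ball x0 (3 * r / 4). V j (Y j) - \<phi>' (Y j) \<le> V j q - \<phi>' q)"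
        proof (intro disjI1 ballI)
          fix q assume "q \<in> {t0 - \<tau>/2<..<t0 + \<tau>/2} \<times> ball x0 (3 * r / 4)"
          then have "q \<in> K" by (auto simp: K_def)
          then show "V j q - \<phi>' q \<le> V j (Y j) - \<phi>' (Y j)" unfolding V_def Y_def by (rule y(2))
        qed
      qed (auto intro!: open_Times)
      from fun_cong[OF this, of "\<Gamma> (j + N) (Y j) - G' (Y j)"]
      have "(\<Gamma> (j + N) (Y j) - G' (Y j)) \<bullet> (\<Gamma> (j + N) (Y j) - G' (Y j)) = 0"
        by (simp only: inner_diff_left)
      then show ?thesis by simp
    qed
    let ?d' = "\<lambda>j. snd (G' (Y j))"
    let ?\<phi>' = "\<lambda>j y. \<phi>' (t j, y)" and ?V = "\<lambda>j y. V j (t j, y)"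
    have inner_bd: "\<bar>?\<phi>' j (x j + z) - ?\<phi>' j (x j) - ?d' j \<bullet> z\<bar> \<le> (\<Lambda> + \<gamma>) * (norm z)\<^sup>2" if "norm z \<le> ?s" for j z
      using quad'[OF YK[of j] xz[OF that, of j]] unfolding Yt by (simp add: inner_prod_def)
    have outer_bd: "\<bar>?V j (x j + z) - ?V j (x j)\<bar> \<le> 2 * (F * (t0 + \<tau>) + 1)" for j z
    proof -
      have "\<bar>?V j y\<bar> \<le> F * (t0 + \<tau>) + 1" for y
      proof -
        have "\<bar>?V j y\<bar> \<le> F * t j + 1" unfolding V_def by (rule bd) (use tpos[of j] in auto)
        also have "\<dots> \<le> F * (t0 + \<tau>) + 1" using tpos[of j] F_nonneg by (simp add: mult_left_mono)
        finally show ?thesis .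
      qed
      from add_mono[OF this[of "x j + z"] this[of "x j"]] show ?thesis
        unfolding mult_2 by (rule order_trans[OF abs_triangle_ineq4])
    qed
    have m\<phi>': "?\<phi>' j \<in> borel_measurable borel" for j by (rule slice_measurable[OF d\<phi>'[OF tpos(1)]])
    have mV: "?V j \<in> borel_measurable borel" for j unfolding V_def by (rule vm)
    have i\<phi>': "integrable (levy_measure g) (mixed_increment ?s (?\<phi>' j) (?V j) (?d' j) (x j))" for j
    proof (rule integrable_mixed_increment[OF s m\<phi>' mV inner_bd])
      fix z :: "real^'n"
      have "2 * (F * (t0 + \<tau>) + 1) \<le> 2 * (F * (t0 + \<tau>) + 1) * (1 + sqrt (norm z))"
        using F_nonneg t0 \<tau> by (simp add: algebra_simps)
      then show "\<bar>?V j (x j + z) - ?V j (x j)\<bar> \<le> 2 * (F * (t0 + \<tau>) + 1) * (1 + sqrt (norm z))"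
        using outer_bd[of j z] by linarith
    qed
    have ineq: "fst (G' (Y j)) \<le> mixed_op g ?s (?\<phi>' j) (?V j) (?d' j) (x j) + f (t j) (x j) (V j (Y j)) + 1 / real (Suc (j + N))" for j
    proof -
      have iV: "integrable (levy_measure g) (mixed_increment ?s (?V j) (?V j) (?d' j) (x j))"
        using approx_solution_integrable[OF v[of "j + N"] s, of "t j" "x j"] Geq[of j]
        unfolding V_def Yt by simp
      have "mixed_op g ?s (?V j) (?V j) (?d' j) (x j) \<le> mixed_op g ?s (?\<phi>' j) (?V j) (?d' j) (x j)"
      proof (rule mixed_op_mono[OF iV i\<phi>'])
        fix z :: "real^'n" assume "norm z \<le> ?s"
        from y(2)[OF xz[OF this, of j], of "j + N"]
        show "V j (t j, x j + z) - V j (t j, x j) \<le> \<phi>' (t j, x j + z) - \<phi>' (t j, x j)"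
          unfolding V_def Yt[symmetric] Y_def by linarith
      qed simp
      moreover have "fst (\<Gamma> (j + N) (Y j)) \<le> mixed_op g ?s (?V j) (?V j) (snd (\<Gamma> (j + N) (Y j))) (x j)
          + f (t j) (x j) (V j (Y j)) + 1 / real (Suc (j + N))"
        using approx_solution_eqn[OF v[of "j + N"] s, of "t j" "x j"] tpos[of j]
        unfolding V_def Yt by linarith
      ultimately show ?thesis unfolding Geq by linarith
    qed
    have tl: "t \<longlonglongrightarrow> t0" and xl: "x \<longlonglongrightarrow> x0"
      unfolding t_def x_def using tendsto_fst[OF Ylim] tendsto_snd[OF Ylim] by simp_all
    have G'l: "(\<lambda>j. G' (Y j)) \<longlonglongrightarrow> G ?q"
    proof -
      have "(\<lambda>j. G' (Y j)) \<longlonglongrightarrow> G' ?q"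
        by (rule continuous_on_tendsto_compose[OF KG' Ylim K(5)]) (simp add: YK)
      then show ?thesis by (simp add: G'_def)
    qed
    have \<phi>'l: "(\<lambda>j. \<phi>' (t j, x j + z)) \<longlonglongrightarrow> \<phi>' (t0, x0 + z)" for z
    proof -
      have "isCont \<phi>' (t0, x0 + z)" by (rule has_derivative_continuous[OF d\<phi>'[OF t0(1)]])
      moreover have "(\<lambda>j. (t j, x j + z)) \<longlonglongrightarrow> (t0, x0 + z)" by (intro tendsto_intros tl xl)
      ultimately show ?thesis by (rule isCont_tendsto_compose)
    qed
    have Vl: "(\<lambda>j. V j (t j, x j + z)) \<longlonglongrightarrow> w (t0, x0 + z)" for z
    proof -
      let ?C = "{0..t0 + \<tau>} \<times> cball 0 (norm x0 + r + norm z)"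
      have inC: "(t j, x j + z) \<in> ?C" for j
      proof -
        have "norm (x j + z) \<le> norm (x j - x0) + norm x0 + norm z"
          using norm_triangle_ineq[of "(x j - x0) + x0" z] norm_triangle_ineq[of "x j - x0" x0] by simp
        then show ?thesis using near[of j] tpos[of j] r by auto
      qed
      have "uniform_limit ?C V w sequentially"
        unfolding V_def using lim by (rule filterlim_compose) (rule filterlim_add_const_nat_at_top)
      then have Vw: "(\<lambda>j. V j (t j, x j + z) - w (t j, x j + z)) \<longlonglongrightarrow> 0"
      proof (intro tendstoI)
        fix e :: real assume "uniform_limit ?C V w sequentially" "e > 0"
        then have "\<forall>\<^sub>F j in sequentially. \<forall>q\<in>?C. dist (V j q) (w q) < e" by (rule uniform_limitD)
        then show "\<forall>\<^sub>F j in sequentially. dist (V j (t j, x j + z) - w (t j, x j + z)) 0 < e"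
        proof eventually_elim
          case (elim j)
          from bspec[OF elim inC] show ?case by (simp add: dist_real_def)
        qed
      qed
      have "(\<lambda>j. w (t j, x j + z)) \<longlonglongrightarrow> w (t0, x0 + z)"
        by (rule continuous_on_tendsto_compose[OF w])
           (use t0 tpos in \<open>auto intro!: tendsto_intros tl xl always_eventually simp: space_time_def less_imp_le\<close>)
      from tendsto_add[OF Vw this] show ?thesis by simp
    qed
    have dl: "(\<lambda>j. ?d' j) \<longlonglongrightarrow> ?d" using tendsto_snd[OF G'l] .
    have opl: "(\<lambda>j. mixed_op g ?s (?\<phi>' j) (?V j) (?d' j) (x j)) \<longlonglongrightarrow> mixed_op g ?s (\<lambda>y. \<phi>' (t0, y)) ?w ?d x0"
    proof (rule mixed_op_tendsto[OF s m\<phi>' mV slice_measurable[OF d\<phi>'[OF t0(1)]] wm inner_bd outer_bd])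
      show "(\<lambda>j. \<phi>' (t j, x j + z) - \<phi>' (t j, x j) - ?d' j \<bullet> z) \<longlonglongrightarrow> \<phi>' (t0, x0 + z) - \<phi>' (t0, x0) - ?d \<bullet> z" for z
        using \<phi>'l[of z] \<phi>'l[of 0] by (intro tendsto_intros dl) simp_all
      show "(\<lambda>j. V j (t j, x j + z) - V j (t j, x j)) \<longlonglongrightarrow> w (t0, x0 + z) - w (t0, x0)" for z
        using Vl[of z] Vl[of 0] by (intro tendsto_intros) simp_all
    qed
    have fl: "(\<lambda>j. f (t j) (x j) (V j (Y j))) \<longlonglongrightarrow> f t0 x0 (w ?q)"
      using Vl[of 0] tpos t0 by (intro f_tendsto tl xl) (auto simp: Yt less_imp_le)
    have el: "(\<lambda>j. 1 / real (Suc (j + N))) \<longlonglongrightarrow> 0"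
      using LIMSEQ_ignore_initial_segment[OF LIMSEQ_inverse_real_of_nat, of N] by (simp add: inverse_eq_divide)
    have "fst (G ?q) \<le> mixed_op g ?s (\<lambda>y. \<phi>' (t0, y)) ?w ?d x0 + f t0 x0 (w ?q) + 0"
      by (rule LIMSEQ_le[OF tendsto_fst[OF G'l] tendsto_add[OF tendsto_add[OF opl fl] el]]) (use ineq in blast)
    also have "mixed_op g ?s (\<lambda>y. \<phi>' (t0, y)) ?w ?d x0 = mixed_op g ?s ?\<phi> ?w ?d x0 + \<gamma> * I2"
    proof -
      have eq: "mixed_increment ?s (\<lambda>y. \<phi>' (t0, y)) ?w ?d x0 z
          = mixed_increment ?s ?\<phi> ?w ?d x0 z + \<gamma> * (indicator (cball 0 ?s) z * (norm z)\<^sup>2)" for z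
        by (simp add: mixed_increment_def \<phi>'_def inner_prod_def power2_norm_eq_inner indicator_def)
      show ?thesis unfolding mixed_op_def eq I2_def
        using i\<phi>s[OF s] integrable_inner_square[OF s] by simp
    qed
    finally show ?thesis by simp
  qed
  \<comment> \<open>Lets \<open>\<gamma>\<close> tend to zero; \<open>I2 + 1\<close> avoids a
    division by zero.\<close>
  have main: "fst (G ?q) \<le> mixed_op g ?s ?\<phi> ?w ?d x0 + f t0 x0 (w ?q)"
  proof (rule field_le_epsilon)
    fix e :: real assume e: "e > 0"
    have I2: "I2 \<ge> 0" unfolding I2_def by (intro integral_nonneg_AE) auto
    have "fst (G ?q) \<le> mixed_op g ?s ?\<phi> ?w ?d x0 + e / (I2 + 1) * I2 + f t0 x0 (w ?q)"
      by (rule key) (use e I2 in auto)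
    moreover have "e / (I2 + 1) * I2 \<le> e" using e I2 by (simp add: field_simps)
    ultimately show "fst (G ?q) \<le> mixed_op g ?s ?\<phi> ?w ?d x0 + f t0 x0 (w ?q) + e" by linarith
  qed
  have \<phi>c0: "continuous_on UNIV ?\<phi>"
    using has_derivative_continuous[OF slice_derivatives(2)[OF G(1)[OF t0(1)]]]
    by (auto intro!: continuous_at_imp_continuous_on)
  have le: "w (t0, x0 + z) - w (t0, x0) \<le> \<phi> (t0, x0 + z) - \<phi> (t0, x0)" if z: "norm z \<le> r" for z
  proof -
    have "w (t0, x0 + z) \<le> \<phi> (t0, x0 + z) + (w (t0, x0) - \<phi> (t0, x0))"
    proof (rule le_on_cball_of_ball[OF r wc, where b = "\<lambda>y. \<phi> (t0, y) + (w (t0, x0) - \<phi> (t0, x0))" and x = x0])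
      show "continuous_on UNIV (\<lambda>y. \<phi> (t0, y) + (w (t0, x0) - \<phi> (t0, x0)))" by (intro continuous_intros \<phi>c0)
      show "w (t0, y) \<le> \<phi> (t0, y) + (w (t0, x0) - \<phi> (t0, x0))" if "y \<in> ball x0 r" for y
        using bspec[OF mx, of "(t0, y)"] that \<tau> by auto
    qed (use z in \<open>simp add: dist_norm\<close>)
    then show ?thesis by linarith
  qed
  have "mixed_op g ?s ?\<phi> ?w ?d x0 \<le> mixed_op g r ?\<phi> ?w ?d x0"
    by (rule mixed_op_radius_mono[OF s _ i\<phi>s[OF s] i\<phi>s[OF r]]) (use r le in auto)
  moreover have "I1_inner g r ?\<phi> x0 + I1_outer g r ?w x0 = mixed_op g r ?\<phi> ?w ?d x0"
    by (rule I1_inner_plus_outer[OF r slice_measurable[OF G(1)[OF t0(1)]] wm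
        slice_derivatives(3)[OF G(1)[OF t0(1)]] i\<phi>s[OF r]])
  moreover have "deriv (\<lambda>t. \<phi> (t, x0)) t0 = fst (G ?q)" by (rule slice_derivatives(1)[OF G(1)[OF t0(1)]])
  ultimately show "deriv (\<lambda>t. \<phi> (t, x0)) t0
      \<le> I1_inner g r ?\<phi> x0 + I1_outer g r ?w x0 + f t0 x0 (w ?q)" using main by linarith
qed

end

section \<open>Construction of the solution\<close>

lemma continuous_imp_usc:
  assumes "continuous_on S u"
  shows "upper_semicontinuous_on S u" "lower_semicontinuous_on S u"
proof -
  have t: "(u \<longlongrightarrow> u x) (at x within S)" if "x \<in> S" for x
    using assms that by (simp add: continuous_on)
  show "upper_semicontinuous_on S u" unfolding upper_semicontinuous_on_def
    using order_tendstoD(2)[OF t] by simp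
  show "lower_semicontinuous_on S u" unfolding lower_semicontinuous_on_def
    using order_tendstoD(1)[OF t] by simp
qed

lemma usc_uminus: "lower_semicontinuous_on S u \<Longrightarrow> upper_semicontinuous_on S (\<lambda>q. - u q)"
  unfolding lower_semicontinuous_on_def upper_semicontinuous_on_def
  by (simp add: less_diff_eq diff_less_eq algebra_simps)

text \<open>Replacing \<open>u\<close> by \<open>- u\<close> turns supersolutions for \<open>f\<close> into subsolutions for the dual of \<open>f\<close>.\<close>

definition dual_rhs :: "(real \<Rightarrow> 'a \<Rightarrow> real \<Rightarrow> real) \<Rightarrow> real \<Rightarrow> 'a \<Rightarrow> real \<Rightarrow> real" where
  "dual_rhs f t x a = - f t x (- a)"

lemma rhs_dual: "rhs f C F \<Longrightarrow> rhs (dual_rhs f) C F"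
proof -
  assume "rhs f C F"
  then interpret rhs f C F .
  show ?thesis
  proof
    show "\<bar>dual_rhs f t x a - dual_rhs f t' x' a'\<bar> \<le> C * (\<bar>t - t'\<bar> + norm (x - x') + \<bar>a - a'\<bar>)"
      if "t \<ge> 0" "t' \<ge> 0" for t t' x x' a a'
      using f_lipschitz[OF that(2,1), of x' "- a'" x "- a"]
      by (simp add: dual_rhs_def norm_minus_commute abs_minus_commute)
  qed (use f_bound in \<open>simp add: dual_rhs_def\<close>)
qed

lemma mixed_op_minus:
  "mixed_op g s (\<lambda>y. - \<phi> y) (\<lambda>y. - u y) (- d) x = - mixed_op g s \<phi> u d x"
proof -
  have "mixed_increment s (\<lambda>y. - \<phi> y) (\<lambda>y. - u y) (- d) x z = - mixed_increment s \<phi> u d x z" for z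
    by (simp add: mixed_increment_def)
  then show ?thesis by (simp add: mixed_op_def)
qed

lemma approx_solution_dual:
  assumes "approx_solution g f T \<eta> v \<Gamma>"
  shows "approx_solution g (dual_rhs f) T \<eta> (\<lambda>q. - v q) (\<lambda>q. - \<Gamma> q)"
proof -
  have "C2_on space_time (\<lambda>q. - v q)" using assms C2_on_minus unfolding approx_solution_def by blast
  moreover have "((\<lambda>q. - v q) has_derivative (\<lambda>h. - \<Gamma> q \<bullet> h)) (at q)" for q
  proof -
    have "(v has_derivative (\<lambda>h. \<Gamma> q \<bullet> h)) (at q)" using assms unfolding approx_solution_def by blast
    from has_derivative_minus[OF this] show ?thesis by simp
  qed
  moreover have "\<exists>\<Lambda>. \<forall>q k. \<bar>- v (q + k) - - v q - - \<Gamma> q \<bullet> k\<bar> \<le> \<Lambda> * (norm k)\<^sup>2"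
  proof -
    obtain \<Lambda> where *: "\<forall>q k. \<bar>v (q + k) - v q - \<Gamma> q \<bullet> k\<bar> \<le> \<Lambda> * (norm k)\<^sup>2"
      using assms unfolding approx_solution_def by blast
    have "\<bar>- v (q + k) - - v q - - \<Gamma> q \<bullet> k\<bar> = \<bar>v (q + k) - v q - \<Gamma> q \<bullet> k\<bar>" for q k by simp
    with * show ?thesis by metis
  qed
  moreover have "\<exists>B. \<forall>q. \<bar>- v q\<bar> \<le> B" using assms unfolding approx_solution_def by simp
  moreover have "\<bar>fst (- \<Gamma> (t, x)) - mixed_op g 1 (\<lambda>y. - v (t, y)) (\<lambda>y. - v (t, y)) (snd (- \<Gamma> (t, x))) x
      - dual_rhs f t x (- v (t, x))\<bar> \<le> \<eta>" if "t \<in> {0..T}" for t x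
  proof -
    have "\<bar>fst (\<Gamma> (t, x)) - mixed_op g 1 (\<lambda>y. v (t, y)) (\<lambda>y. v (t, y)) (snd (\<Gamma> (t, x))) x - f t x (v (t, x))\<bar> \<le> \<eta>"
      using assms that unfolding approx_solution_def by blast
    then show ?thesis
      unfolding uminus_prod_def fst_conv snd_conv mixed_op_minus dual_rhs_def minus_minus by linarith
  qed
  ultimately show ?thesis unfolding approx_solution_def by blast
qed

text \<open>The limit itself is not smooth and cannot serve as a test function, so comparison with
  \<open>w\<close> always passes through its approximations. The index \<open>j\<close> sets both
  the horizon and the accuracy; the 3 is \<open>2 * \<eta> + \<epsilon>\<close> of
  \<open>comparison\<close> with \<open>\<epsilon> = \<eta>\<close>.\<close>

definition limit_solution ::
  "(real^'n \<Rightarrow> real) \<Rightarrow> (real \<Rightarrow> real^'n \<Rightarrow> real \<Rightarrow> real) \<Rightarrow> real \<Rightarrow> real \<Rightarrow> (real \<times> (real^'n) \<Rightarrow> real) \<Rightarrow> bool" where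
  "limit_solution g f F K w \<longleftrightarrow> (\<exists>v \<Gamma>.
     (\<forall>j. approx_solution g f (real j) (1 / real (Suc j)) (v j) (\<Gamma> j)) \<and>
     (\<forall>j t x. 0 \<le> t \<longrightarrow> t \<le> real j \<longrightarrow> \<bar>v j (t, x)\<bar> \<le> F * t + 1 / real (Suc j)) \<and>
     (\<forall>j t x. 0 \<le> t \<longrightarrow> t < real j \<longrightarrow>
        \<bar>v j (t, x) - w (t, x)\<bar> \<le> 3 / real (Suc j) * exp (K * t) * log_weight x))"

text \<open>Records what the oscillation estimate needs: \<open>\<delta> j < 1\<close> leaves all
  jumps longer than 1 in place, and the integer \<open>H j\<close> puts whole periods on the time
  grid.\<close>

definition scheme_limit ::
  "(real^'n \<Rightarrow> real) \<Rightarrow> (real \<Rightarrow> real^'n \<Rightarrow> real \<Rightarrow> real) \<Rightarrow> real \<Rightarrow> real \<Rightarrow> (real \<times> (real^'n) \<Rightarrow> real) \<Rightarrow> bool" where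
  "scheme_limit g f C F w \<longleftrightarrow> (\<exists>\<delta> (H :: nat \<Rightarrow> nat).
     (\<forall>j. 0 < \<delta> j \<and> \<delta> j < 1 \<and> 0 < H j \<and> euler_scheme f C F (levy_trunc g (\<delta> j)) (1 / real (H j))) \<and>
     (\<forall>t\<ge>0. \<forall>x. (\<lambda>j. euler_seq (levy_trunc g (\<delta> j)) (1 / real (H j)) f (nat \<lfloor>t * real (H j)\<rfloor>) x)
        \<longlonglongrightarrow> w (t, x)))"

lemma limit_solution_dual:
  assumes "limit_solution g f F K w"
  shows "limit_solution g (dual_rhs f) F K (\<lambda>q. - w q)"
proof -
  obtain v \<Gamma> where v: "\<And>j. approx_solution g f (real j) (1 / real (Suc j)) (v j) (\<Gamma> j)"
    "\<And>j t x. 0 \<le> t \<Longrightarrow> t \<le> real j \<Longrightarrow> \<bar>v j (t, x)\<bar> \<le> F * t + 1 / real (Suc j)"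
    "\<And>j t x. 0 \<le> t \<Longrightarrow> t < real j \<Longrightarrow>
        \<bar>v j (t, x) - w (t, x)\<bar> \<le> 3 / real (Suc j) * exp (K * t) * log_weight x"
    using assms unfolding limit_solution_def by blast
  have "\<bar>- v j (t, x) - - w (t, x)\<bar> \<le> 3 / real (Suc j) * exp (K * t) * log_weight x"
    if "0 \<le> t" "t < real j" for j t x
    using v(3)[OF that, of x] by linarith
  moreover have "\<bar>- v j (t, x)\<bar> \<le> F * t + 1 / real (Suc j)" if "0 \<le> t" "t \<le> real j" for j t x
    using v(2)[OF that, of x] by simp
  ultimately show ?thesis unfolding limit_solution_def
    using approx_solution_dual[OF v(1)]
    by (intro exI[of _ "\<lambda>j q. - v j q"] exI[of _ "\<lambda>j q. - \<Gamma> j q"]) blast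
qed

context nonlocal_rhs begin

lemma nonlocal_rhs_dual: "nonlocal_rhs g (dual_rhs f) C F"
  by (intro nonlocal_rhs.intro levy_kernel_axioms rhs_dual rhs_axioms)

definition growth :: "real \<Rightarrow> real" where
  "growth r = C + weight_bound r + 1"

text \<open>One approximation is read as a viscosity subsolution with right-hand side
  \<open>f + \<eta>\<close>; the excess is at most \<open>\<eta> * log_weight x\<close> because the
  weight is at least 1.\<close>

lemma approx_solution_compare:
  assumes r: "r > 0" and u: "approx_solution g f T \<eta> u \<Gamma>u" and v: "approx_solution g f T \<eta> v \<Gamma>v"
    and 0: "\<And>x. u (0, x) \<le> \<eta>" "\<And>x. - \<eta> \<le> v (0, x)" and \<eta>: "\<eta> \<ge> 0" and t: "0 \<le> t" "t < T"
  shows "u (t, x) \<le> v (t, x) + 3 * \<eta> * exp (growth r * t) * log_weight x"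
proof -
  have du: "\<And>q. (u has_derivative (\<lambda>h. \<Gamma>u q \<bullet> h)) (at q)" using u unfolding approx_solution_def by blast
  obtain B where B: "\<And>q. \<bar>u q\<bar> \<le> B" using u unfolding approx_solution_def by blast
  have "continuous_on space_time u"
    using has_derivative_continuous[OF du] by (intro continuous_at_imp_continuous_on ballI)
  then have usc: "upper_semicontinuous_on space_time u" by (rule continuous_imp_usc)
  have "u (t, x) \<le> v (t, x) + (2 * \<eta> + \<eta>) * exp ((C + weight_bound r + 1) * t) * log_weight x"
  proof (rule comparison[OF r approx_solution_visc_sub[OF u r] usc 0(1) _ v 0(2) \<eta> \<eta> C_nonneg _ _ t])
    show "\<bar>u (t, x)\<bar> \<le> B" for t x by (rule B)
    show "\<bar>f t x a - f t x b\<bar> \<le> C * \<bar>a - b\<bar>" if "0 < t" for t x a b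
      using f_lipschitz[of t t x a x b] that by simp
    show "f t x a + \<eta> \<le> f t x a + \<eta> * log_weight x" for t x a
      using mult_left_mono[OF log_weight_ge_1[of x] \<eta>] by simp
  qed
  then show ?thesis by (simp add: growth_def)
qed

theorem limit_solution_exists:
  assumes r: "r > 0"
  obtains w where "limit_solution g f F (growth r) w" "scheme_limit g f C F w"
proof -
  have "\<exists>v \<Gamma> \<delta> H. approx_solution g f (real j) (1 / real (Suc j)) v \<Gamma> \<and> 0 < \<delta> \<and> \<delta> < 1 \<and> 0 < (H::nat) \<and>
    euler_scheme f C F (levy_trunc g \<delta>) (1 / real H) \<and>
    (\<forall>t x. 0 \<le> t \<longrightarrow> t \<le> real j \<longrightarrow>
      \<bar>v (t, x) - euler_seq (levy_trunc g \<delta>) (1 / real H) f (nat \<lfloor>t * real H\<rfloor>) x\<bar> \<le> 1 / real (Suc j))" for j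
  proof -
    have "0 \<le> real j" "0 < 1 / real (Suc j)" by simp_all
    from approx_solution_exists[OF this] show ?thesis by metis
  qed
  then obtain v \<Gamma> \<delta> H where v: "\<And>j. approx_solution g f (real j) (1 / real (Suc j)) (v j) (\<Gamma> j)"
    and \<delta>H: "\<And>j. 0 < \<delta> j" "\<And>j. \<delta> j < 1" "\<And>j. 0 < (H j::nat)"
      "\<And>j. euler_scheme f C F (levy_trunc g (\<delta> j)) (1 / real (H j))"
    and near: "\<And>j t x. 0 \<le> t \<Longrightarrow> t \<le> real j \<Longrightarrow>
      \<bar>v j (t, x) - euler_seq (levy_trunc g (\<delta> j)) (1 / real (H j)) f (nat \<lfloor>t * real (H j)\<rfloor>) x\<bar> \<le> 1 / real (Suc j)"
    by metis
  let ?u = "\<lambda>j t x. euler_seq (levy_trunc g (\<delta> j)) (1 / real (H j)) f (nat \<lfloor>t * real (H j)\<rfloor>) x"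
  let ?K = "growth r"
  have vbd: "\<bar>v j (t, x)\<bar> \<le> F * t + 1 / real (Suc j)" if t: "0 \<le> t" "t \<le> real j" for j t x
  proof -
    interpret E: euler_scheme f C F "levy_trunc g (\<delta> j)" "1 / real (H j)" by (rule \<delta>H)
    have "\<bar>?u j t x\<bar> \<le> F * (real (nat \<lfloor>t * real (H j)\<rfloor>) * (1 / real (H j)))" by (rule E.euler_seq_bound)
    also have "\<dots> \<le> F * t"
      using E.nat_floor_div(1)[OF t(1)] F_nonneg by (intro mult_left_mono) auto
    finally show ?thesis using near[OF t, of x] by linarith
  qed
  have v0: "\<bar>v j (0, x)\<bar> \<le> 1 / real (Suc j)" for j x using vbd[of 0 j x] by simp
  (* The approximations are mutually comparable because each is a classical, hence a viscosity,
     subsolution for the other up to its error. *)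
  have cauchy: "\<bar>v k (t, x) - v j (t, x)\<bar> \<le> 3 / real (Suc j) * exp (?K * t) * log_weight x"
    if jk: "j \<le> k" and t: "0 \<le> t" "t < real j" for j k t x
  proof -
    let ?\<eta> = "1 / real (Suc j)"
    have \<eta>: "1 / real (Suc k) \<le> ?\<eta>" "?\<eta> \<ge> 0" using jk by (auto simp: frac_le)
    have ak: "approx_solution g f (real j) ?\<eta> (v k) (\<Gamma> k)"
      by (rule approx_solution_mono[OF v]) (use jk \<eta> in auto)
    have "v k (0, y) \<le> ?\<eta>" "- ?\<eta> \<le> v k (0, y)" "v j (0, y) \<le> ?\<eta>" "- ?\<eta> \<le> v j (0, y)" for y
      using v0[of k y] v0[of j y] \<eta> by linarith+
    then have "v k (t, x) \<le> v j (t, x) + 3 * ?\<eta> * exp (?K * t) * log_weight x"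
      "v j (t, x) \<le> v k (t, x) + 3 * ?\<eta> * exp (?K * t) * log_weight x"
      using approx_solution_compare[OF r ak v[of j] _ _ \<eta>(2) t]
        approx_solution_compare[OF r v[of j] ak _ _ \<eta>(2) t] by blast+
    then show ?thesis by (simp add: abs_le_iff algebra_simps)
  qed
  have small: "\<exists>j. t < real j \<and> 3 / real (Suc j) * E < e" if "e > 0" for t E e :: real
  proof -
    obtain n :: nat where n: "max t (3 * \<bar>E\<bar> / e) < real n" using reals_Archimedean2 by blast
    then have "3 * \<bar>E\<bar> < e * real n" using that by (simp add: field_simps)
    also have "\<dots> \<le> e * real (Suc n)" using that by simp
    finally have "3 / real (Suc n) * \<bar>E\<bar> < e" by (simp add: field_simps)
    moreover have "3 / real (Suc n) * E \<le> 3 / real (Suc n) * \<bar>E\<bar>" by (intro mult_left_mono) auto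
    ultimately have "t < real n \<and> 3 / real (Suc n) * E < e" using n by linarith
    then show ?thesis by blast
  qed
  have conv: "convergent (\<lambda>j. v j (t, x))" if t: "0 \<le> t" for t x
  proof -
    have "Cauchy (\<lambda>j. v j (t, x))"
    proof (rule metric_CauchyI)
      fix e :: real assume "e > 0"
      then obtain j where j: "t < real j" "3 / real (Suc j) * (exp (?K * t) * log_weight x) < e / 2"
        using small[of "e / 2" t "exp (?K * t) * log_weight x"] by auto
      have b: "\<bar>v k (t, x) - v j (t, x)\<bar> < e / 2" if "j \<le> k" for k
        using cauchy[OF that t j(1), of x] j(2) by (simp add: mult.assoc)
      show "\<exists>M. \<forall>m\<ge>M. \<forall>n\<ge>M. dist (v m (t, x)) (v n (t, x)) < e"
      proof (intro exI[of _ j] allI impI)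
        fix m n assume "j \<le> m" "j \<le> n"
        then show "dist (v m (t, x)) (v n (t, x)) < e" using b[of m] b[of n] unfolding dist_real_def by linarith
      qed
    qed
    then show ?thesis by (simp add: Cauchy_convergent_iff)
  qed
  define w where "w q = lim (\<lambda>j. v j q)" for q
  have wl: "(\<lambda>j. v j (t, x)) \<longlonglongrightarrow> w (t, x)" if "0 \<le> t" for t x
    unfolding w_def using conv[OF that] by (simp add: convergent_LIMSEQ_iff)
  have err: "\<bar>v j (t, x) - w (t, x)\<bar> \<le> 3 / real (Suc j) * exp (?K * t) * log_weight x"
    if t: "0 \<le> t" "t < real j" for j t x
  proof (rule tendsto_upperbound)
    show "(\<lambda>k. \<bar>v j (t, x) - v k (t, x)\<bar>) \<longlonglongrightarrow> \<bar>v j (t, x) - w (t, x)\<bar>"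
      by (intro tendsto_intros wl t)
    show "\<forall>\<^sub>F k in sequentially. \<bar>v j (t, x) - v k (t, x)\<bar> \<le> 3 / real (Suc j) * exp (?K * t) * log_weight x"
      using cauchy[OF _ t, of _ x] unfolding eventually_sequentially by (auto simp: abs_minus_commute)
  qed simp
  have "limit_solution g f F ?K w"
    unfolding limit_solution_def using v vbd err by blast
  moreover have "scheme_limit g f C F w"
    unfolding scheme_limit_def
  proof (intro exI conjI allI impI)
    fix t :: real and x :: "real^'n" assume t: "0 \<le> t"
    have "(\<lambda>j. v j (t, x) - ?u j t x) \<longlonglongrightarrow> 0"
    proof (rule Lim_null_comparison)
      obtain n :: nat where "t < real n" using reals_Archimedean2 by blast
      then show "\<forall>\<^sub>F j in sequentially. norm (v j (t, x) - ?u j t x) \<le> inverse (real (Suc j))"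
        unfolding eventually_sequentially using near[OF t, of _ x]
        by (intro exI[of _ n]) (auto simp: inverse_eq_divide)
      show "(\<lambda>j. inverse (real (Suc j))) \<longlonglongrightarrow> 0" by (rule LIMSEQ_inverse_real_of_nat)
    qed
    from tendsto_diff[OF wl[OF t, of x] this] show "(\<lambda>j. ?u j t x) \<longlonglongrightarrow> w (t, x)" by simp
  qed (use \<delta>H in auto)
  ultimately show ?thesis using that by blast
qed

lemma small_error: "(\<lambda>j. 3 / real (Suc j) * a * b) \<longlonglongrightarrow> 0" for a b :: real
proof -
  have "(\<lambda>j. (3 * a * b) * inverse (real (Suc j))) \<longlonglongrightarrow> (3 * a * b) * 0"
    by (intro tendsto_intros LIMSEQ_inverse_real_of_nat)
  then show ?thesis by (simp add: divide_inverse mult_ac)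
qed

text \<open>The weight is bounded on balls, so the recorded error gives locally uniform convergence,
  which carries continuity and the subsolution property to the limit.\<close>

lemma limit_solution_properties:
  assumes r: "r > 0" and w: "limit_solution g f F (growth r) w"
  shows "continuous_on space_time w"
    and "\<And>t x. 0 \<le> t \<Longrightarrow> \<bar>w (t, x)\<bar> \<le> F * t"
    and "visc_sub g r f T w"
proof -
  let ?K = "growth r"
  obtain v \<Gamma> where v: "\<And>j. approx_solution g f (real j) (1 / real (Suc j)) (v j) (\<Gamma> j)"
    and vbd: "\<And>j t x. 0 \<le> t \<Longrightarrow> t \<le> real j \<Longrightarrow> \<bar>v j (t, x)\<bar> \<le> F * t + 1 / real (Suc j)"
    and err: "\<And>j t x. 0 \<le> t \<Longrightarrow> t < real j \<Longrightarrow>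
        \<bar>v j (t, x) - w (t, x)\<bar> \<le> 3 / real (Suc j) * exp (?K * t) * log_weight x"
    using w unfolding limit_solution_def by blast
  have K: "?K \<ge> 0" using C_nonneg weight_bound_nonneg[of r] by (simp add: growth_def)
  have unif: "uniform_limit ({0..S} \<times> cball 0 R) v w sequentially" for S R
  proof -
    have "compact ((log_weight :: real^'n \<Rightarrow> real) ` cball 0 R)"
      by (intro compact_continuous_image log_weight_continuous compact_cball)
    then obtain M where M: "\<forall>y\<in>(log_weight :: real^'n \<Rightarrow> real) ` cball 0 R. norm y \<le> M"
      using compact_imp_bounded bounded_iff by blast
    show ?thesis
    proof (rule uniform_limitI)
      fix e :: real assume e: "e > 0"
      have "\<forall>\<^sub>F j in sequentially. 3 / real (Suc j) * exp (?K * S) * M < e"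
        using order_tendstoD(2)[OF small_error e] .
      moreover obtain n :: nat where "S < real n" using reals_Archimedean2 by blast
      then have "\<forall>\<^sub>F j in sequentially. S < real j"
        unfolding eventually_sequentially by (intro exI[of _ n]) auto
      ultimately show "\<forall>\<^sub>F j in sequentially. \<forall>q\<in>{0..S} \<times> cball 0 R. dist (v j q) (w q) < e"
      proof eventually_elim
        case (elim j)
        show ?case
        proof
          fix q assume "q \<in> {0..S} \<times> (cball 0 R :: (real^'n) set)"
          then obtain t x where q: "q = (t, x)" "0 \<le> t" "t \<le> S" "x \<in> cball 0 R" by auto
          have "\<bar>v j (t, x) - w (t, x)\<bar> \<le> 3 / real (Suc j) * exp (?K * t) * log_weight x"
            using q elim by (intro err) auto
          also have "\<dots> \<le> 3 / real (Suc j) * exp (?K * S) * M"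
          proof (intro mult_mono)
            show "exp (?K * t) \<le> exp (?K * S)" using q K by (simp add: mult_left_mono)
            have "norm (log_weight x) \<le> M" using M q by blast
            then show "log_weight x \<le> M" by simp
          qed (use log_weight_ge_1[of x] in auto)
          also have "\<dots> < e" by (rule elim)
          finally show "dist (v j q) (w q) < e" by (simp add: q dist_real_def)
        qed
      qed
    qed
  qed
  have vc: "continuous_on UNIV (v j)" for j
  proof -
    have "\<And>q. (v j has_derivative (\<lambda>h. \<Gamma> j q \<bullet> h)) (at q)" using v unfolding approx_solution_def by blast
    from has_derivative_continuous[OF this] show ?thesis by (intro continuous_at_imp_continuous_on ballI)
  qed
  show wc: "continuous_on space_time w"
    unfolding continuous_on_eq_continuous_within
  proof
    fix q :: "real \<times> (real^'n)" assume "q \<in> space_time"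
    then obtain t x where q: "q = (t, x)" "0 \<le> t" by (cases q) (auto simp: space_time_def)
    let ?K = "{0..t + 1} \<times> (cball 0 (norm x + 1) :: (real^'n) set)"
    have "continuous_on ?K w"
      by (rule uniform_limit_theorem[OF always_eventually unif]) (auto intro: continuous_on_subset[OF vc])
    then have c: "continuous (at q within ?K) w" using q by (simp add: continuous_on_eq_continuous_within)
    have "at q within ?K = at q within space_time"
    proof (rule at_within_nhd[of _ "{..<t + 1} \<times> ball 0 (norm x + 1)"])
      show "?K \<inter> ({..<t + 1} \<times> ball 0 (norm x + 1)) - {q} = space_time \<inter> ({..<t + 1} \<times> ball 0 (norm x + 1)) - {q}"
        by (auto simp: space_time_def)
    qed (use q in \<open>auto intro!: open_Times\<close>)
    with c show "continuous (at q within space_time) w" by simp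
  qed
  have wl: "(\<lambda>j. v j (t, x)) \<longlonglongrightarrow> w (t, x)" if t: "0 \<le> t" for t x
  proof (rule LIM_zero_cancel, rule Lim_null_comparison[OF _ small_error])
    obtain n :: nat where "t < real n" using reals_Archimedean2 by blast
    then show "\<forall>\<^sub>F j in sequentially. norm (v j (t, x) - w (t, x)) \<le> 3 / real (Suc j) * exp (?K * t) * log_weight x"
      unfolding eventually_sequentially using err[OF t, of _ x] by (intro exI[of _ n]) auto
  qed
  show wbd: "\<bar>w (t, x)\<bar> \<le> F * t" if t: "0 \<le> t" for t x
  proof (rule LIMSEQ_le)
    show "(\<lambda>j. \<bar>v j (t, x)\<bar>) \<longlonglongrightarrow> \<bar>w (t, x)\<bar>" by (intro tendsto_intros wl t)
    have "(\<lambda>j. F * t + inverse (real (Suc j))) \<longlonglongrightarrow> F * t + 0"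
      by (intro tendsto_intros LIMSEQ_inverse_real_of_nat)
    then show "(\<lambda>j. F * t + 1 / real (Suc j)) \<longlonglongrightarrow> F * t" by (simp add: inverse_eq_divide)
    obtain n :: nat where n: "t < real n" using reals_Archimedean2 by blast
    show "\<exists>N. \<forall>j\<ge>N. \<bar>v j (t, x)\<bar> \<le> F * t + 1 / real (Suc j)"
      using n by (intro exI[of _ n] allI impI vbd t) linarith
  qed
  show "visc_sub g r f T w"
  proof (rule visc_sub_limit[OF r v unif wc])
    show "\<bar>v j (t, x)\<bar> \<le> F * t + 1" if "0 \<le> t" "t \<le> real j" for j t x
    proof -
      have "1 / real (Suc j) \<le> 1" by simp
      then show ?thesis using vbd[OF that, of x] by linarith
    qed
    show "\<bar>w (t, x)\<bar> \<le> F * t + 1" if "0 \<le> t" for t x using wbd[OF that, of x] by linarith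
  qed
qed

text \<open>Comparison with each approximation of \<open>w\<close>, followed by the limit, in which
  only the allowance \<open>\<epsilon>\<close> survives.\<close>

lemma subsolution_le:
  assumes r: "r > 0" and w: "limit_solution g f F (growth r) w"
    and u: "\<And>T. visc_sub g r f1 T u" "upper_semicontinuous_on space_time u" "\<And>x. u (0, x) \<le> 0"
      "\<And>T. \<exists>M. \<forall>t x. 0 < t \<longrightarrow> t \<le> T \<longrightarrow> \<bar>u (t, x)\<bar> \<le> M"
    and f1: "\<And>t x a. 0 < t \<Longrightarrow> f1 t x a \<le> f t x a + \<epsilon> * log_weight x" and \<epsilon>: "\<epsilon> \<ge> 0" and t: "0 \<le> t"
  shows "u (t, x) \<le> w (t, x) + \<epsilon> * exp (growth r * t) * log_weight x"
proof -
  let ?K = "growth r"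
  obtain v \<Gamma> where v: "\<And>j. approx_solution g f (real j) (1 / real (Suc j)) (v j) (\<Gamma> j)"
    and vbd: "\<And>j t x. 0 \<le> t \<Longrightarrow> t \<le> real j \<Longrightarrow> \<bar>v j (t, x)\<bar> \<le> F * t + 1 / real (Suc j)"
    and err: "\<And>j t x. 0 \<le> t \<Longrightarrow> t < real j \<Longrightarrow>
        \<bar>v j (t, x) - w (t, x)\<bar> \<le> 3 / real (Suc j) * exp (?K * t) * log_weight x"
    using w unfolding limit_solution_def by blast
  let ?E = "exp (?K * t) * log_weight x"
  have E: "?E \<ge> 0" using log_weight_ge_1[of x] by simp
  have main: "u (t, x) \<le> w (t, x) + 3 / real (Suc j) * exp (?K * t) * log_weight x
      + (2 * (1 / real (Suc j)) + \<epsilon>) * exp (?K * t) * log_weight x" if j: "t < real j" for j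
  proof -
    obtain M where M: "\<forall>t x. 0 < t \<longrightarrow> t \<le> real j \<longrightarrow> \<bar>u (t, x)\<bar> \<le> M" using u(4) by blast
    have "u (t, x) \<le> v j (t, x) + (2 * (1 / real (Suc j)) + \<epsilon>) * exp ((C + weight_bound r + 1) * t) * log_weight x"
    proof (rule comparison[OF r u(1,2) _ _ v _ _ \<epsilon> C_nonneg _ _ t j])
      show "u (0, x) \<le> 1 / real (Suc j)" for x using u(3)[of x] by (rule order_trans) simp
      show "- (1 / real (Suc j)) \<le> v j (0, x)" for x using vbd[of 0 j x] by (simp add: abs_le_iff)
      show "\<bar>f t x a - f t x b\<bar> \<le> C * \<bar>a - b\<bar>" if "0 < t" for t x a b
        using f_lipschitz[of t t x a x b] that by simp
    qed (use M f1 in auto)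
    then show ?thesis using err[OF t j, of x] by (simp add: growth_def)
  qed
  show ?thesis
  proof (rule tendsto_lowerbound)
    have "(\<lambda>j. w (t, x) + 3 / real (Suc j) * exp (?K * t) * log_weight x
      + (2 * inverse (real (Suc j)) + \<epsilon>) * exp (?K * t) * log_weight x)
      \<longlonglongrightarrow> w (t, x) + 0 + (2 * 0 + \<epsilon>) * exp (?K * t) * log_weight x"
      by (intro tendsto_intros small_error LIMSEQ_inverse_real_of_nat)
    then show "(\<lambda>j. w (t, x) + 3 / real (Suc j) * exp (?K * t) * log_weight x
      + (2 * (1 / real (Suc j)) + \<epsilon>) * exp (?K * t) * log_weight x)
      \<longlonglongrightarrow> w (t, x) + \<epsilon> * exp (?K * t) * log_weight x" by (simp add: inverse_eq_divide)
    obtain n :: nat where "t < real n" using reals_Archimedean2 by blast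
    then show "\<forall>\<^sub>F j in sequentially. u (t, x) \<le> w (t, x) + 3 / real (Suc j) * exp (?K * t) * log_weight x
      + (2 * (1 / real (Suc j)) + \<epsilon>) * exp (?K * t) * log_weight x"
      unfolding eventually_sequentially by (intro exI[of _ n] allI impI main) linarith
  qed simp
qed

end

section \<open>Oscillation and growth rates\<close>

text \<open>\<open>F0\<close> bounds the oscillation of \<open>f\<close> at a fixed time rather than
  its size, so that additive constants such as \<open>L\<close> do not enter the ergodic
  estimate.\<close>

definition periodic_rhs :: "(real \<Rightarrow> real^'n \<Rightarrow> real \<Rightarrow> real) \<Rightarrow> real \<Rightarrow> bool" where
  "periodic_rhs f F0 \<longleftrightarrow>
     (\<forall>t\<ge>0. \<forall>x a. f t x (a + 1) = f t x a) \<and>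
     (\<forall>k. (\<forall>i. k $ i \<in> \<int>) \<longrightarrow> (\<exists>c. \<forall>t\<ge>0. \<forall>x a. f t (x + k) (a - c) = f t x a)) \<and>
     (\<forall>t\<ge>0. \<forall>x a. f (t + 1) x a = f t x a) \<and>
     (\<forall>t\<ge>0. \<forall>x a y b. \<bar>f t x a - f t y b\<bar> \<le> F0)"

lemma integer_vector_dense:
  fixes y :: "real^'n"
  obtains k :: "real^'n" where "\<forall>i. k $ i \<in> \<int>" "norm (y - k) \<le> real CARD('n)"
proof -
  let ?k = "(\<chi> i. of_int \<lfloor>y $ i\<rfloor>) :: real^'n"
  have "norm (y - ?k) \<le> (\<Sum>i\<in>UNIV. \<bar>(y - ?k) $ i\<bar>)" by (rule norm_le_l1_cart)
  also have "\<dots> \<le> (\<Sum>i\<in>(UNIV :: 'n set). 1)"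
  proof (rule sum_mono)
    fix i
    show "\<bar>(y - ?k) $ i\<bar> \<le> 1" by simp linarith
  qed
  finally show ?thesis by (intro that[of ?k]) auto
qed

context levy_kernel begin

text \<open>A unit ball centred at distance at least 2 avoids the unit ball around 0, so truncation
  at \<open>\<delta> < 1\<close> leaves it untouched; \<open>levy_lower\<close> then gives a
  constant independent of \<open>\<delta>\<close>.\<close>

lemma levy_trunc_spread:
  obtains c where "c > 0" "\<And>\<delta> w b. 0 < \<delta> \<Longrightarrow> \<delta> < 1 \<Longrightarrow> bounded_borel w \<Longrightarrow> (\<And>x. w x \<ge> 0) \<Longrightarrow>
    2 \<le> norm b \<Longrightarrow> norm b \<le> R \<Longrightarrow>
    c * (\<integral>x. indicator (cball b 1) x * w x \<partial>lborel) \<le> (\<integral>x. w x \<partial>levy_trunc g \<delta>)"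
proof -
  obtain c where c: "c > 0" "\<And>z. z \<noteq> 0 \<Longrightarrow> norm z \<le> \<bar>R\<bar> + 1 \<Longrightarrow> levy_density g z \<ge> c"
    using levy_lower[of "\<bar>R\<bar> + 1"] by (metis abs_ge_zero add_nonneg_pos zero_less_one)
  have "c * (\<integral>x. indicator (cball b 1) x * w x \<partial>lborel) \<le> (\<integral>x. w x \<partial>levy_trunc g \<delta>)"
    if \<delta>: "0 < \<delta>" "\<delta> < 1" and w: "bounded_borel w" "\<And>x. w x \<ge> 0" and b: "2 \<le> norm b" "norm b \<le> R"
    for \<delta> w and b :: "real^'n"
  proof -
    obtain B where wm [measurable]: "w \<in> borel_measurable borel" and B: "\<And>x. \<bar>w x\<bar> \<le> B"
      using w(1) unfolding bounded_borel_def by blast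
    interpret T: finite_measure "levy_trunc g \<delta>" by (rule finite_levy_trunc[OF \<delta>(1)])
    have "integrable (levy_trunc g \<delta>) w" by (rule T.integrable_const_bound[where B = B]) (use B in auto)
    then have "integrable (levy_measure g) (\<lambda>z. indicator {z. \<delta> < norm z} z * w z)"
      unfolding levy_trunc_def by (subst (asm) integrable_density) auto
    then have i1: "integrable lborel (\<lambda>z. levy_density g z * (indicator {z. \<delta> < norm z} z * w z))"
      unfolding levy_measure_eq by (subst (asm) integrable_density) (auto simp: levy_density_nonneg)
    have i2: "integrable lborel (\<lambda>x. indicator (cball b 1) x * w x)"
    proof (rule Bochner_Integration.integrable_bound[where f = "\<lambda>x. B * indicator (cball b 1) x"])
      show "integrable lborel (\<lambda>x. B * indicator (cball b 1) x)"
        by (intro integrable_mult_right integrable_real_indicator) (auto simp: emeasure_cball)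
      show "(\<lambda>x. indicator (cball b 1) x * w x) \<in> borel_measurable lborel"
        using wm by (intro borel_measurable_times borel_measurable_indicator) auto
      have "B \<ge> 0" using B[of 0] by linarith
      then show "AE x in lborel. norm (indicator (cball b 1) x * w x) \<le> norm (B * indicator (cball b 1) x)"
        using B by (auto simp: abs_mult indicator_def)
    qed
    have "(\<integral>x. w x \<partial>levy_trunc g \<delta>) = (\<integral>z. levy_density g z * (indicator {z. \<delta> < norm z} z * w z) \<partial>lborel)"
      by (simp add: levy_trunc_integral levy_integral)
    moreover have "(\<integral>x. c * (indicator (cball b 1) x * w x) \<partial>lborel) \<le> \<dots>"
    proof (rule integral_mono[OF _ i1])
      show "integrable lborel (\<lambda>x. c * (indicator (cball b 1) x * w x))" using i2 by simp
      fix z :: "real^'n"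
      show "c * (indicator (cball b 1) z * w z) \<le> levy_density g z * (indicator {z. \<delta> < norm z} z * w z)"
      proof (cases "norm (b - z) \<le> 1")
        case True
        have "norm z \<ge> 1" using True b norm_triangle_ineq2[of b z] by linarith
        moreover have "norm z \<le> \<bar>R\<bar> + 1" using True b norm_triangle_ineq3[of b z] by linarith
        moreover have "z \<noteq> 0" using \<open>norm z \<ge> 1\<close> by auto
        ultimately show ?thesis using c(2)[of z] w(2)[of z] \<delta> True
          by (auto simp: dist_norm intro: mult_right_mono)
      next
        case False
        then show ?thesis using w(2)[of z] levy_density_nonneg[of z] by (simp add: dist_norm indicator_def)
      qed
    qed
    ultimately show ?thesis using i2 by simp
  qed
  then show ?thesis using that c(1) by blast
qed

text \<open>The order of quantifiers is the point: \<open>\<kappa>\<close> is fixed before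
  \<open>f\<close>, hence before \<open>p\<close> and \<open>L\<close>. The discrete bound does not
  involve the step or the truncation, so it survives the limit.\<close>

theorem scheme_limit_oscillation:
  obtains \<kappa> where "\<kappa> > 0" "\<And>f C F F0 w. rhs f C F \<Longrightarrow> periodic_rhs f F0 \<Longrightarrow> scheme_limit g f C F w \<Longrightarrow>
    (\<forall>n t x. 0 \<le> t \<longrightarrow> \<bar>w (t + real n, x) - w (t, x) - w (real n, 0)\<bar> \<le> 2 + F0 / \<kappa>)"
proof -
  let ?D = "real CARD('n)"
  obtain c where c: "c > 0" "\<And>\<delta> w b. 0 < \<delta> \<Longrightarrow> \<delta> < 1 \<Longrightarrow> bounded_borel w \<Longrightarrow> (\<And>x. w x \<ge> 0) \<Longrightarrow>
    2 \<le> norm b \<Longrightarrow> norm b \<le> 2 * ?D + 2 \<Longrightarrow>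
    c * (\<integral>x. indicator (cball b 1) x * w x \<partial>lborel) \<le> (\<integral>x. w x \<partial>levy_trunc g \<delta>)"
    using levy_trunc_spread[of "2 * ?D + 2"] by blast
  define om where "om = measure lborel (cball (0::real^'n) 1)"
  have om: "om > 0" unfolding om_def by (simp add: content_cball)
  have "\<bar>w (t + real n, x) - w (t, x) - w (real n, 0)\<bar> \<le> 2 + F0 / (c * om)"
    if f: "rhs f C F" and per: "periodic_rhs f F0" and w: "scheme_limit g f C F w" and t: "0 \<le> t"
    for f C F F0 w n t x
  proof -
    obtain \<delta> and H :: "nat \<Rightarrow> nat" where \<delta>H: "\<And>j. 0 < \<delta> j" "\<And>j. \<delta> j < 1" "\<And>j. 0 < H j"
      "\<And>j. euler_scheme f C F (levy_trunc g (\<delta> j)) (1 / real (H j))"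
      and lim: "\<And>t x. 0 \<le> t \<Longrightarrow>
        (\<lambda>j. euler_seq (levy_trunc g (\<delta> j)) (1 / real (H j)) f (nat \<lfloor>t * real (H j)\<rfloor>) x) \<longlonglongrightarrow> w (t, x)"
      using w unfolding scheme_limit_def by blast
    let ?u = "\<lambda>j t x. euler_seq (levy_trunc g (\<delta> j)) (1 / real (H j)) f (nat \<lfloor>t * real (H j)\<rfloor>) x"
    have bound: "\<bar>?u j (t + real n) x - ?u j t x - ?u j (real n) 0\<bar> \<le> 2 + F0 / (c * om)" for j
    proof -
      interpret E: euler_scheme f C F "levy_trunc g (\<delta> j)" "1 / real (H j)" by (rule \<delta>H)
      interpret P: periodic_euler_scheme f C F "levy_trunc g (\<delta> j)" "1 / real (H j)"
        "{k. \<forall>i. k $ i \<in> \<int>}" ?D c F0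
      proof
        show "\<exists>k\<in>{k. \<forall>i. k $ i \<in> \<int>}. norm (y - k) \<le> ?D" for y :: "real^'n"
          using integer_vector_dense[of y] by blast
        show "c * (\<integral>x. indicator (cball b 1) x * w x \<partial>lborel) \<le> (\<integral>x. w x \<partial>levy_trunc g (\<delta> j))"
          if "bounded_borel w" "\<And>x. 0 \<le> w x" "2 \<le> norm b" "norm b \<le> 2 * ?D + 2" for w and b :: "real^'n"
          by (rule c(2)[OF \<delta>H(1,2) that])
        show "f t x (a + 1) = f t x a" if "t \<ge> 0" for t x a
          using per that unfolding periodic_rhs_def by blast
        show "\<exists>c. \<forall>t\<ge>0. \<forall>x a. f t (x + k) (a - c) = f t x a" if "k \<in> {k. \<forall>i. k $ i \<in> \<int>}" for k
          using per that unfolding periodic_rhs_def by blast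
        show "f (t + 1) x a = f t x a" if "t \<ge> 0" for t x a
          using per that unfolding periodic_rhs_def by blast
        show "\<bar>f t x a - f t y b\<bar> \<le> F0" if "t \<ge> 0" for t x a y b
          using per that unfolding periodic_rhs_def by blast
      qed (rule c(1))
      \<comment> \<open>The grid index of \<open>t + real n\<close> exceeds that of \<open>t\<close>
        by exactly \<open>n * H j\<close>, since \<open>n * H j\<close> is an integer.\<close>
      have fl: "nat \<lfloor>a + real m\<rfloor> = nat \<lfloor>a\<rfloor> + m" if "a \<ge> 0" for a :: real and m
        using floor_add_int[of a "int m"] that by (simp add: nat_add_distrib)
      have "(t + real n) * real (H j) = t * real (H j) + real (n * H j)" by (simp add: algebra_simps)
      then have "nat \<lfloor>(t + real n) * real (H j)\<rfloor> = nat \<lfloor>t * real (H j)\<rfloor> + n * H j"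
        using fl[of "t * real (H j)" "n * H j"] t by simp
      moreover have "nat \<lfloor>real n * real (H j)\<rfloor> = n * H j"
        by (metis floor_of_nat nat_int of_nat_mult)
      moreover have "real (n * H j) * (1 / real (H j)) = real n" using \<delta>H(3)[of j] by simp
      ultimately show ?thesis
        using P.euler_seq_time_shift[of "n * H j" n "nat \<lfloor>t * real (H j)\<rfloor>" x]
        by (simp add: P.om_def om_def)
    qed
    show ?thesis
    proof (rule tendsto_upperbound)
      show "(\<lambda>j. \<bar>?u j (t + real n) x - ?u j t x - ?u j (real n) 0\<bar>)
        \<longlonglongrightarrow> \<bar>w (t + real n, x) - w (t, x) - w (real n, 0)\<bar>"
        by (intro tendsto_intros lim) (use t in auto)
    qed (use bound in auto)
  qed
  then show ?thesis using that[of "c * om"] c(1) om by simp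
qed

end

text \<open>Evaluating \<open>a (m * n)\<close> as \<open>m\<close> blocks and as \<open>n\<close>
  blocks compares \<open>a n / n\<close> with \<open>a m / m\<close> up to
  \<open>Q / n + Q / m\<close>. The ratios converge, and letting \<open>m\<close> tend to infinity
  keeps the same constant \<open>Q\<close>.\<close>

lemma quasi_additive:
  fixes a :: "nat \<Rightarrow> real"
  assumes a: "\<And>m n. \<bar>a (m + n) - a m - a n\<bar> \<le> Q" and a0: "a 0 = 0"
  obtains l where "\<And>n. \<bar>a n - real n * l\<bar> \<le> Q"
proof -
  have Q: "Q \<ge> 0" using a[of 0 0] abs_ge_zero order_trans by blast
  have mult: "\<bar>a (k * n) - real k * a n\<bar> \<le> real k * Q" for k n
  proof (induction k)
    case (Suc k)
    have "\<bar>a (k * n + n) - a (k * n) - a n\<bar> \<le> Q" by (rule a)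
    with Suc show ?case by (simp add: algebra_simps) 
  qed (simp add: a0)
  have key: "\<bar>a n / real n - a m / real m\<bar> \<le> Q / real n + Q / real m" if "n > 0" "m > 0" for m n
  proof -
    have "\<bar>real m * a n - real n * a m\<bar> \<le> real m * Q + real n * Q"
      using mult[of m n] mult[of n m] by (simp add: mult.commute[of n m])
    then have "\<bar>real m * a n - real n * a m\<bar> / (real m * real n) \<le> (real m * Q + real n * Q) / (real m * real n)"
      by (intro divide_right_mono) auto
    moreover have "\<bar>real m * a n - real n * a m\<bar> / (real m * real n) = \<bar>a n / real n - a m / real m\<bar>"
    proof -
      have "a n / real n - a m / real m = (real m * a n - real n * a m) / (real m * real n)"
        using that by (simp add: field_simps)
      then show ?thesis by (simp add: abs_mult)
    qed
    moreover have "(real m * Q + real n * Q) / (real m * real n) = Q / real n + Q / real m"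
      using that by (simp add: field_simps)
    ultimately show ?thesis by simp
  qed
  have inv: "(\<lambda>m. Q / real (Suc m)) \<longlonglongrightarrow> 0"
  proof -
    have "(\<lambda>m. Q * inverse (real (Suc m))) \<longlonglongrightarrow> Q * 0" by (intro tendsto_intros LIMSEQ_inverse_real_of_nat)
    then show ?thesis by (simp add: divide_inverse)
  qed
  have "Cauchy (\<lambda>m. a (Suc m) / real (Suc m))"
  proof (rule metric_CauchyI)
    fix e :: real assume e: "e > 0"
    then obtain N where N: "\<And>m. m \<ge> N \<Longrightarrow> Q / real (Suc m) < e / 2"
      using order_tendstoD(2)[OF inv, of "e/2"] unfolding eventually_sequentially by auto
    have "dist (a (Suc m) / real (Suc m)) (a (Suc n) / real (Suc n)) < e" if "m \<ge> N" "n \<ge> N" for m n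
      using key[of "Suc m" "Suc n"] N[OF that(1)] N[OF that(2)] unfolding dist_real_def by linarith
    then show "\<exists>M. \<forall>m\<ge>M. \<forall>n\<ge>M. dist (a (Suc m) / real (Suc m)) (a (Suc n) / real (Suc n)) < e" by blast
  qed
  then obtain l where l: "(\<lambda>m. a (Suc m) / real (Suc m)) \<longlonglongrightarrow> l"
    using Cauchy_convergent convergent_def by blast
  have "\<bar>a n - real n * l\<bar> \<le> Q" for n
  proof (cases "n = 0")
    case False
    have "\<bar>a n / real n - l\<bar> \<le> Q / real n + 0"
    proof (rule LIMSEQ_le)
      show "(\<lambda>m. \<bar>a n / real n - a (Suc m) / real (Suc m)\<bar>) \<longlonglongrightarrow> \<bar>a n / real n - l\<bar>" by (intro tendsto_intros l)
      show "(\<lambda>m. Q / real n + Q / real (Suc m)) \<longlonglongrightarrow> Q / real n + 0" by (intro tendsto_intros inv)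
      show "\<exists>N. \<forall>m\<ge>N. \<bar>a n / real n - a (Suc m) / real (Suc m)\<bar> \<le> Q / real n + Q / real (Suc m)"
        using key False by blast
    qed
    then have "real n * \<bar>a n / real n - l\<bar> \<le> real n * (Q / real n)" by (intro mult_left_mono) auto
    also have "real n * \<bar>a n / real n - l\<bar> = \<bar>real n * (a n / real n - l)\<bar>" by (simp add: abs_mult)
    also have "real n * (a n / real n - l) = a n - real n * l" using False by (simp add: algebra_simps)
    finally show ?thesis using False by simp
  qed (simp add: a0 Q)
  then show ?thesis using that by blast
qed

text \<open>A general time is an integer plus a remainder in \<open>[0, 1]\<close>, on which
  \<open>w\<close> is bounded. The resulting rate \<open>M / t\<close> is uniform over the whole
  space.\<close>

lemma growth_rate_exists:
  fixes w :: "real \<times> (real^'n) \<Rightarrow> real"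
  assumes shift: "\<And>n t x. 0 \<le> t \<Longrightarrow> \<bar>w (t + real n, x) - w (t, x) - w (real n, 0)\<bar> \<le> Q"
    and bd: "\<And>t x. 0 \<le> t \<Longrightarrow> \<bar>w (t, x)\<bar> \<le> F * t"
  obtains l where "has_growth_rate w l" "\<And>n. \<bar>w (real n, 0) - real n * l\<bar> \<le> Q"
proof -
  have F: "F \<ge> 0" using bd[of 1 0] by simp
  have "\<bar>w (real (m + n), 0) - w (real m, 0) - w (real n, 0)\<bar> \<le> Q" for m n
    using shift[of "real m" n 0] by simp
  moreover have "w (real 0, 0) = 0" using bd[of 0 0] by simp
  ultimately obtain l where l: "\<And>n. \<bar>w (real n, 0) - real n * l\<bar> \<le> Q"
    using quasi_additive[of "\<lambda>n. w (real n, 0)" Q] by metis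
  \<comment> \<open>One \<open>Q\<close> for splitting off the integer part, one for
    quasi-additivity; \<open>F\<close> and \<open>\<bar>l\<bar>\<close> for the fractional
    remainder.\<close>
  define M where "M = 2 * Q + F + \<bar>l\<bar>"
  have est: "\<bar>w (t, x) / t - l\<bar> \<le> M / t" if t: "t > 0" for t x
  proof -
    define n where "n = nat \<lfloor>t\<rfloor>"
    define s where "s = t - real n"
    have n: "real n = of_int \<lfloor>t\<rfloor>" using t by (simp add: n_def)
    have s: "0 \<le> s" "s \<le> 1" unfolding s_def n by linarith+
    have "\<bar>w (t, x) - w (s, x) - w (real n, 0)\<bar> \<le> Q" using shift[OF s(1), of n x] by (simp add: s_def)
    moreover have "\<bar>w (s, x)\<bar> \<le> F" using bd[OF s(1), of x] mult_left_mono[OF s(2) F] by simp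
    moreover have "\<bar>real n * l - t * l\<bar> \<le> \<bar>l\<bar>"
    proof -
      have "real n * l - t * l = - (s * l)" by (simp add: s_def algebra_simps)
      then show ?thesis using s mult_right_mono[OF s(2), of "\<bar>l\<bar>"] by (simp add: abs_mult)
    qed
    ultimately have "\<bar>w (t, x) - t * l\<bar> \<le> M" using l[of n] unfolding M_def by linarith
    then have "\<bar>w (t, x) - t * l\<bar> / t \<le> M / t" using t by (intro divide_right_mono) auto
    also have "\<bar>w (t, x) - t * l\<bar> / t = \<bar>(w (t, x) - t * l) / t\<bar>" using t by simp
    also have "(w (t, x) - t * l) / t = w (t, x) / t - l" using t by (simp add: diff_divide_distrib)
    finally show ?thesis .
  qed
  have "has_growth_rate w l"
    unfolding has_growth_rate_def
  proof (intro allI impI uniform_limitI)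
    fix K :: "(real^'n) set" and e :: real assume e: "e > 0"
    have "\<forall>\<^sub>F t in at_top. t > max 0 (M / e)" by (rule eventually_gt_at_top)
    then show "\<forall>\<^sub>F t in at_top. \<forall>y\<in>K. dist (w (t, y) / t) l < e"
    proof eventually_elim
      case (elim t)
      have "M / t < e" using elim e by (simp add: field_simps)
      then show ?case using est[of t] elim by (auto simp: dist_real_def intro: le_less_trans)
    qed
  qed
  then show ?thesis using that l by blast
qed

lemma growth_rate_unique:
  fixes w w' :: "real \<times> (real^'n) \<Rightarrow> real"
  assumes "has_growth_rate w l" "has_growth_rate w' l'" "\<And>q. q \<in> space_time \<Longrightarrow> w' q = w q"
  shows "l' = l"
proof -
  have lim: "((\<lambda>t. v (t, 0) / t) \<longlongrightarrow> k) at_top" if v: "has_growth_rate v k"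
    for v :: "real \<times> (real^'n) \<Rightarrow> real" and k
  proof -
    have "uniform_limit {0} (\<lambda>\<tau> y. v (\<tau>, y) / \<tau>) (\<lambda>y. k) at_top"
      by (rule v[unfolded has_growth_rate_def, rule_format]) simp
    then show ?thesis by (rule tendsto_uniform_limitI[where x = 0]) simp
  qed
  note 1 = lim[OF assms(1)] lim[OF assms(2)]
  have "\<forall>\<^sub>F t in at_top. w' (t, 0) / t = w (t, 0) / t"
    using eventually_ge_at_top[of "0::real"] by eventually_elim (simp add: assms(3) space_time_def)
  with 1(2) have "((\<lambda>t. w (t, 0) / t) \<longlongrightarrow> l') at_top" by (rule Lim_transform_eventually)
  then show ?thesis using 1(1) by (rule tendsto_unique[OF trivial_limit_at_top_linorder])
qed

section \<open>The cell problem\<close>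

lemma I1_outer_minus: "I1_outer g r (\<lambda>x. - u x) x = - I1_outer g r u x"
proof -
  have "indicator A z *\<^sub>R (- u (x + z) - - u x) = - (indicator A z *\<^sub>R (u (x + z) - u x))" for A z
    by (simp add: algebra_simps)
  then show ?thesis unfolding I1_outer_def set_lebesgue_integral_def by (simp only: integral_minus)
qed

lemma I1_inner_minus:
  assumes "gradient (\<lambda>x. - \<phi> x) x = - gradient \<phi> x"
  shows "I1_inner g r (\<lambda>x. - \<phi> x) x = - I1_inner g r \<phi> x"
proof -
  have "indicator A z *\<^sub>R (- \<phi> (x + z) - - \<phi> x - (- gradient \<phi> x) \<bullet> z)
      = - (indicator A z *\<^sub>R (\<phi> (x + z) - \<phi> x - gradient \<phi> x \<bullet> z))" for A z
    by (simp add: algebra_simps)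
  then show ?thesis unfolding I1_inner_def set_lebesgue_integral_def assms by (simp only: integral_minus)
qed

lemma C2_test_minus:
  fixes \<phi> :: "real \<times> (real^'n) \<Rightarrow> real"
  assumes \<phi>: "C2_on space_time \<phi>" and t: "t > 0"
  shows "deriv (\<lambda>t. - \<phi> (t, x)) t = - deriv (\<lambda>t. \<phi> (t, x)) t"
    and "I1_inner g r (\<lambda>x. - \<phi> (t, x)) x = - I1_inner g r (\<lambda>x. \<phi> (t, x)) x"
proof -
  obtain G where G: "\<And>t x. 0 < t \<Longrightarrow> (\<phi> has_derivative (\<lambda>h. G (t, x) \<bullet> h)) (at (t, x))"
    using C2_test_function[OF \<phi>] by metis
  have "((\<lambda>q. - \<phi> q) has_derivative (\<lambda>h. (- G (t, x)) \<bullet> h)) (at (t, x))"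
    using has_derivative_minus[OF G[OF t]] by simp
  note m = slice_derivatives[OF this] and p = slice_derivatives[OF G[OF t, of x]]
  show "deriv (\<lambda>t. - \<phi> (t, x)) t = - deriv (\<lambda>t. \<phi> (t, x)) t" by (simp add: m(1) p(1))
  show "I1_inner g r (\<lambda>x. - \<phi> (t, x)) x = - I1_inner g r (\<lambda>x. \<phi> (t, x)) x"
    by (rule I1_inner_minus) (simp add: m(3) p(3))
qed

text \<open>The envelope of the zero initial datum is zero, and a test time \<open>t0\<close> lies
  below the horizon \<open>t0 + 1\<close>.\<close>

lemma viscosity_subsolution_iff:
  fixes u :: "real \<times> (real^'n) \<Rightarrow> real"
  shows "viscosity_subsolution g r (\<lambda>t y v q l. l + f t y v) (\<lambda>y. 0) u \<longleftrightarrow>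
    u \<in> USC_b \<and> (\<forall>x. u (0, x) \<le> 0) \<and> (\<forall>T. visc_sub g r f T u)"
proof -
  have lim: "Limsup (nhds x) (\<lambda>y. ereal 0) = 0" for x :: "real^'n"
    by (subst Limsup_const) (auto simp: zero_ereal_def)
  show ?thesis
  proof (intro iffI conjI allI)
    assume *: "viscosity_subsolution g r (\<lambda>t y v q l. l + f t y v) (\<lambda>y. 0) u"
    then show "u \<in> USC_b" unfolding viscosity_subsolution_def by blast
    show "u (0, x) \<le> 0" for x using * unfolding viscosity_subsolution_def lim by simp
    show "visc_sub g r f T u" for T
      unfolding visc_sub_def
    proof (intro allI impI)
      fix t0 x0 \<tau> and \<phi> :: "real \<times> (real^'n) \<Rightarrow> real"
      assume a: "0 < t0" "t0 < T" "0 < \<tau>" "\<tau> < t0" "C2_on space_time \<phi>"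
        "\<forall>q\<in>{t0 - \<tau><..<t0 + \<tau>} \<times> ball x0 r. u q - \<phi> q \<le> u (t0, x0) - \<phi> (t0, x0)"
      have \<tau>: "\<tau> \<in> {0<..<t0}" using a by simp
      from * have "deriv (\<lambda>t. \<phi> (t, x0)) t0 - (I1_inner g r (\<lambda>x. \<phi> (t0, x)) x0
          + I1_outer g r (\<lambda>x. u (t0, x)) x0 + f t0 x0 (u (t0, x0))) \<le> 0"
        unfolding viscosity_subsolution_def using a(1,5,6) \<tau> by blast
      then show "deriv (\<lambda>t. \<phi> (t, x0)) t0 \<le> I1_inner g r (\<lambda>x. \<phi> (t0, x)) x0
          + I1_outer g r (\<lambda>x. u (t0, x)) x0 + f t0 x0 (u (t0, x0))" by linarith
    qed
  next
    assume *: "u \<in> USC_b \<and> (\<forall>x. u (0, x) \<le> 0) \<and> (\<forall>T. visc_sub g r f T u)"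
    show "viscosity_subsolution g r (\<lambda>t y v q l. l + f t y v) (\<lambda>y. 0) u"
      unfolding viscosity_subsolution_def
    proof (intro conjI allI impI ballI)
      show "u \<in> USC_b" using * by blast
      show "ereal (u (0, x)) \<le> Limsup (nhds x) (\<lambda>y. ereal 0)" for x using * unfolding lim by simp
      fix t0 :: real and x0 \<tau> and \<phi> :: "real \<times> (real^'n) \<Rightarrow> real"
      assume a: "0 < t0" "\<tau> \<in> {0<..<t0}" "C2_on space_time \<phi>"
        "\<forall>q\<in>{t0 - \<tau><..<t0 + \<tau>} \<times> ball x0 r. u q - \<phi> q \<le> u (t0, x0) - \<phi> (t0, x0)"
      have \<tau>: "0 < \<tau>" "\<tau> < t0" "t0 < t0 + 1" using a(2) by auto
      have "visc_sub g r f (t0 + 1) u" using * by blast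
      then have "deriv (\<lambda>t. \<phi> (t, x0)) t0 \<le> I1_inner g r (\<lambda>x. \<phi> (t0, x)) x0
          + I1_outer g r (\<lambda>x. u (t0, x)) x0 + f t0 x0 (u (t0, x0))"
        unfolding visc_sub_def using a(1,3,4) \<tau> by blast
      then show "deriv (\<lambda>t. \<phi> (t, x0)) t0 - (I1_inner g r (\<lambda>x. \<phi> (t0, x)) x0
          + I1_outer g r (\<lambda>x. u (t0, x)) x0 + f t0 x0 (u (t0, x0))) \<le> 0" by linarith
    qed
  qed
qed

text \<open>Testing \<open>u\<close> from below with \<open>\<phi>\<close> is testing
  \<open>- u\<close> from above with \<open>- \<phi>\<close>. The outer integral is odd in
  \<open>u\<close>; for the singular part the gradient must exist, which holds at positive
  times.\<close>

lemma viscosity_supersolution_iff: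
  fixes u :: "real \<times> (real^'n) \<Rightarrow> real"
  shows "viscosity_supersolution g r (\<lambda>t y v q l. l + f t y v) (\<lambda>y. 0) u \<longleftrightarrow>
    u \<in> LSC_b \<and> (\<forall>x. 0 \<le> u (0, x)) \<and> (\<forall>T. visc_sub g r (dual_rhs f) T (\<lambda>q. - u q))"
proof -
  have lim: "Liminf (nhds x) (\<lambda>y. ereal 0) = 0" for x :: "real^'n"
    by (subst Liminf_const) (auto simp: zero_ereal_def)
  show ?thesis
  proof (intro iffI conjI allI)
    assume *: "viscosity_supersolution g r (\<lambda>t y v q l. l + f t y v) (\<lambda>y. 0) u"
    then show "u \<in> LSC_b" unfolding viscosity_supersolution_def by blast
    show "0 \<le> u (0, x)" for x using * unfolding viscosity_supersolution_def lim by simp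
    show "visc_sub g r (dual_rhs f) T (\<lambda>q. - u q)" for T
      unfolding visc_sub_def
    proof (intro allI impI)
      fix t0 x0 \<tau> and \<phi> :: "real \<times> (real^'n) \<Rightarrow> real"
      assume a: "0 < t0" "t0 < T" "0 < \<tau>" "\<tau> < t0" "C2_on space_time \<phi>"
        "\<forall>q\<in>{t0 - \<tau><..<t0 + \<tau>} \<times> ball x0 r. - u q - \<phi> q \<le> - u (t0, x0) - \<phi> (t0, x0)"
      have \<tau>: "\<tau> \<in> {0<..<t0}" using a by simp
      have mn: "\<forall>q\<in>{t0 - \<tau><..<t0 + \<tau>} \<times> ball x0 r. u q - - \<phi> q \<ge> u (t0, x0) - - \<phi> (t0, x0)"
      proof
        fix q assume "q \<in> {t0 - \<tau><..<t0 + \<tau>} \<times> ball x0 r"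
        from bspec[OF a(6) this] show "u q - - \<phi> q \<ge> u (t0, x0) - - \<phi> (t0, x0)" by linarith
      qed
      have c2: "C2_on space_time (\<lambda>q. - \<phi> q)" by (rule C2_on_minus[OF a(5)])
      from *[unfolded viscosity_supersolution_def, THEN conjunct2, THEN conjunct2,
          rule_format, OF a(1) \<tau> c2, of x0] mn
      have "deriv (\<lambda>t. - \<phi> (t, x0)) t0 - (I1_inner g r (\<lambda>x. - \<phi> (t0, x)) x0
          + I1_outer g r (\<lambda>x. u (t0, x)) x0 + f t0 x0 (u (t0, x0))) \<ge> 0"
        by blast
      then show "deriv (\<lambda>t. \<phi> (t, x0)) t0 \<le> I1_inner g r (\<lambda>x. \<phi> (t0, x)) x0
          + I1_outer g r (\<lambda>x. - u (t0, x)) x0 + dual_rhs f t0 x0 (- u (t0, x0))"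
        unfolding C2_test_minus[OF a(5,1)] I1_outer_minus dual_rhs_def minus_minus by linarith
    qed
  next
    assume *: "u \<in> LSC_b \<and> (\<forall>x. 0 \<le> u (0, x)) \<and> (\<forall>T. visc_sub g r (dual_rhs f) T (\<lambda>q. - u q))"
    show "viscosity_supersolution g r (\<lambda>t y v q l. l + f t y v) (\<lambda>y. 0) u"
      unfolding viscosity_supersolution_def
    proof (intro conjI allI impI ballI)
      show "u \<in> LSC_b" using * by blast
      show "ereal (u (0, x)) \<ge> Liminf (nhds x) (\<lambda>y. ereal 0)" for x using * unfolding lim by simp
      fix t0 :: real and x0 \<tau> and \<phi> :: "real \<times> (real^'n) \<Rightarrow> real"
      assume a: "0 < t0" "\<tau> \<in> {0<..<t0}" "C2_on space_time \<phi>"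
        "\<forall>q\<in>{t0 - \<tau><..<t0 + \<tau>} \<times> ball x0 r. u q - \<phi> q \<ge> u (t0, x0) - \<phi> (t0, x0)"
      have \<tau>: "0 < \<tau>" "\<tau> < t0" "t0 < t0 + 1" using a(2) by auto
      have c2: "C2_on space_time (\<lambda>q. - \<phi> q)" by (rule C2_on_minus[OF a(3)])
      have mx: "- u q - - \<phi> q \<le> - u (t0, x0) - - \<phi> (t0, x0)"
        if "q\<in>{t0 - \<tau><..<t0 + \<tau>} \<times> ball x0 r" for q
        using bspec[OF a(4) that] by linarith
      have "visc_sub g r (dual_rhs f) (t0 + 1) (\<lambda>q. - u q)" using * by blast
      from this[unfolded visc_sub_def, rule_format, OF a(1) \<tau>(3,1,2) c2 mx]
      have "deriv (\<lambda>t. - \<phi> (t, x0)) t0 \<le> I1_inner g r (\<lambda>x. - \<phi> (t0, x)) x0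
          + I1_outer g r (\<lambda>x. - u (t0, x)) x0 + dual_rhs f t0 x0 (- u (t0, x0))" .
      then show "deriv (\<lambda>t. \<phi> (t, x0)) t0 - (I1_inner g r (\<lambda>x. \<phi> (t0, x)) x0
          + I1_outer g r (\<lambda>x. u (t0, x)) x0 + f t0 x0 (u (t0, x0))) \<ge> 0"
        unfolding C2_test_minus[OF a(3,1)] I1_outer_minus dual_rhs_def minus_minus by linarith
    qed
  qed
qed

lemma C_b_iff:
  "u \<in> C_b \<longleftrightarrow> upper_semicontinuous_on space_time u \<and> lower_semicontinuous_on space_time u \<and>
    (\<forall>T>0. bounded (u ` ({0<..<T} \<times> UNIV)))"
  unfolding C_b_def USC_b_def LSC_b_def by blast

lemma C_b_bound:
  assumes "u \<in> C_b"
  shows "\<exists>M. \<forall>t x. 0 < t \<longrightarrow> t \<le> T \<longrightarrow> \<bar>u (t, x)\<bar> \<le> M"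
proof -
  have "bounded (u ` ({0<..<\<bar>T\<bar> + 1} \<times> UNIV))" using assms unfolding C_b_iff by (simp add: add_nonneg_pos)
  then obtain M where M: "\<forall>y\<in>u ` ({0<..<\<bar>T\<bar> + 1} \<times> UNIV). norm y \<le> M" unfolding bounded_iff by blast
  have "\<bar>u (t, x)\<bar> \<le> M" if "0 < t" "t \<le> T" for t x
    using bspec[OF M, of "u (t, x)"] that by auto
  then show ?thesis by blast
qed

section \<open>Bounds for the cell right-hand side and properties of the effective
  Hamiltonian\<close>

definition cell_rhs ::
  "(real \<Rightarrow> real) \<Rightarrow> (real \<times> (real^'n) \<Rightarrow> real) \<Rightarrow> real^'n \<Rightarrow> real \<Rightarrow> real \<Rightarrow> real^'n \<Rightarrow> real \<Rightarrow> real" where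
  "cell_rhs W \<sigma> p L t y v = L - deriv W (v + p \<bullet> y) + \<sigma> (t, y)"

lemma cell_solution_iff:
  "cell_solution g W \<sigma> r p L w \<longleftrightarrow> w \<in> C_b \<and> (\<forall>x. w (0, x) = 0) \<and>
     (\<forall>T. visc_sub g r (cell_rhs W \<sigma> p L) T w) \<and>
     (\<forall>T. visc_sub g r (dual_rhs (cell_rhs W \<sigma> p L)) T (\<lambda>q. - w q))"
proof -
  have eq: "(\<lambda>\<tau> y v q l. l + L - deriv W (v + p \<bullet> y) + \<sigma> (\<tau>, y)) = (\<lambda>t y v q l. l + cell_rhs W \<sigma> p L t y v)"
    by (simp add: cell_rhs_def fun_eq_iff)
  have "(\<forall>x. w (0, x) = 0) \<longleftrightarrow> (\<forall>x. w (0, x) \<le> 0) \<and> (\<forall>x. 0 \<le> w (0, x))" by (auto intro: antisym)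
  then show ?thesis
    unfolding cell_solution_def viscosity_solution_def eq viscosity_subsolution_iff viscosity_supersolution_iff C_b_def
    by blast
qed

lemma periodic_shift_int:
  fixes h :: "real \<Rightarrow> 'a"
  assumes "\<And>v. h (v + 1) = h v"
  shows "h (v + of_int i) = h v"
proof (induction i arbitrary: v rule: int_induct[where k = 0])
  case (step1 i)
  have "h (v + of_int (i + 1)) = h ((v + of_int i) + 1)" by (simp add: algebra_simps)
  then show ?case using assms step1 by simp
next
  case (step2 i)
  have "h (v + of_int (i - 1)) = h ((v + of_int (i - 1)) + 1)" by (simp only: assms)
  also have "(v + of_int (i - 1)) + 1 = v + of_int i" by simp
  finally show ?case using step2 by simp
qed simp

locale cell_problem = levy_kernel g for g :: "real^'n \<Rightarrow> real" +
  fixes W :: "real \<Rightarrow> real" and \<sigma> :: "real \<times> (real^'n) \<Rightarrow> real" and r C1 C2 :: real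
  assumes W_lip: "C1-lipschitz_on UNIV (deriv W)"
    and W_diff: "\<And>v. W differentiable (at v)"
    and W_per: "\<And>v. W (v + 1) = W v"
    and \<sigma>_lip: "C2-lipschitz_on space_time \<sigma>"
    and \<sigma>_per_t: "\<And>t x. t \<ge> 0 \<Longrightarrow> \<sigma> (t + 1, x) = \<sigma> (t, x)"
    and \<sigma>_per_x: "\<And>t x k. t \<ge> 0 \<Longrightarrow> (\<forall>i. k $ i \<in> \<int>) \<Longrightarrow> \<sigma> (t, x + k) = \<sigma> (t, x)"
    and r: "r > 0"
begin

abbreviation rhs_of where "rhs_of p L \<equiv> cell_rhs W \<sigma> p L"

lemma C12: "C1 \<ge> 0" "C2 \<ge> 0"
  using W_lip \<sigma>_lip lipschitz_on_nonneg by blast+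

lemma deriv_W_lip: "\<bar>deriv W a - deriv W b\<bar> \<le> C1 * \<bar>a - b\<bar>"
  using lipschitz_onD[OF W_lip, of a b] by (simp add: dist_real_def)

lemma deriv_W_per: "deriv W (v + 1) = deriv W v"
proof -
  have "(W has_real_derivative deriv W (v + 1)) (at (v + 1))"
    using W_diff[of "v + 1"] by (simp add: DERIV_deriv_iff_real_differentiable)
  then have "((\<lambda>x. W (x + 1)) has_real_derivative deriv W (v + 1)) (at v)" by (simp add: DERIV_shift)
  then show ?thesis by (simp add: W_per DERIV_imp_deriv)
qed

text \<open>Fractional parts lie within one period, where the Lipschitz bound gives
  \<open>C1\<close>.\<close>

lemma deriv_W_osc: "\<bar>deriv W a - deriv W b\<bar> \<le> C1"
proof -
  have "deriv W v = deriv W (frac v)" for v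
    using periodic_shift_int[of "deriv W" "frac v" "\<lfloor>v\<rfloor>"] deriv_W_per by (simp add: frac_def)
  then have "\<bar>deriv W a - deriv W b\<bar> \<le> C1 * \<bar>frac a - frac b\<bar>" using deriv_W_lip by metis
  also have "\<dots> \<le> C1 * 1"
  proof (rule mult_left_mono[OF _ C12(1)])
    show "\<bar>frac a - frac b\<bar> \<le> 1"
      using frac_ge_0[of a] frac_ge_0[of b] frac_lt_1[of a] frac_lt_1[of b] by linarith
  qed
  finally show ?thesis by simp
qed

lemma \<sigma>_lipschitz:
  assumes "t \<ge> 0" "t' \<ge> 0"
  shows "\<bar>\<sigma> (t, x) - \<sigma> (t', x')\<bar> \<le> C2 * (\<bar>t - t'\<bar> + norm (x - x'))"
proof -
  have "\<bar>\<sigma> (t, x) - \<sigma> (t', x')\<bar> \<le> C2 * dist (t, x) (t', x')"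
    using lipschitz_onD[OF \<sigma>_lip, of "(t, x)" "(t', x')"] assms by (simp add: space_time_def dist_real_def)
  also have "\<dots> \<le> C2 * (\<bar>t - t'\<bar> + norm (x - x'))"
    using norm_Pair_le[of "t - t'" "x - x'"] C12 by (intro mult_left_mono) (auto simp: dist_norm)
  finally show ?thesis .
qed

definition forcing_osc where "forcing_osc = C2 * (1 + real CARD('n))"

text \<open>Periodicity moves \<open>(t, x)\<close> to a time in \<open>[0, 1]\<close> and a point
  of norm at most the dimension, where the Lipschitz bound applies.\<close>

lemma \<sigma>_osc: "t \<ge> 0 \<Longrightarrow> \<bar>\<sigma> (t, x) - \<sigma> (0, 0)\<bar> \<le> forcing_osc"
proof -
  assume t: "t \<ge> 0"
  have nat: "\<sigma> (s + real n, x) = \<sigma> (s, x)" if "s \<ge> 0" for s n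
  proof (induction n)
    case (Suc n)
    have "\<sigma> (s + real (Suc n), x) = \<sigma> ((s + real n) + 1, x)" by (simp add: algebra_simps)
    then show ?case using \<sigma>_per_t[of "s + real n" x] that Suc by simp
  qed simp
  define s where "s = frac t"
  have s: "0 \<le> s" "s \<le> 1" using frac_ge_0[of t] frac_lt_1[of t] by (auto simp: s_def less_imp_le)
  have "t = s + real (nat \<lfloor>t\<rfloor>)" using t by (simp add: s_def frac_def)
  then have 1: "\<sigma> (t, x) = \<sigma> (s, x)" using nat[OF s(1)] by metis
  obtain k where k: "\<forall>i. k $ i \<in> \<int>" "norm (x - k) \<le> real CARD('n)" using integer_vector_dense by blast
  have "\<sigma> (s, x) = \<sigma> (s, x - k)" using \<sigma>_per_x[OF s(1) k(1), of "x - k"] by simp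
  then have "\<bar>\<sigma> (t, x) - \<sigma> (0, 0)\<bar> \<le> C2 * (\<bar>s - 0\<bar> + norm (x - k - 0))"
    unfolding 1 using \<sigma>_lipschitz[OF s(1), of 0 "x - k" 0] by simp
  also have "\<dots> \<le> forcing_osc" unfolding forcing_osc_def using s k C12 by (intro mult_left_mono) auto
  finally show ?thesis .
qed

definition Cp where "Cp p = C1 * (1 + norm p) + C2" for p :: "real^'n"
definition Fp where "Fp L = \<bar>L\<bar> + (\<bar>deriv W 0\<bar> + C1) + (\<bar>\<sigma> (0, 0)\<bar> + forcing_osc)" for L
text \<open>Unlike \<open>Cp\<close> and \<open>Fp\<close>, this constant depends neither on
  \<open>p\<close> nor on \<open>L\<close>: \<open>C1\<close> bounds the oscillation of
  \<open>deriv W\<close>, twice \<open>forcing_osc\<close> that of \<open>\<sigma>\<close>.\<close>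

definition F0 where "F0 = C1 + 2 * forcing_osc"

lemma rhs_cell: "rhs (rhs_of p L) (Cp p) (Fp L)"
proof
  fix t t' :: real and x x' :: "real^'n" and a a' :: real
  assume t: "t \<ge> 0"
  show "\<bar>rhs_of p L t x a\<bar> \<le> Fp L"
    using deriv_W_osc[of "a + p \<bullet> x" 0] \<sigma>_osc[OF t, of x] unfolding cell_rhs_def Fp_def by linarith
  assume t': "t' \<ge> 0"
  let ?n = "norm (x - x')"
  have pn: "\<bar>p \<bullet> x - p \<bullet> x'\<bar> \<le> norm p * ?n"
    using Cauchy_Schwarz_ineq2[of p "x - x'"] by (simp add: inner_diff_right)
  have "\<bar>deriv W (a + p \<bullet> x) - deriv W (a' + p \<bullet> x')\<bar> \<le> C1 * \<bar>(a + p \<bullet> x) - (a' + p \<bullet> x')\<bar>"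
    by (rule deriv_W_lip)
  also have "\<dots> \<le> C1 * (\<bar>a - a'\<bar> + norm p * ?n)" using pn C12 by (intro mult_left_mono) linarith+
  also have "\<dots> \<le> C1 * ((1 + norm p) * (\<bar>t - t'\<bar> + ?n + \<bar>a - a'\<bar>))"
  proof (rule mult_left_mono[OF _ C12(1)])
    have "0 \<le> norm p * \<bar>a - a'\<bar>" "0 \<le> norm p * \<bar>t - t'\<bar>" by simp_all
    then show "\<bar>a - a'\<bar> + norm p * ?n \<le> (1 + norm p) * (\<bar>t - t'\<bar> + ?n + \<bar>a - a'\<bar>)"
      by (simp add: algebra_simps)
  qed
  finally have 1: "\<bar>deriv W (a + p \<bullet> x) - deriv W (a' + p \<bullet> x')\<bar> \<le> C1 * (1 + norm p) * (\<bar>t - t'\<bar> + ?n + \<bar>a - a'\<bar>)"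
    by (simp add: mult.assoc)
  have "\<bar>\<sigma> (t, x) - \<sigma> (t', x')\<bar> \<le> C2 * (\<bar>t - t'\<bar> + ?n)" by (rule \<sigma>_lipschitz[OF t t'])
  also have "\<dots> \<le> C2 * (\<bar>t - t'\<bar> + ?n + \<bar>a - a'\<bar>)" using C12 by (intro mult_left_mono) auto
  finally show "\<bar>rhs_of p L t x a - rhs_of p L t' x' a'\<bar> \<le> Cp p * (\<bar>t - t'\<bar> + ?n + \<bar>a - a'\<bar>)"
    using 1 unfolding cell_rhs_def Cp_def distrib_right[of _ C2] by linarith
qed

lemma nonlocal_rhs_cell: "nonlocal_rhs g (rhs_of p L) (Cp p) (Fp L)"
  by (intro nonlocal_rhs.intro levy_kernel_axioms rhs_cell)

lemma periodic_cell: "periodic_rhs (rhs_of p L) F0"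
  unfolding periodic_rhs_def
proof (intro conjI allI impI)
  fix t :: real and x y :: "real^'n" and a b :: real assume t: "t \<ge> 0"
  show "rhs_of p L t x (a + 1) = rhs_of p L t x a"
    using deriv_W_per[of "a + p \<bullet> x"] by (simp add: cell_rhs_def algebra_simps)
  show "rhs_of p L (t + 1) x a = rhs_of p L t x a" by (simp add: cell_rhs_def \<sigma>_per_t[OF t])
  show "\<bar>rhs_of p L t x a - rhs_of p L t y b\<bar> \<le> F0"
    using deriv_W_osc[of "a + p \<bullet> x" "b + p \<bullet> y"] \<sigma>_osc[OF t, of x] \<sigma>_osc[OF t, of y]
    unfolding cell_rhs_def F0_def by linarith
next
  fix k :: "real^'n" assume k: "\<forall>i. k $ i \<in> \<int>"
  show "\<exists>c. \<forall>t\<ge>0. \<forall>x a. rhs_of p L t (x + k) (a - c) = rhs_of p L t x a"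
    \<comment> \<open>Lowering the value by \<open>p \<bullet> k\<close> cancels the change of
      \<open>p \<bullet> x\<close> under the shift, so the argument of \<open>deriv W\<close> is
      unchanged.\<close>
    by (rule exI[of _ "p \<bullet> k"]) (auto simp: cell_rhs_def \<sigma>_per_x[OF _ k] inner_add_right)
qed

definition cell_growth where "cell_growth p = levy_kernel.weight_bound g r + Cp p + 1"

lemma growth_eq: "nonlocal_rhs.growth g (Cp p) r = cell_growth p"
  using nonlocal_rhs.growth_def[OF nonlocal_rhs_cell] by (simp add: cell_growth_def)

text \<open>The effective Hamiltonian refers to arbitrary viscosity solutions. By uniqueness they
  agree on space-time with one that has both representations, and the arguments below work with that
  one.\<close>

definition constructed_solution where
  "constructed_solution p L w \<longleftrightarrow> limit_solution g (rhs_of p L) (Fp L) (cell_growth p) w \<and> scheme_limit g (rhs_of p L) (Cp p) (Fp L) w"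

lemma constructed_solution_exists: "\<exists>w. constructed_solution p L w"
  using nonlocal_rhs.limit_solution_exists[OF nonlocal_rhs_cell r]
  unfolding constructed_solution_def growth_eq by metis

lemma constructed_solution_properties:
  assumes "constructed_solution p L w"
  shows "continuous_on space_time w" "0 \<le> t \<Longrightarrow> \<bar>w (t, x)\<bar> \<le> Fp L * t"
    "visc_sub g r (rhs_of p L) T w" "visc_sub g r (dual_rhs (rhs_of p L)) T (\<lambda>q. - w q)"
proof -
  have l: "limit_solution g (rhs_of p L) (Fp L) (nonlocal_rhs.growth g (Cp p) r) w"
    using assms unfolding constructed_solution_def growth_eq by blast
  show "continuous_on space_time w" "0 \<le> t \<Longrightarrow> \<bar>w (t, x)\<bar> \<le> Fp L * t" "visc_sub g r (rhs_of p L) T w"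
    using nonlocal_rhs.limit_solution_properties[OF nonlocal_rhs_cell r l] by blast+
  interpret N: nonlocal_rhs g "rhs_of p L" "Cp p" "Fp L" by (rule nonlocal_rhs_cell)
  show "visc_sub g r (dual_rhs (rhs_of p L)) T (\<lambda>q. - w q)"
    using nonlocal_rhs.limit_solution_properties(3)[OF N.nonlocal_rhs_dual r limit_solution_dual[OF l]] .
qed

lemma cell_solution_constructed:
  assumes "constructed_solution p L w"
  shows "cell_solution g W \<sigma> r p L w"
proof -
  note gp = constructed_solution_properties[OF assms]
  have "bounded (w ` ({0<..<T} \<times> UNIV))" if T: "T > 0" for T
    unfolding bounded_iff
  proof (intro exI ballI)
    fix y assume "y \<in> w ` ({0<..<T} \<times> UNIV)"
    then obtain t x where y: "y = w (t, x)" "0 < t" "t < T" by auto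
    have F: "Fp L \<ge> 0" using gp(2)[of 1 0] by simp
    have "\<bar>y\<bar> \<le> Fp L * t" using gp(2)[of t x] y by simp
    also have "\<dots> \<le> Fp L * T" using y F by (intro mult_left_mono) auto
    finally show "norm y \<le> Fp L * T" by simp
  qed
  then have "w \<in> C_b" unfolding C_b_iff using continuous_imp_usc[OF gp(1)] by blast
  moreover have "w (0, x) = 0" for x using gp(2)[of 0 x] by simp
  ultimately show ?thesis unfolding cell_solution_iff using gp(3,4) by blast
qed

text \<open>Used with \<open>\<epsilon> = 0\<close> and equal data for uniqueness, with
  \<open>\<epsilon> = 0\<close> and ordered \<open>L\<close> for monotonicity, and with positive
  \<open>\<epsilon>\<close> for continuity.\<close>

lemma cell_solution_compare:
  assumes w: "constructed_solution p L w" and u: "cell_solution g W \<sigma> r p' L' u" and t: "0 \<le> t" and \<epsilon>: "\<epsilon> \<ge> 0"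
  shows "(\<And>t x a. 0 < t \<Longrightarrow> rhs_of p' L' t x a \<le> rhs_of p L t x a + \<epsilon> * log_weight x) \<Longrightarrow>
      u (t, x) \<le> w (t, x) + \<epsilon> * exp (cell_growth p * t) * log_weight x"
    and "(\<And>t x a. 0 < t \<Longrightarrow> rhs_of p L t x a \<le> rhs_of p' L' t x a + \<epsilon> * log_weight x) \<Longrightarrow>
      w (t, x) \<le> u (t, x) + \<epsilon> * exp (cell_growth p * t) * log_weight x"
proof -
  have l: "limit_solution g (rhs_of p L) (Fp L) (nonlocal_rhs.growth g (Cp p) r) w"
    using w unfolding constructed_solution_def growth_eq by blast
  interpret N: nonlocal_rhs g "rhs_of p L" "Cp p" "Fp L" by (rule nonlocal_rhs_cell)
  have u': "u \<in> C_b" "\<And>x. u (0, x) = 0" "\<And>T. visc_sub g r (rhs_of p' L') T u"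
    "\<And>T. visc_sub g r (dual_rhs (rhs_of p' L')) T (\<lambda>q. - u q)"
    using u unfolding cell_solution_iff by blast+
  note bd = C_b_bound[OF u'(1)]
  have sc: "upper_semicontinuous_on space_time u" "upper_semicontinuous_on space_time (\<lambda>q. - u q)"
    using u'(1) usc_uminus unfolding C_b_iff by blast+
  show "u (t, x) \<le> w (t, x) + \<epsilon> * exp (cell_growth p * t) * log_weight x"
    if "\<And>t x a. 0 < t \<Longrightarrow> rhs_of p' L' t x a \<le> rhs_of p L t x a + \<epsilon> * log_weight x"
    using N.subsolution_le[OF r l u'(3) sc(1) _ bd that \<epsilon> t, of x] by (simp add: u'(2) growth_eq)
  show "w (t, x) \<le> u (t, x) + \<epsilon> * exp (cell_growth p * t) * log_weight x"
    if f: "\<And>t x a. 0 < t \<Longrightarrow> rhs_of p L t x a \<le> rhs_of p' L' t x a + \<epsilon> * log_weight x"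
  proof -
    have "dual_rhs (rhs_of p' L') t x a \<le> dual_rhs (rhs_of p L) t x a + \<epsilon> * log_weight x" if "0 < t" for t x a
      using f[OF that, of x "- a"] unfolding dual_rhs_def by linarith
    from nonlocal_rhs.subsolution_le[OF N.nonlocal_rhs_dual r limit_solution_dual[OF l] u'(4) sc(2) _ _ this \<epsilon> t, of x]
    have "- u (t, x) \<le> - w (t, x) + \<epsilon> * exp (cell_growth p * t) * log_weight x"
      using bd by (simp add: u'(2) growth_eq)
    then show ?thesis by linarith
  qed
qed

lemma cell_solution_unique:
  assumes w: "constructed_solution p L w" and u: "cell_solution g W \<sigma> r p L u" and q: "q \<in> space_time"
  shows "u q = w q"
proof -
  obtain t x where q': "q = (t, x)" "0 \<le> t" using q by (cases q) (auto simp: space_time_def)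
  have "u (t, x) \<le> w (t, x)" "w (t, x) \<le> u (t, x)"
    using cell_solution_compare[OF w u q'(2), of 0 x] by simp_all
  then show ?thesis by (simp add: q')
qed

text \<open>\<open>Q\<close> precedes \<open>p\<close> and \<open>L\<close> because
  \<open>F0\<close> and the spread constant depend on neither.\<close>

lemma uniform_growth:
  obtains Q where "\<And>p L w. constructed_solution p L w \<Longrightarrow>
    \<exists>l. has_growth_rate w l \<and> (\<forall>n. \<bar>w (real n, 0) - real n * l\<bar> \<le> Q)"
proof -
  obtain \<kappa> where \<kappa>: "\<kappa> > 0" "\<And>f C F F0 w. rhs f C F \<Longrightarrow> periodic_rhs f F0 \<Longrightarrow> scheme_limit g f C F w \<Longrightarrow>
    (\<forall>n t x. 0 \<le> t \<longrightarrow> \<bar>w (t + real n, x) - w (t, x) - w (real n, 0)\<bar> \<le> 2 + F0 / \<kappa>)"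
    using scheme_limit_oscillation by blast
  have "\<exists>l. has_growth_rate w l \<and> (\<forall>n. \<bar>w (real n, 0) - real n * l\<bar> \<le> 2 + F0 / \<kappa>)" if w: "constructed_solution p L w" for p L w
  proof -
    have "scheme_limit g (rhs_of p L) (Cp p) (Fp L) w" using w unfolding constructed_solution_def by blast
    from \<kappa>(2)[OF rhs_cell periodic_cell this]
    have "\<bar>w (t + real n, x) - w (t, x) - w (real n, 0)\<bar> \<le> 2 + F0 / \<kappa>" if "0 \<le> t" for n t x
      using that by blast
    from growth_rate_exists[OF this constructed_solution_properties(2)[OF w]] show ?thesis by metis
  qed
  then show ?thesis using that by blast
qed

lemma effective_hamiltonian_eq:
  assumes "constructed_solution p L w" "has_growth_rate w l"
  shows "effective_hamiltonian g W \<sigma> r p L = l"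
  unfolding effective_hamiltonian_def
proof (rule the_equality)
  show "\<exists>w. cell_solution g W \<sigma> r p L w \<and> has_growth_rate w l"
    using cell_solution_constructed assms by blast
  show "l' = l" if ex: "\<exists>u. cell_solution g W \<sigma> r p L u \<and> has_growth_rate u l'" for l'
  proof -
    obtain u where u: "cell_solution g W \<sigma> r p L u" "has_growth_rate u l'" using ex by blast
    show ?thesis by (rule growth_rate_unique[OF assms(2) u(2) cell_solution_unique[OF assms(1) u(1)]])
  qed
qed

lemma effective_hamiltonian_approx:
  obtains Q where "\<And>p L w n. constructed_solution p L w \<Longrightarrow>
    \<bar>w (real n, 0) - real n * effective_hamiltonian g W \<sigma> r p L\<bar> \<le> Q"
  using uniform_growth effective_hamiltonian_eq by metis

text \<open>Beyond radius \<open>R\<close> the weight exceeds the whole oscillation of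
  \<open>deriv W\<close>, however far apart its arguments are; inside, their distance is at most
  \<open>norm (p - p') * \<bar>R\<bar>\<close>. The resulting \<open>d\<close> is uniform in all
  parameters.\<close>

lemma rhs_perturb:
  assumes \<epsilon>: "\<epsilon> > 0"
  obtains d where "d > 0" "\<And>p p' L L' t x a. norm (p - p') < d \<Longrightarrow> \<bar>L - L'\<bar> < d \<Longrightarrow>
    rhs_of p' L' t x a \<le> rhs_of p L t x a + \<epsilon> * log_weight x"
proof -
  obtain R where R: "\<And>x::real^'n. R < norm x \<Longrightarrow> 2 * C1 / \<epsilon> \<le> log_weight x" using log_weight_coercive by blast
  define d where "d = min (\<epsilon> / 2) (\<epsilon> / (2 * (C1 * \<bar>R\<bar> + 1)))"
  have C1R: "C1 * \<bar>R\<bar> + 1 > 0" using C12 by (simp add: add_nonneg_pos)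
  have d: "d > 0" using \<epsilon> C1R by (simp add: d_def)
  have "rhs_of p' L' t x a \<le> rhs_of p L t x a + \<epsilon> * log_weight x"
    if p: "norm (p - p') < d" and L: "\<bar>L - L'\<bar> < d" for p p' L L' t x a
  proof -
    have l1: "\<epsilon> / 2 \<le> \<epsilon> / 2 * log_weight x" using mult_left_mono[OF log_weight_ge_1[of x], of "\<epsilon> / 2"] \<epsilon> by simp
    have W: "\<bar>deriv W (a + p \<bullet> x) - deriv W (a + p' \<bullet> x)\<bar> \<le> \<epsilon> / 2 * log_weight x"
    proof (cases "R < norm x")
      case True
      have "\<bar>deriv W (a + p \<bullet> x) - deriv W (a + p' \<bullet> x)\<bar> \<le> C1" by (rule deriv_W_osc)
      also have "C1 \<le> \<epsilon> / 2 * log_weight x" using R[OF True] \<epsilon> by (simp add: field_simps)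
      finally show ?thesis .
    next
      case False
      have "\<bar>deriv W (a + p \<bullet> x) - deriv W (a + p' \<bullet> x)\<bar> \<le> C1 * \<bar>(p - p') \<bullet> x\<bar>"
        using deriv_W_lip[of "a + p \<bullet> x" "a + p' \<bullet> x"] by (simp add: inner_diff_left)
      also have "\<dots> \<le> C1 * (d * \<bar>R\<bar>)"
      proof (rule mult_left_mono[OF _ C12(1)])
        have "\<bar>(p - p') \<bullet> x\<bar> \<le> norm (p - p') * norm x" by (rule Cauchy_Schwarz_ineq2)
        also have "\<dots> \<le> d * \<bar>R\<bar>" using p d False by (intro mult_mono) auto
        finally show "\<bar>(p - p') \<bullet> x\<bar> \<le> d * \<bar>R\<bar>" .
      qed
      also have "\<dots> \<le> d * (C1 * \<bar>R\<bar> + 1)" using d by (simp add: algebra_simps)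
      also have "\<dots> \<le> \<epsilon> / 2"
      proof -
        have "d \<le> \<epsilon> / (2 * (C1 * \<bar>R\<bar> + 1))" by (simp add: d_def)
        then show ?thesis using C1R by (simp add: field_simps)
      qed
      finally show ?thesis using l1 by linarith
    qed
    have "d \<le> \<epsilon> / 2" unfolding d_def by (rule min.cobounded1)
    then have "L' - L \<le> \<epsilon> / 2 * log_weight x" using L l1 by linarith
    moreover have "\<epsilon> * log_weight x = \<epsilon> / 2 * log_weight x + \<epsilon> / 2 * log_weight x" by simp
    ultimately show ?thesis using W unfolding cell_rhs_def by linarith
  qed
  then show ?thesis using that d by blast
qed

text \<open>At a fixed large time \<open>n\<close>, the Hamiltonian is \<open>w (n, 0) / n\<close>
  up to \<open>Q / n\<close> uniformly in the parameters, and \<open>w (n, 0)\<close> changes by at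
  most 1 under a small change of \<open>(p, L)\<close>.\<close>

lemma effective_hamiltonian_continuous:
  "continuous_on UNIV (\<lambda>(p, L). effective_hamiltonian g W \<sigma> r p L)"
  unfolding continuous_on_iff
proof (intro ballI allI impI)
  fix q0 :: "(real^'n) \<times> real" and e :: real assume e: "e > 0"
  obtain p0 L0 where q0: "q0 = (p0, L0)" by (cases q0)
  obtain Q where Q: "\<And>p L w n. constructed_solution p L w \<Longrightarrow>
    \<bar>w (real n, 0) - real n * effective_hamiltonian g W \<sigma> r p L\<bar> \<le> Q"
    using effective_hamiltonian_approx by blast
  obtain w0 where w0: "constructed_solution p0 L0 w0" using constructed_solution_exists by blast
  obtain n :: nat where n: "(2 * \<bar>Q\<bar> + 1) / e < real n" using reals_Archimedean2 by blast
  have "(2 * \<bar>Q\<bar> + 1) / e > 0" using e by (simp add: add_nonneg_pos)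
  then have np: "real n > 0" using n by linarith
  have ne: "2 * \<bar>Q\<bar> + 1 < real n * e" using n e by (simp add: field_simps)
  \<comment> \<open>Chosen so that the comparison error at time \<open>n\<close> and at the origin,
    where the weight is 1, equals 1.\<close>
  define \<epsilon> where "\<epsilon> = 1 / exp (cell_growth p0 * real n)"
  have \<epsilon>: "\<epsilon> > 0" by (simp add: \<epsilon>_def)
  have \<epsilon>1: "\<epsilon> * exp (cell_growth p0 * real n) * log_weight (0::real^'n) = 1" by (simp add: \<epsilon>_def log_weight_def)
  obtain d where d: "d > 0" "\<And>p p' L L' t x a. norm (p - p') < d \<Longrightarrow> \<bar>L - L'\<bar> < d \<Longrightarrow>
    rhs_of p' L' t x a \<le> rhs_of p L t x a + \<epsilon> * log_weight x"
    using rhs_perturb[OF \<epsilon>] by metis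
  show "\<exists>d>0. \<forall>q\<in>UNIV. dist q q0 < d \<longrightarrow> dist (case q of (p, L) \<Rightarrow> effective_hamiltonian g W \<sigma> r p L)
      (case q0 of (p, L) \<Rightarrow> effective_hamiltonian g W \<sigma> r p L) < e"
  proof (intro exI[of _ d] conjI ballI impI d(1))
    fix q :: "(real^'n) \<times> real" assume dq: "dist q q0 < d"
    obtain p L where q: "q = (p, L)" by (cases q)
    have pl: "norm (p - p0) < d" "\<bar>L - L0\<bar> < d"
      using dq norm_fst_le[of "p - p0" "L - L0"] norm_snd_le[of "L - L0" "p - p0"]
      by (auto simp: q q0 dist_norm)
    then have pl': "norm (p0 - p) < d" "\<bar>L0 - L\<bar> < d" by (simp_all add: norm_minus_commute abs_minus_commute)
    obtain w where w: "constructed_solution p L w" using constructed_solution_exists by blast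
    have n0: "0 \<le> real n" by simp
    \<comment> \<open>Both inequalities are taken relative to \<open>w0\<close>, so the growth
      constant is that of \<open>p0\<close> and stays fixed while \<open>(p, L)\<close>
      varies.\<close>
    have "w (real n, 0) \<le> w0 (real n, 0) + 1" "w0 (real n, 0) \<le> w (real n, 0) + 1"
      using cell_solution_compare[OF w0 cell_solution_constructed[OF w] n0 less_imp_le[OF \<epsilon>], where x = 0]
        d(2)[OF pl] d(2)[OF pl'] unfolding \<epsilon>1 by blast+
    moreover let ?h = "effective_hamiltonian g W \<sigma> r p L" and ?k = "effective_hamiltonian g W \<sigma> r p0 L0"
    have "\<bar>w (real n, 0) - real n * ?h\<bar> \<le> Q" "\<bar>w0 (real n, 0) - real n * ?k\<bar> \<le> Q"
      by (rule Q[OF w] Q[OF w0])+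
    ultimately have "\<bar>real n * ?h - real n * ?k\<bar> < real n * e" using ne by linarith
    then have "real n * \<bar>?h - ?k\<bar> < real n * e" by (simp add: right_diff_distrib[symmetric] abs_mult)
    then show "dist (case q of (p, L) \<Rightarrow> effective_hamiltonian g W \<sigma> r p L)
      (case q0 of (p, L) \<Rightarrow> effective_hamiltonian g W \<sigma> r p L) < e"
      using np by (simp add: q q0 dist_real_def)
  qed
qed

text \<open>Ordered solutions with linear rates can violate the order of the rates by at most
  \<open>2 * Q / n\<close>, for every \<open>n\<close>.\<close>

lemma effective_hamiltonian_mono: "mono (\<lambda>L. effective_hamiltonian g W \<sigma> r p L)"
proof (rule monoI)
  fix L L' :: real assume LL: "L \<le> L'"
  obtain Q where Q: "\<And>p L w n. constructed_solution p L w \<Longrightarrow>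
    \<bar>w (real n, 0) - real n * effective_hamiltonian g W \<sigma> r p L\<bar> \<le> Q"
    using effective_hamiltonian_approx by blast
  obtain w w' where w: "constructed_solution p L w" "constructed_solution p L' w'" using constructed_solution_exists by blast
  let ?h = "effective_hamiltonian g W \<sigma> r p L" and ?h' = "effective_hamiltonian g W \<sigma> r p L'"
  have le: "w (t, x) \<le> w' (t, x)" if "0 \<le> t" for t x
    using cell_solution_compare(1)[OF w(2) cell_solution_constructed[OF w(1)] that, of 0 x] LL
    by (simp add: cell_rhs_def)
  show "?h \<le> ?h'"
  proof (rule ccontr)
    assume "\<not> ?h \<le> ?h'"
    then have pos: "?h - ?h' > 0" by simp
    obtain n :: nat where "2 * Q / (?h - ?h') < real n" using reals_Archimedean2 by blast
    then have "2 * Q < real n * ?h - real n * ?h'" using pos by (simp add: field_simps)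
    moreover have "\<bar>w (real n, 0) - real n * ?h\<bar> \<le> Q" "\<bar>w' (real n, 0) - real n * ?h'\<bar> \<le> Q"
      by (rule Q[OF w(1)] Q[OF w(2)])+
    moreover have "w (real n, 0) \<le> w' (real n, 0)" by (rule le) simp
    ultimately show False by linarith
  qed
qed

end

theorem theorem1p1:
  fixes g :: "real^'n \<Rightarrow> real"
    and W :: "real \<Rightarrow> real"
    and \<sigma> :: "real \<times> (real^'n) \<Rightarrow> real"
    and r :: real
  assumes g_continuous: "continuous_on (sphere 0 1) g"
    and g_positive: "\<forall>z \<in> sphere 0 1. g z > 0"
    and g_even: "\<forall>z \<in> sphere 0 1. g (- z) = g z"
    and W_differentiable: "\<forall>v. W differentiable (at v)"
    and W_deriv_lipschitz: "\<exists>C. C-lipschitz_on UNIV (deriv W)"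
    and W_periodic: "\<forall>v. W (v + 1) = W v"
    and \<sigma>_lipschitz: "\<exists>C. C-lipschitz_on space_time \<sigma>"
    and \<sigma>_periodic_time: "\<forall>t\<ge>0. \<forall>x. \<sigma> (t + 1, x) = \<sigma> (t, x)"
    and \<sigma>_periodic_space:
      "\<forall>t\<ge>0. \<forall>x k. (\<forall>i. k $ i \<in> \<int>) \<longrightarrow> \<sigma> (t, x + k) = \<sigma> (t, x)"
    and r_positive: "r > 0"
  shows "(\<forall>L p. \<exists>w. cell_solution g W \<sigma> r p L w \<and>
            (\<forall>w'. cell_solution g W \<sigma> r p L w' \<longrightarrow> (\<forall>q \<in> space_time. w' q = w q)) \<and>
            (\<exists>!l. has_growth_rate w l)) \<and>
         continuous_on UNIV (\<lambda>(p, L). effective_hamiltonian g W \<sigma> r p L) \<and>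
         (\<forall>p. mono (\<lambda>L. effective_hamiltonian g W \<sigma> r p L))"
proof -
  obtain C1 C2 where C: "C1-lipschitz_on UNIV (deriv W)" "C2-lipschitz_on space_time \<sigma>"
    using W_deriv_lipschitz \<sigma>_lipschitz by blast
  interpret cell_problem g W \<sigma> r C1 C2
    by unfold_locales
      (use assms C in \<open>auto simp: \<sigma>_periodic_time \<sigma>_periodic_space\<close>)
  have "\<exists>w. cell_solution g W \<sigma> r p L w \<and>
            (\<forall>w'. cell_solution g W \<sigma> r p L w' \<longrightarrow> (\<forall>q \<in> space_time. w' q = w q)) \<and>
            (\<exists>!l. has_growth_rate w l)" for L p
  proof -
    obtain w where w: "constructed_solution p L w" using constructed_solution_exists by blast
    obtain l where l: "has_growth_rate w l" using uniform_growth w by metis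
    have "l' = l" if "has_growth_rate w l'" for l' by (rule growth_rate_unique[OF l that]) simp
    then have "\<exists>!l. has_growth_rate w l" using l by blast
    then show ?thesis using cell_solution_constructed[OF w] cell_solution_unique[OF w] by blast
  qed
  then show ?thesis using effective_hamiltonian_continuous effective_hamiltonian_mono by blast
qed

end
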